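(* Let $D\subseteq\mathbb{C}$ be a domain and let $\mathcal{F}$ be a family of meromorphic functions on $D$ such that every $f\in\mathcal{F}$ satisfies $f(z)\neq 0$ for all $z\in D$ and all poles of every $f\in\mathcal{F}$ are multiple (i.e. have multiplicity at least $2$). Let $h$ be a meromorphic function on $D$ with $h(z)\neq 0$ for all $z\in D$, $h\not\equiv\infty$, and all poles of $h$ simple. Let $Q[f]$ be the differential polynomial described in the context, of weight $w$. If, for each $f\in\mathcal{F}$, the function $Q[f]-h$ has at most $w-1$ distinct zeros in $D$ (ignoring multiplicities), then $\mathcal{F}$ is normal in $D$.
   Context: Fix integers $k\geq 1$ and non-negative integers $p_0,p_1,\ldots,p_k,q_1,\ldots,q_k$ with $p_i\geq q_i$ for $i=1,\ldots,k$ and $q':=\sum_{i=1}^k q_i>0$. For a meromorphic function $f$, set $$Q[f]:=f^{p_0}\,(f^{p_1})^{(q_1)}\,(f^{p_2})^{(q_2)}\cdots(f^{p_k})^{(q_k)},$$ where $(f^{p})^{(q)}$ denotes the $q$-th derivative of $f^p$. With $p':=\sum_{i=1}^k p_i$, the degree of $Q[f]$ is $d:=p_0+p'$ and its weight is $w:=d+q'$. A family $\mathcal{F}$ of meromorphic functions on $D$ is normal in $D$ if every sequence in $\mathcal{F}$ has a subsequence converging locally uniformly in $D$ with respect to the spherical metric to a limit that is either meromorphic on $D$ or identically $\infty$. *)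

theory Defs
  imports "HOL-Complex_Analysis.Complex_Analysis"
begin

text \<open>Extended complex values: None represents the point at infinity.
  A nicely meromorphic function takes the value infinity exactly at its poles.\<close>
definition ext_val :: "(complex \<Rightarrow> complex) \<Rightarrow> complex \<Rightarrow> complex option" where
  "ext_val f z = (if is_pole f z then None else Some (f z))"

fun chordal :: "complex option \<Rightarrow> complex option \<Rightarrow> real" where
  "chordal (Some a) (Some b) =
     2 * cmod (a - b) / (sqrt (1 + (cmod a)\<^sup>2) * sqrt (1 + (cmod b)\<^sup>2))"
| "chordal (Some a) None = 2 / sqrt (1 + (cmod a)\<^sup>2)"
| "chordal None (Some b) = 2 / sqrt (1 + (cmod b)\<^sup>2)"
| "chordal None None = 0"

definition sph_loc_unif :: "(nat \<Rightarrow> complex \<Rightarrow> complex option) \<Rightarrow> (complex \<Rightarrow> complex option)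
    \<Rightarrow> complex set \<Rightarrow> bool" where
  "sph_loc_unif g G D \<longleftrightarrow>
     (\<forall>K. K \<subseteq> D \<longrightarrow> compact K \<longrightarrow>
        (\<forall>e::real>0. \<forall>\<^sub>F n in sequentially. \<forall>z\<in>K. chordal (g n z) (G z) < e))"

definition normal_family_sph :: "(complex \<Rightarrow> complex) set \<Rightarrow> complex set \<Rightarrow> bool" where
  "normal_family_sph Fam D \<longleftrightarrow>
     (\<forall>f::nat \<Rightarrow> complex \<Rightarrow> complex. (\<forall>n. f n \<in> Fam) \<longrightarrow>
        (\<exists>r::nat \<Rightarrow> nat. strict_mono r \<and>
           ((\<exists>g. g nicely_meromorphic_on D \<and>
                 sph_loc_unif (\<lambda>n. ext_val (f (r n))) (ext_val g) D)
            \<or> sph_loc_unif (\<lambda>n. ext_val (f (r n))) (\<lambda>_. None) D)))"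

definition diffpoly :: "nat \<Rightarrow> (nat \<Rightarrow> nat) \<Rightarrow> (nat \<Rightarrow> nat) \<Rightarrow> (complex \<Rightarrow> complex)
    \<Rightarrow> complex \<Rightarrow> complex" where
  "diffpoly k p q f z =
     f z ^ p 0 * (\<Prod>i\<in>{1..k}. (deriv ^^ q i) (\<lambda>x. f x ^ p i) z)"

definition diffpoly_weight :: "nat \<Rightarrow> (nat \<Rightarrow> nat) \<Rightarrow> (nat \<Rightarrow> nat) \<Rightarrow> nat" where
  "diffpoly_weight k p q = p 0 + (\<Sum>i\<in>{1..k}. p i) + (\<Sum>i\<in>{1..k}. q i)"

text \<open>Zeros in D of the meromorphic function g (zeros of a meromorphic function:
  points where it tends to 0; if g vanishes identically, every point is a zero).\<close>
definition mero_zeros :: "(complex \<Rightarrow> complex) \<Rightarrow> complex set \<Rightarrow> complex set" where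
  "mero_zeros g D = {z\<in>D. (g \<longlongrightarrow> 0) (at z)}"

end

theory Submission
  imports Defs "HOL-Computational_Algebra.Fundamental_Theorem_Algebra" "HOL-Library.Diagonal_Subsequence"
begin

text \<open>
  Since the functions \<open>f\<close> have no zeros, one works with the holomorphic functions \<open>\<phi> = 1 / f\<close>; the spherical
  metric is invariant under inversion.

  At a point where \<open>h\<close> is finite, the rescaling lemma of Zalcman and Pang with exponent \<open>q' / d\<close> turns a non-normal
  sequence into a nonconstant entire \<open>\<psi>\<close> with bounded spherical derivative, multiple zeros, and such that \<open>Q[1 / \<psi>] - c\<close>
  has at most \<open>w - 1\<close> zeros for some \<open>c \<noteq> 0\<close>. Such a \<open>\<psi>\<close> has exponential type, and bounds for logarithmic derivatives
  on suitable circles show that it is a polynomial. For polynomials a Wronskian argument yields at least \<open>w\<close> zeros.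

  At a simple pole of \<open>h\<close>, normality in the punctured disc and the maximum principle leave only the case \<open>\<phi> \<rightarrow> \<infinity>\<close> with zeros
  of \<open>\<phi>\<close> running into the pole. Rescaling at the critical scale gives a nonconstant entire function for which \<open>Q[1 / \<psi>] - b / z\<close>
  has at most \<open>w - 1\<close> zeros; normality on the punctured plane shows that it is a polynomial, and the same count
  gives a contradiction.
\<close>

section \<open>Logarithmic derivatives on good circles\<close>

text \<open>The threshold \<open>w\<close> comes from the polynomial count. If \<open>P\<close> has
  degree \<open>M + 1\<close>, comparing the Wronskian of the numerator and \<open>P\<close> with
  their zeros gives at least \<open>(d - 1) * M + w\<close> solutions. For the right-hand side
  \<open>b / z\<close> the same number survives: clearing the denominator costs one degree, and this
  is paid for by the zeros of \<open>P\<close> being multiple. Multiplicity is also what removes the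
  singularities of the auxiliary function that excludes transcendental limits. The exponent
  \<open>q' / d\<close> is the one with \<open>a ^ d = \<rho> ^ q'\<close> for
  \<open>a = \<rho> powr (q' / d)\<close>; replacing \<phi> by
  \<open>a * \<phi> (y + \<rho> * z)\<close> then leaves the size of the right-hand side alone. At a
  simple pole the right-hand side itself grows like \<open>1 / \<rho>\<close>, so the balance
  becomes \<open>a ^ d = \<rho> ^ (q' - 1)\<close>. For \<open>q' = 1\<close> this corresponds to
  exponent 0, outside the reach of the rescaling lemma, and the centre of the rescaling has to stay
  at the pole. The critical scale is therefore found by hand from the zeros near the pole and from
  where the functions become large.\<close>

lemma half_plane_Schwarz:
  assumes F: "F holomorphic_on ball a r" and "r > 0"
    and pos: "\<And>z. z \<in> ball a r \<Longrightarrow> Re (F z) > 0" and z: "z \<in> ball a r"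
  shows "cmod (F z - F a) \<le> cmod (z - a) / r * cmod (F z + cnj (F a))"
proof -
  \<comment> \<open>The Cayley map \<open>u \<mapsto> (u - F a) / (u + cnj (F a))\<close> carries
    the right half-plane to the unit disc and \<open>F a\<close> to 0, so Schwarz's lemma applies
    after moving the disc to the unit disc.\<close>
  define G where "G = (\<lambda>\<xi>. (F (a + of_real r * \<xi>) - F a) / (F (a + of_real r * \<xi>) + cnj (F a)))"
  have mem: "a + of_real r * \<xi> \<in> ball a r" if "cmod \<xi> < 1" for \<xi>
    using that \<open>r > 0\<close> by (simp add: dist_norm norm_mult)
  have a: "a \<in> ball a r" using \<open>r > 0\<close> by simp
  have nz: "F (a + of_real r * \<xi>) + cnj (F a) \<noteq> 0" if "cmod \<xi> < 1" for \<xi>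
  proof -
    have "Re (F (a + of_real r * \<xi>) + cnj (F a)) > 0"
      using pos[OF mem[OF that]] pos[OF a] by simp
    then show ?thesis by (metis less_irrefl zero_complex.sel(1))
  qed
  have hol: "G holomorphic_on ball 0 1"
  proof -
    have "(F \<circ> (\<lambda>\<xi>. a + of_real r * \<xi>)) holomorphic_on ball 0 1"
      by (intro holomorphic_on_compose_gen[OF _ F] holomorphic_intros) (use mem in auto)
    then show ?thesis unfolding G_def
      by (intro holomorphic_intros) (use nz in \<open>auto simp: o_def\<close>)
  qed
  have lt: "cmod (G \<xi>) < 1" if "cmod \<xi> < 1" for \<xi>
  proof -
    define u where "u = F (a + of_real r * \<xi>)"
    have 1: "Re u > 0" "Re (F a) > 0" using pos[OF mem[OF that]] pos[OF a] by (simp_all add: u_def)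
    have "(cmod (u - F a))\<^sup>2 < (cmod (u + cnj (F a)))\<^sup>2"
    proof -
      have "(cmod (u + cnj (F a)))\<^sup>2 - (cmod (u - F a))\<^sup>2 = 4 * Re u * Re (F a)"
        unfolding cmod_power2 by (simp add: power2_eq_square algebra_simps)
      then show ?thesis using 1 by (smt (verit) mult_pos_pos)
    qed
    then have "cmod (u - F a) < cmod (u + cnj (F a))"
      by (rule power_less_imp_less_base) simp
    then show ?thesis using nz[OF that] by (simp add: G_def u_def norm_divide)
  qed
  define \<xi> where "\<xi> = (z - a) / of_real r"
  have \<xi>: "cmod \<xi> < 1" "a + of_real r * \<xi> = z"
    using z \<open>r > 0\<close> by (simp_all add: \<xi>_def norm_divide dist_norm norm_minus_commute)
  have "cmod (G \<xi>) \<le> cmod \<xi>"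
    by (rule Schwarz_Lemma(1)[OF hol _ lt \<xi>(1)]) (simp_all add: G_def)
  moreover have "cmod \<xi> = cmod (z - a) / r" using \<open>r > 0\<close> by (simp add: \<xi>_def norm_divide)
  ultimately show ?thesis
    using nz[OF \<xi>(1)] unfolding G_def \<xi>(2) norm_divide by (simp add: field_simps)
qed

text \<open>Squaring the Schwarz estimate and cancelling the imaginary parts, which occur on the
  right with the factor \<open>s\<^sup>2 \<le> 1\<close>, leaves Harnack's factor
  \<open>(1 - s) / (1 + s)\<close>; its denominator is then estimated by 2.\<close>

lemma half_plane_Harnack:
  assumes F: "F holomorphic_on ball a r" and "r > 0"
    and pos: "\<And>z. z \<in> ball a r \<Longrightarrow> Re (F z) > 0" and z: "z \<in> ball a r"
  shows "Re (F z) \<ge> Re (F a) * (1 - cmod (z - a) / r) / 2"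
proof -
  define s where "s = cmod (z - a) / r"
  have s: "0 \<le> s" "s < 1" using z \<open>r > 0\<close> by (auto simp: s_def dist_norm norm_minus_commute)
  have a: "a \<in> ball a r" using \<open>r > 0\<close> by simp
  have "cmod (F z - F a) \<le> s * cmod (F z + cnj (F a))"
    unfolding s_def by (rule half_plane_Schwarz[OF assms])
  then have "(cmod (F z - F a))\<^sup>2 \<le> (s * cmod (F z + cnj (F a)))\<^sup>2"
    by (rule power_mono) simp
  then have "(Re (F z) - Re (F a))\<^sup>2 + (Im (F z) - Im (F a))\<^sup>2
      \<le> s\<^sup>2 * ((Re (F z) + Re (F a))\<^sup>2 + (Im (F z) - Im (F a))\<^sup>2)"
    by (simp add: power_mult_distrib cmod_power2)
  moreover have "s\<^sup>2 * (Im (F z) - Im (F a))\<^sup>2 \<le> 1 * (Im (F z) - Im (F a))\<^sup>2"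
    by (rule mult_right_mono) (use s in \<open>auto simp: power_le_one\<close>)
  ultimately have "(Re (F z) - Re (F a))\<^sup>2 \<le> (s * (Re (F z) + Re (F a)))\<^sup>2"
    unfolding power_mult_distrib by (simp only: distrib_left mult_1)
  then have "\<bar>Re (F z) - Re (F a)\<bar> \<le> s * (Re (F z) + Re (F a))"
  proof -
    have "0 \<le> s * (Re (F z) + Re (F a))"
      by (rule mult_nonneg_nonneg) (use pos[OF z] pos[OF a] s in linarith)+
    moreover assume "(Re (F z) - Re (F a))\<^sup>2 \<le> (s * (Re (F z) + Re (F a)))\<^sup>2"
    ultimately show ?thesis by (simp only: abs_le_square_iff[symmetric] abs_of_nonneg)
  qed
  then have *: "Re (F a) * (1 - s) \<le> Re (F z) * (1 + s)" by (simp add: algebra_simps)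
  also have "\<dots> \<le> Re (F z) * 2" using pos[OF z] s by (intro mult_left_mono) auto
  finally show ?thesis by (simp add: s_def)
qed

text \<open>\<open>B + F a - F\<close> maps into the right half-plane. At distance at most
  \<open>3 * R\<close> the Schwarz factor is \<open>3 / 4\<close>, so the oscillation
  \<open>x\<close> satisfies \<open>x \<le> 3 / 4 * (x + 2 * B)\<close>, that is
  \<open>x \<le> 6 * B\<close>. Cauchy's estimate on circles of radius \<open>R\<close> then bounds
  the derivative.\<close>

lemma Borel_Caratheodory_deriv:
  assumes F: "F holomorphic_on ball a (4 * R)" and "R > 0" and "B > 0"
    and le: "\<And>z. z \<in> ball a (4 * R) \<Longrightarrow> Re (F z) < Re (F a) + B" and z: "cmod (z - a) \<le> 2 * R"
  shows "cmod (deriv F z) \<le> 6 * B / R"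
proof -
  have bd: "cmod (F x - F a) \<le> 6 * B" if x: "cmod (x - a) \<le> 3 * R" for x
  proof -
    define G where "G = (\<lambda>z. of_real B + F a - F z)"
    have xb: "x \<in> ball a (4 * R)" using x \<open>R > 0\<close> by (simp add: dist_norm norm_minus_commute)
    have "G holomorphic_on ball a (4 * R)" unfolding G_def by (intro holomorphic_intros F)
    then have "cmod (G x - G a) \<le> cmod (x - a) / (4 * R) * cmod (G x + cnj (G a))"
      by (rule half_plane_Schwarz) (use \<open>R > 0\<close> le xb in \<open>auto simp: G_def algebra_simps\<close>)
    also have "\<dots> \<le> 3 / 4 * cmod (G x + cnj (G a))"
      by (rule mult_right_mono) (use x \<open>R > 0\<close> in \<open>auto simp: field_simps\<close>)
    also have "cmod (G x + cnj (G a)) \<le> cmod (G x - G a) + 2 * B"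
    proof -
      have "G x + cnj (G a) = (G x - G a) + of_real (2 * B)" by (simp add: G_def)
      then show ?thesis
        using norm_triangle_ineq[of "G x - G a" "of_real (2 * B)"] \<open>B > 0\<close>
        by (metis abs_of_pos mult_pos_pos norm_of_real zero_less_numeral)
    qed
    finally have "cmod (G x - G a) \<le> 6 * B" by simp
    then show ?thesis by (simp add: G_def norm_minus_commute)
  qed
  have sub: "cball z R \<subseteq> ball a (4 * R)"
  proof
    fix x assume "x \<in> cball z R"
    then have "dist z x \<le> R" "dist a z \<le> 2 * R" using z by (auto simp: dist_norm norm_minus_commute)
    then show "x \<in> ball a (4 * R)" using dist_triangle[of a x z] \<open>R > 0\<close> by simp
  qed
  have "cmod ((deriv ^^ 1) (\<lambda>x. F x - F a) z) \<le> fact 1 * (6 * B) / R ^ 1"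
  proof (rule Cauchy_inequality)
    show "(\<lambda>x. F x - F a) holomorphic_on ball z R"
      by (intro holomorphic_intros holomorphic_on_subset[OF F]) (use sub in auto)
    show "continuous_on (cball z R) (\<lambda>x. F x - F a)"
      by (intro continuous_intros holomorphic_on_imp_continuous_on holomorphic_on_subset[OF F]) (use sub in auto)
    fix x assume "cmod (z - x) = R"
    then have "cmod (x - a) \<le> 3 * R"
      using z norm_triangle_ineq[of "x - z" "z - a"] by (simp add: norm_minus_commute)
    then show "cmod (F x - F a) \<le> 6 * B" by (rule bd)
  qed fact
  moreover have "deriv (\<lambda>x. F x - F a) z = deriv F z"
  proof -
    have "F field_differentiable at z"
      using holomorphic_on_imp_differentiable_at[OF F, of z] z \<open>R > 0\<close>
      by (simp add: dist_norm norm_minus_commute)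
    then show ?thesis by (simp add: deriv_diff)
  qed
  ultimately show ?thesis by simp
qed

section \<open>Entire functions of exponential type\<close>

definition exp_type :: "complex \<Rightarrow> (complex \<Rightarrow> complex) \<Rightarrow> bool" where
  "exp_type a F \<longleftrightarrow> F holomorphic_on UNIV \<and> (\<exists>A\<ge>0. \<forall>z. cmod (F z) \<le> exp (A * (1 + cmod (z - a))))"

lemma exp_type_holo: "exp_type a F \<Longrightarrow> F holomorphic_on UNIV"
  by (simp add: exp_type_def)

text \<open>The centre must be movable: growth is first known about 0, whereas the good circles are
  centred at a point where finitely many functions are all non-zero.\<close>

lemma exp_type_center:
  assumes "exp_type a F" shows "exp_type b F"
proof -
  obtain A where A: "A \<ge> 0" "\<And>z. cmod (F z) \<le> exp (A * (1 + cmod (z - a)))"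
    using assms by (auto simp: exp_type_def)
  have "cmod (F z) \<le> exp ((A * (1 + cmod (b - a))) * (1 + cmod (z - b)))" for z
  proof -
    have "1 + cmod (z - a) \<le> 1 + (cmod (z - b) + cmod (b - a))"
      using norm_triangle_ineq[of "z - b" "b - a"] by simp
    also have "\<dots> \<le> (1 + cmod (b - a)) * (1 + cmod (z - b))" by (simp add: algebra_simps)
    finally have "A * (1 + cmod (z - a)) \<le> A * ((1 + cmod (b - a)) * (1 + cmod (z - b)))"
      using A(1) by (rule mult_left_mono)
    then show ?thesis using A(2)[of z] by (smt (verit) exp_le_cancel_iff mult.assoc)
  qed
  then show ?thesis using assms A(1) unfolding exp_type_def
    by (intro conjI exI[of _ "A * (1 + cmod (b - a))"]) auto
qed

lemma exp_type_mult:
  assumes "exp_type a F" "exp_type a G" shows "exp_type a (\<lambda>z. F z * G z)"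
proof -
  obtain A B where A: "A \<ge> 0" "\<And>z. cmod (F z) \<le> exp (A * (1 + cmod (z - a)))"
    and B: "B \<ge> 0" "\<And>z. cmod (G z) \<le> exp (B * (1 + cmod (z - a)))"
    using assms by (auto simp: exp_type_def)
  have "cmod (F z * G z) \<le> exp ((A + B) * (1 + cmod (z - a)))" for z
    unfolding norm_mult distrib_right exp_add by (intro mult_mono A B) auto
  then show ?thesis using assms A(1) B(1) unfolding exp_type_def
    by (intro conjI exI[of _ "A + B"] holomorphic_intros) auto
qed

lemma exp_type_add:
  assumes "exp_type a F" "exp_type a G" shows "exp_type a (\<lambda>z. F z + G z)"
proof -
  obtain A B where A: "A \<ge> 0" "\<And>z. cmod (F z) \<le> exp (A * (1 + cmod (z - a)))"
    and B: "B \<ge> 0" "\<And>z. cmod (G z) \<le> exp (B * (1 + cmod (z - a)))"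
    using assms by (auto simp: exp_type_def)
  have "cmod (F z + G z) \<le> exp ((A + B + 1) * (1 + cmod (z - a)))" for z
  proof -
    let ?t = "1 + cmod (z - a)"
    have "A * ?t \<le> (A + B) * ?t" "B * ?t \<le> (A + B) * ?t" using A B by (auto intro!: mult_right_mono)
    then have "cmod (F z + G z) \<le> 2 * exp ((A + B) * ?t)"
      using A(2)[of z] B(2)[of z] norm_triangle_ineq[of "F z" "G z"]
      by (smt (verit) exp_le_cancel_iff)
    \<comment> \<open>The extra summand 1 in the exponent pays for the factor 2.\<close>
    also have "2 \<le> exp ?t" using exp_ge_add_one_self[of ?t] norm_ge_zero[of "z - a"] by linarith
    finally show ?thesis by (simp add: distrib_right exp_add mult.commute)
  qed
  then show ?thesis using assms A(1) B(1) unfolding exp_type_def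
    by (intro conjI exI[of _ "A + B + 1"] holomorphic_intros) auto
qed

lemma exp_type_const: "exp_type a (\<lambda>_. c)"
proof -
  have "cmod c \<le> exp (cmod c * (1 + cmod (z - a)))" for z
  proof -
    have "cmod c \<le> cmod c * (1 + cmod (z - a))"
      using mult_left_mono[of 1 "1 + cmod (z - a)" "cmod c"] by simp
    also have "\<dots> \<le> exp \<dots>" using exp_ge_add_one_self[of "cmod c * (1 + cmod (z - a))"] by linarith
    finally show ?thesis .
  qed
  then show ?thesis unfolding exp_type_def by (intro conjI exI[of _ "cmod c"]) auto
qed

lemma exp_type_power: "exp_type a F \<Longrightarrow> exp_type a (\<lambda>z. F z ^ n)"
  by (induction n) (auto intro: exp_type_mult exp_type_const)

lemma exp_type_prod:
  "finite I \<Longrightarrow> (\<And>i. i \<in> I \<Longrightarrow> exp_type a (F i)) \<Longrightarrow> exp_type a (\<lambda>z. \<Prod>i\<in>I. F i z)"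
  by (induction I rule: finite_induct) (auto intro: exp_type_mult exp_type_const)

lemma exp_type_diff:
  assumes "exp_type a F" "exp_type a G" shows "exp_type a (\<lambda>z. F z - G z)"
  using exp_type_add[OF assms(1) exp_type_mult[OF exp_type_const[of a "-1"] assms(2)]] by simp

lemma exp_type_deriv:
  assumes "exp_type a F" shows "exp_type a (deriv F)"
proof -
  obtain A where A: "A \<ge> 0" "\<And>z. cmod (F z) \<le> exp (A * (1 + cmod (z - a)))"
    using assms by (auto simp: exp_type_def)
  have F: "F holomorphic_on UNIV" using assms by (rule exp_type_holo)
  have "cmod (deriv F z) \<le> exp ((2 * A) * (1 + cmod (z - a)))" for z
  proof -
    have "cmod ((deriv ^^ 1) F z) \<le> fact 1 * exp ((2 * A) * (1 + cmod (z - a))) / 1 ^ 1"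
    proof (rule Cauchy_inequality)
      show "F holomorphic_on ball z 1" using F by (rule holomorphic_on_subset) simp
      show "continuous_on (cball z 1) F"
        using F by (intro holomorphic_on_imp_continuous_on) (rule holomorphic_on_subset, auto)
      fix x assume "cmod (z - x) = 1"
      then have "1 + cmod (x - a) \<le> 2 * (1 + cmod (z - a))"
        using norm_triangle_ineq[of "x - z" "z - a"] norm_ge_zero[of "z - a"] norm_minus_commute[of x z]
        by (smt (verit) diff_add_cancel add_diff_eq)
      then have "A * (1 + cmod (x - a)) \<le> A * (2 * (1 + cmod (z - a)))"
        using A(1) by (rule mult_left_mono)
      then show "cmod (F x) \<le> exp ((2 * A) * (1 + cmod (z - a)))"
        using A(2)[of x] by (simp only: mult_ac) (meson exp_le_cancel_iff order_trans)
    qed simp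
    then show ?thesis by simp
  qed
  moreover have "deriv F holomorphic_on UNIV" using F by (intro holomorphic_deriv) auto
  ultimately show ?thesis using A(1) unfolding exp_type_def
    by (intro conjI exI[of _ "2 * A"]) auto
qed

section \<open>Zeros of an entire function in a disc\<close>

lemma holomorphic_divide_root:
  assumes "G holomorphic_on UNIV" "G b = 0"
  obtains H where "H holomorphic_on UNIV" "\<And>z. G z = (z - b) * H z"
proof
  let ?H = "\<lambda>z. if z = b then deriv G b else (G z - G b) / (z - b)"
  show "?H holomorphic_on UNIV" by (rule pole_lemma[OF assms(1)]) simp
  show "G z = (z - b) * ?H z" for z using assms(2) by simp
qed

lemma cball_max_modulus:
  assumes G: "G holomorphic_on UNIV" and "\<And>z. cmod (z - a) = r \<Longrightarrow> cmod (G z) \<le> B" "r > 0"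
    and z: "cmod (z - a) \<le> r"
  shows "cmod (G z) \<le> B"
proof (rule maximum_modulus_frontier[of G "cball a r"])
  show "G holomorphic_on interior (cball a r)" using G by (rule holomorphic_on_subset) simp
  show "continuous_on (closure (cball a r)) G"
    using G by (intro holomorphic_on_imp_continuous_on) (rule holomorphic_on_subset, auto)
  show "z \<in> cball a r" using z by (simp add: dist_norm norm_minus_commute)
  fix x assume "x \<in> frontier (cball a r)"
  then show "cmod (G x) \<le> B" using assms(2,3) by (auto simp: dist_norm norm_minus_commute)
qed auto

text \<open>Jensen's inequality; the bound for the zero-free factor comes from the maximum principle
  on the circle of radius \<open>12 * R\<close>.\<close>

lemma root_list_bounds:
  assumes G: "G holomorphic_on UNIV" and F: "\<And>z. F z = (\<Prod>x\<leftarrow>xs. z - x) * G z"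
    and xs: "\<And>x. x \<in> set xs \<Longrightarrow> cmod (x - a) \<le> 4 * R" and "R > 0" and "F a \<noteq> 0"
    and M: "\<And>z. cmod (z - a) = 12 * R \<Longrightarrow> cmod (F z) \<le> M"
  shows "2 ^ length xs \<le> M / cmod (F a)"
    and "cmod (z - a) \<le> 12 * R \<Longrightarrow> cmod (G z) \<le> cmod (G a) * (M / cmod (F a))"
proof -
  \<comment> \<open>A root lies within \<open>4 * R\<close> of \<open>a\<close>, hence at least
    \<open>8 * R\<close> away from the circle of radius \<open>12 * R\<close>. Each root thus
    contributes the factor \<open>8 * R / (4 * R) = 2\<close> to the first conclusion.\<close>
  have lower: "(8 * R) ^ length xs \<le> cmod (\<Prod>x\<leftarrow>xs. z - x)" if "cmod (z - a) = 12 * R" for z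
    using xs
  proof (induction xs)
    case (Cons x xs)
    have "cmod (x - a) \<le> 4 * R" using Cons.prems by simp
    then have "8 * R \<le> cmod (z - x)" using that norm_triangle_ineq[of "z - x" "x - a"] by simp
    moreover have "(8 * R) ^ length xs \<le> cmod (\<Prod>x\<leftarrow>xs. z - x)" using Cons by simp
    ultimately have "(8 * R) * (8 * R) ^ length xs \<le> cmod (z - x) * cmod (\<Prod>x\<leftarrow>xs. z - x)"
      using \<open>R > 0\<close> by (intro mult_mono) (simp_all del: power_mult_distrib)
    then show ?case by (simp add: norm_mult del: power_mult_distrib)
  qed simp
  have upper: "cmod (\<Prod>x\<leftarrow>xs. a - x) \<le> (4 * R) ^ length xs"
    using xs
  proof (induction xs)
    case (Cons x xs)
    have "cmod (x - a) \<le> 4 * R" using Cons.prems by simp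
    then have "cmod (a - x) \<le> 4 * R" by (simp add: norm_minus_commute)
    moreover have "cmod (\<Prod>x\<leftarrow>xs. a - x) \<le> (4 * R) ^ length xs" using Cons by simp
    ultimately have "cmod (a - x) * cmod (\<Prod>x\<leftarrow>xs. a - x) \<le> (4 * R) * (4 * R) ^ length xs"
      using \<open>R > 0\<close> by (intro mult_mono) (simp_all del: power_mult_distrib)
    then show ?case by (simp add: norm_mult del: power_mult_distrib)
  qed simp
  have Gle: "cmod (G z) \<le> M / (8 * R) ^ length xs" if "cmod (z - a) \<le> 12 * R" for z
  proof (rule cball_max_modulus[OF G _ _ that])
    fix z assume z: "cmod (z - a) = 12 * R"
    have "(8 * R) ^ length xs * cmod (G z) \<le> cmod (\<Prod>x\<leftarrow>xs. z - x) * cmod (G z)"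
      by (intro mult_right_mono lower z) auto
    also have "\<dots> \<le> M" using M[OF z] by (simp add: F norm_mult)
    finally show "cmod (G z) \<le> M / (8 * R) ^ length xs"
      using \<open>R > 0\<close> by (simp add: field_simps)
  qed (use \<open>R > 0\<close> in auto)
  have Fa: "cmod (F a) \<le> (4 * R) ^ length xs * cmod (G a)"
    unfolding F norm_mult by (intro mult_right_mono upper) auto
  have Ga: "G a \<noteq> 0" using \<open>F a \<noteq> 0\<close> F by auto
  have eq: "(8 * R) ^ length xs = 2 ^ length xs * (4 * R) ^ length xs"
    unfolding power_mult_distrib[symmetric] by simp
  have M0: "M \<ge> 0"
  proof -
    have "0 \<le> M / (8 * R) ^ length xs" using norm_ge_zero[of "G a"] Gle[of a] \<open>R > 0\<close> by (simp add: order.trans[of 0 "cmod (G a)"])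
    moreover have "(8 * R) ^ length xs > 0" using \<open>R > 0\<close> by simp
    ultimately show ?thesis by (meson not_less zero_le_divide_iff less_le_not_le)
  qed
  have "cmod (G a) \<le> M / (8 * R) ^ length xs" using Gle[of a] \<open>R > 0\<close> by simp
  then have "2 ^ length xs * ((4 * R) ^ length xs * cmod (G a)) \<le> M"
    using \<open>R > 0\<close> unfolding eq by (subst (asm) pos_le_divide_eq) (simp, simp only: mult_ac)
  moreover have "2 ^ length xs * cmod (F a) \<le> 2 ^ length xs * ((4 * R) ^ length xs * cmod (G a))"
    using Fa by (intro mult_left_mono) auto
  ultimately show "2 ^ length xs \<le> M / cmod (F a)"
    using \<open>F a \<noteq> 0\<close> by (subst pos_le_divide_eq) (simp, linarith)
  show "cmod (G z) \<le> cmod (G a) * (M / cmod (F a))" if "cmod (z - a) \<le> 12 * R"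
  proof -
    have "(4 * R) ^ length xs \<le> (8 * R) ^ length xs" using \<open>R > 0\<close> by (intro power_mono) auto
    then have "cmod (F a) \<le> (8 * R) ^ length xs * cmod (G a)"
      using Fa mult_right_mono[of "(4 * R) ^ length xs" "(8 * R) ^ length xs" "cmod (G a)"] by simp
    then have "M / (8 * R) ^ length xs \<le> cmod (G a) * (M / cmod (F a))"
      using \<open>R > 0\<close> \<open>F a \<noteq> 0\<close> M0 mult_left_mono[of "cmod (F a)" "(8 * R) ^ length xs * cmod (G a)" M]
      by (simp add: field_simps del: power_mult_distrib)
    then show ?thesis using Gle[OF that] by linarith
  qed
qed

text \<open>A list of roots of maximal length is divided out. Jensen's bound caps the length, so a
  maximum exists, and a root of the cofactor in the disc would give a longer list. Repeated entries
  record multiplicities.\<close>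

lemma holomorphic_factor_roots:
  assumes F: "F holomorphic_on UNIV" and "F a \<noteq> 0" and "R > 0"
  obtains xs G where "G holomorphic_on UNIV" "\<And>z. F z = (\<Prod>x\<leftarrow>xs. z - x) * G z"
    "\<And>x. x \<in> set xs \<Longrightarrow> cmod (x - a) \<le> 4 * R" "\<And>z. cmod (z - a) \<le> 4 * R \<Longrightarrow> G z \<noteq> 0"
proof -
  define P where "P n \<longleftrightarrow> (\<exists>xs G. length xs = n \<and> G holomorphic_on UNIV \<and> (\<forall>z. F z = (\<Prod>x\<leftarrow>xs. z - x) * G z)
    \<and> (\<forall>x\<in>set xs. cmod (x - a) \<le> 4 * R))" for n
  have "compact (F ` sphere a (12 * R))"
    by (intro compact_continuous_image holomorphic_on_imp_continuous_on) (auto intro: holomorphic_on_subset[OF F])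
  then obtain M where M: "\<And>z. cmod (z - a) = 12 * R \<Longrightarrow> cmod (F z) \<le> M"
    using compact_imp_bounded bounded_iff by (metis dist_commute dist_norm imageI mem_sphere)
  obtain N where N: "M / cmod (F a) < 2 ^ N"
    using real_arch_pow[of 2 "M / cmod (F a)"] by auto
  have bound: "n \<le> N" if "P n" for n
  proof -
    from that obtain xs G where xs: "length xs = n" "G holomorphic_on UNIV" "\<And>z. F z = (\<Prod>x\<leftarrow>xs. z - x) * G z"
      "\<And>x. x \<in> set xs \<Longrightarrow> cmod (x - a) \<le> 4 * R" by (auto simp: P_def)
    have "2 ^ length xs \<le> M / cmod (F a)"
      by (rule root_list_bounds(1)[OF xs(2-4) assms(3,2) M])
    then have "2 ^ n < (2::real) ^ N" using xs(1) N by (simp only:)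
    then show ?thesis by simp
  qed
  have P0: "P 0" using F by (auto simp: P_def)
  obtain n where n: "P n" "\<And>m. P m \<Longrightarrow> m \<le> n"
    using GreatestI_nat[of P 0 N] Greatest_le_nat[of P _ N] P0 bound by blast
  then obtain xs G where xs: "length xs = n" "G holomorphic_on UNIV" "\<And>z. F z = (\<Prod>x\<leftarrow>xs. z - x) * G z"
      "\<And>x. x \<in> set xs \<Longrightarrow> cmod (x - a) \<le> 4 * R" by (auto simp: P_def)
  show thesis
  proof (rule that[of G xs])
    fix b assume b: "cmod (b - a) \<le> 4 * R"
    show "G b \<noteq> 0"
    proof
      assume "G b = 0"
      then obtain H where H: "H holomorphic_on UNIV" "\<And>z. G z = (z - b) * H z"
        using holomorphic_divide_root[OF xs(2)] by blast
      have "P (Suc n)" unfolding P_def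
        by (rule exI[of _ "b # xs"], rule exI[of _ H]) (use xs H b in \<open>auto simp: mult_ac\<close>)
      then show False using n(2) by force
    qed
  qed (use xs in auto)
qed

lemma deriv_root_list:
  assumes "G holomorphic_on UNIV" "z \<notin> set xs" "G z \<noteq> 0"
  shows "deriv (\<lambda>z. (\<Prod>x\<leftarrow>xs. z - x) * G z) z = (\<Prod>x\<leftarrow>xs. z - x) * G z * ((\<Sum>x\<leftarrow>xs. 1 / (z - x)) + deriv G z / G z)"
  using assms
proof (induction xs)
  case (Cons x xs)
  have h: "(\<lambda>z. (\<Prod>x\<leftarrow>xs. z - x) * G z) holomorphic_on UNIV"
  proof -
    have "(\<lambda>z. (\<Prod>x\<leftarrow>xs. z - x)) holomorphic_on UNIV"
      by (induction xs) (auto intro!: holomorphic_intros)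
    then show ?thesis by (intro holomorphic_intros Cons.prems)
  qed
  have "deriv (\<lambda>z. (z - x) * ((\<Prod>x\<leftarrow>xs. z - x) * G z)) z
      = (z - x) * deriv (\<lambda>z. (\<Prod>x\<leftarrow>xs. z - x) * G z) z + (\<Prod>x\<leftarrow>xs. z - x) * G z"
    using holomorphic_on_imp_differentiable_at[OF h, of z]
    by (subst deriv_mult) (auto intro!: derivative_intros simp: mult_ac)
  moreover have "deriv (\<lambda>z. (\<Prod>x\<leftarrow>xs. z - x) * G z) z
      = (\<Prod>x\<leftarrow>xs. z - x) * G z * ((\<Sum>x\<leftarrow>xs. 1 / (z - x)) + deriv G z / G z)"
    using Cons by simp
  ultimately have "deriv (\<lambda>z. (z - x) * ((\<Prod>x\<leftarrow>xs. z - x) * G z)) z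
      = (z - x) * ((\<Prod>x\<leftarrow>xs. z - x) * G z * ((\<Sum>x\<leftarrow>xs. 1 / (z - x)) + deriv G z / G z))
        + (\<Prod>x\<leftarrow>xs. z - x) * G z"
    by simp
  also have "\<dots> = (z - x) * ((\<Prod>x\<leftarrow>xs. z - x) * G z) *
      ((1 / (z - x) + (\<Sum>x\<leftarrow>xs. 1 / (z - x))) + deriv G z / G z)"
  proof -
    have "z - x \<noteq> 0" using Cons.prems by auto
    moreover have "u * (v * (s + g)) + v = u * v * ((1 / u + s) + g)" if "u \<noteq> 0" for u v s g :: complex
      using that by (simp add: field_simps)
    ultimately show ?thesis by blast
  qed
  finally show ?case by (simp add: mult.assoc)
qed auto

text \<open>The radius avoids all zeros by a fixed distance: there are \<open>O(R)\<close> zeros, so one of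
  \<open>O(R)\<close> equally spaced candidate radii is far from every zero.\<close>

lemma good_radius:
  fixes X :: "complex set" and R K :: real
  assumes "finite X" "real (card X) \<le> K * R" "R \<ge> 1" "K \<ge> 0"
  obtains r where "R \<le> r" "r \<le> 2 * R" "\<And>x z. x \<in> X \<Longrightarrow> cmod (z - a) = r \<Longrightarrow> cmod (z - x) \<ge> 1 / (2 * (K + 1))"
proof -
  define N where "N = card X"
  define \<delta> where "\<delta> = R / (2 * (N + 1))"
  have \<delta>: "\<delta> > 0" using assms by (simp add: \<delta>_def)
  define \<rho> where "\<rho> = (\<lambda>j::nat. R + (2 * j + 1) * \<delta>)"
  \<comment> \<open>The candidate radii are spaced by \<open>2 * \<delta>\<close>, so a point spoils
    at most one of them, and \<open>N\<close> points cannot spoil all \<open>N + 1\<close>.\<close>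
  define bad where "bad = (\<lambda>x. {j \<in> {..N}. \<bar>\<rho> j - cmod (x - a)\<bar> < \<delta>})"
  have card1: "card (bad x) \<le> 1" for x
  proof -
    have "i = j" if "i \<in> bad x" "j \<in> bad x" for i j
    proof -
      have "\<bar>\<rho> i - \<rho> j\<bar> < 2 * \<delta>" using that by (auto simp: bad_def)
      moreover have "\<rho> i - \<rho> j = 2 * \<delta> * (real i - real j)" by (simp add: \<rho>_def algebra_simps)
      ultimately have "2 * \<delta> * \<bar>real i - real j\<bar> < 2 * \<delta> * 1" using \<delta> by (simp add: abs_mult)
      then have "\<bar>real i - real j\<bar> < 1" using \<delta> by (subst (asm) mult_less_cancel_left_pos) auto
      then show ?thesis by linarith
    qed
    moreover have "finite (bad x)" by (simp add: bad_def)
    ultimately show ?thesis using card_le_Suc0_iff_eq[of "bad x"] by auto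
  qed
  have "card (\<Union>x\<in>X. bad x) \<le> (\<Sum>x\<in>X. card (bad x))" by (rule card_UN_le[OF assms(1)])
  also have "\<dots> \<le> (\<Sum>x\<in>X. 1)" by (intro sum_mono card1)
  finally have "card (\<Union>x\<in>X. bad x) < card {..N}" by (simp add: N_def)
  then obtain j where j: "j \<le> N" "j \<notin> (\<Union>x\<in>X. bad x)"
  proof -
    have "finite (\<Union>x\<in>X. bad x)" using assms(1) by (auto simp: bad_def)
    then have "\<not> {..N} \<subseteq> (\<Union>x\<in>X. bad x)"
      using \<open>card (\<Union>x\<in>X. bad x) < card {..N}\<close> card_mono leD by blast
    then show thesis using that by blast
  qed
  show thesis
  proof
    show "R \<le> \<rho> j" using \<delta> by (simp add: \<rho>_def)
    have "(2 * real j + 1) * \<delta> \<le> (2 * (real N + 1)) * \<delta>" using j \<delta> by (intro mult_right_mono) auto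
    also have "\<dots> = R" unfolding \<delta>_def by (simp add: field_simps)
    finally show "\<rho> j \<le> 2 * R" by (simp add: \<rho>_def)
    fix x z assume x: "x \<in> X" and z: "cmod (z - a) = \<rho> j"
    then have "\<not> \<bar>\<rho> j - cmod (x - a)\<bar> < \<delta>" using j by (auto simp: bad_def)
    moreover have "\<bar>cmod (z - a) - cmod (x - a)\<bar> \<le> cmod (z - x)"
      using norm_triangle_ineq3[of "z - a" "x - a"] by simp
    ultimately have "\<delta> \<le> cmod (z - x)" using z by linarith
    moreover have "1 / (2 * (K + 1)) \<le> \<delta>"
    proof -
      have "real N + 1 \<le> R * (K + 1)" using assms by (simp add: N_def algebra_simps)
      then show ?thesis using assms by (simp add: \<delta>_def field_simps)
    qed
    ultimately show "1 / (2 * (K + 1)) \<le> cmod (z - x)" by linarith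
  qed
qed

text \<open>Near the disc of radius \<open>2 * R\<close>, \<open>F\<close> is a product over roots
  times \<open>exp g\<close>. The roots contribute at most \<open>length xs / \<delta>\<close> to
  the logarithmic derivative, and \<open>deriv g\<close> is bounded by Borel-Caratheodory; both the
  number of roots and the growth are \<open>O(R)\<close>. The exceptional set \<open>X\<close> is
  returned instead of a radius so that several functions can share one circle.\<close>

lemma exp_type_log_deriv:
  assumes "exp_type a F" "F a \<noteq> 0"
  obtains K where "K \<ge> 0"
    "\<And>R. R \<ge> 1 \<Longrightarrow> \<exists>X. finite X \<and> real (card X) \<le> K * R \<and>
      (\<forall>\<delta> z. \<delta> > 0 \<longrightarrow> cmod (z - a) \<le> 2 * R \<longrightarrow> (\<forall>x\<in>X. cmod (z - x) \<ge> \<delta>) \<longrightarrow>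
        F z \<noteq> 0 \<and> cmod (deriv F z) \<le> (K / \<delta> + K) * R * cmod (F z))"
proof -
  have F: "F holomorphic_on UNIV" using assms(1) by (rule exp_type_holo)
  obtain A where A: "A \<ge> 0" "\<And>z. cmod (F z) \<le> exp (A * (1 + cmod (z - a)))"
    using assms(1) by (auto simp: exp_type_def)
  \<comment> \<open>The 13 comes from \<open>1 + 12 * R \<le> 13 * R\<close>; the final 1 makes the
    bound on \<open>ln (M / cmod (F a))\<close> strict, as \<open>Borel_Caratheodory_deriv\<close>
    demands.\<close>
  define B where "B = 13 * A + \<bar>ln (cmod (F a))\<bar> + 1"
  define K where "K = max (6 * B) (B / ln 2)"
  have B: "B > 0" using A by (simp add: B_def)
  have K: "K \<ge> 0" using B by (simp add: K_def)
  have main: "\<exists>X. finite X \<and> real (card X) \<le> K * R \<and>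
      (\<forall>\<delta> z. \<delta> > 0 \<longrightarrow> cmod (z - a) \<le> 2 * R \<longrightarrow> (\<forall>x\<in>X. cmod (z - x) \<ge> \<delta>) \<longrightarrow>
        F z \<noteq> 0 \<and> cmod (deriv F z) \<le> (K / \<delta> + K) * R * cmod (F z))" if R: "R \<ge> 1" for R
  proof -
    have R0: "R > 0" using R by simp
    define M where "M = exp (A * (1 + 12 * R))"
    have M: "cmod (F z) \<le> M" if "cmod (z - a) = 12 * R" for z using A(2)[of z] that by (simp add: M_def)
    obtain G xs where xs: "G holomorphic_on UNIV" "\<And>z. F z = (\<Prod>x\<leftarrow>xs. z - x) * G z"
      "\<And>x. x \<in> set xs \<Longrightarrow> cmod (x - a) \<le> 4 * R" "\<And>z. cmod (z - a) \<le> 4 * R \<Longrightarrow> G z \<noteq> 0"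
      by (rule holomorphic_factor_roots[OF F assms(2) R0]) (rule that)
    note bds = root_list_bounds[OF xs(1,2,3) R0 assms(2) M]
    have lnM: "ln (M / cmod (F a)) < B * R"
    proof -
      have "ln (M / cmod (F a)) = A * (1 + 12 * R) - ln (cmod (F a))"
        using assms(2) by (simp add: ln_div M_def)
      also have "\<dots> < A * (13 * R) + (\<bar>ln (cmod (F a))\<bar> + 1) * R"
      proof -
        have "A * (1 + 12 * R) \<le> A * (13 * R)" using A(1) R by (intro mult_left_mono) auto
        moreover have "- ln (cmod (F a)) < (\<bar>ln (cmod (F a))\<bar> + 1) * 1" by (simp add: abs_if)
        moreover have "(\<bar>ln (cmod (F a))\<bar> + 1) * 1 \<le> (\<bar>ln (cmod (F a))\<bar> + 1) * R" using R by (intro mult_left_mono) auto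
        ultimately show ?thesis by linarith
      qed
      finally show ?thesis by (simp add: B_def algebra_simps)
    qed
    have MF: "M / cmod (F a) > 0" using assms(2) by (simp add: M_def)
    have len: "real (length xs) \<le> K * R"
    proof -
      have "ln (2 ^ length xs) \<le> ln (M / cmod (F a))" using bds(1) MF by (subst ln_le_cancel_iff) auto
      then have "real (length xs) * ln 2 \<le> B * R" using lnM by (simp add: ln_realpow)
      then have "real (length xs) \<le> B / ln 2 * R" by (simp add: field_simps)
      also have "\<dots> \<le> K * R" using R by (intro mult_right_mono) (auto simp: K_def)
      finally show ?thesis .
    qed
    have "\<exists>g. g holomorphic_on ball a (4 * R) \<and> (\<forall>z\<in>ball a (4 * R). G z = exp (g z))"
      by (rule contractible_imp_holomorphic_log[of G "ball a (4 * R)"])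
        (use xs(1,4) in \<open>auto intro: holomorphic_on_subset convex_imp_contractible simp: dist_norm norm_minus_commute\<close>)
    then obtain g where g: "g holomorphic_on ball a (4 * R)" "\<And>z. z \<in> ball a (4 * R) \<Longrightarrow> G z = exp (g z)"
      by auto
    have Re: "Re (g z) < Re (g a) + B * R" if z: "z \<in> ball a (4 * R)" for z
    proof -
      have "cmod (G z) \<le> cmod (G a) * (M / cmod (F a))"
        by (rule bds(2)) (use z R in \<open>auto simp: dist_norm norm_minus_commute\<close>)
      then have "exp (Re (g z)) \<le> exp (Re (g a)) * (M / cmod (F a))"
        using g(2)[OF z] g(2)[of a] R by simp
      also have "\<dots> = exp (Re (g a) + ln (M / cmod (F a)))" unfolding exp_add using MF by simp
      finally show ?thesis using lnM by simp
    qed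
    have gd: "cmod (deriv g z) \<le> 6 * B" if z: "cmod (z - a) \<le> 2 * R" for z
      using Borel_Caratheodory_deriv[OF g(1) R0 _ Re z] B R0 by simp
    show ?thesis
    proof (intro exI[of _ "set xs"] conjI allI impI)
      show "real (card (set xs)) \<le> K * R" using len card_length[of xs] by linarith
      fix \<delta> :: real and z
      assume \<delta>: "\<delta> > 0" and z: "cmod (z - a) \<le> 2 * R" and far: "\<forall>x\<in>set xs. cmod (z - x) \<ge> \<delta>"
      have zb: "z \<in> ball a (4 * R)" using z R by (simp add: dist_norm norm_minus_commute)
      have zn: "z \<notin> set xs" using far \<delta> by force
      have Gz: "G z \<noteq> 0" using z R by (intro xs(4)) auto
      show "F z \<noteq> 0" using zn Gz by (auto simp: xs(2) prod_list_zero_iff)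
      have "deriv G z = deriv (\<lambda>z. exp (g z)) z"
        using g(2) zb eventually_nhds_in_open[of "ball a (4 * R)" z]
        by (intro deriv_cong_ev) (auto elim!: eventually_mono)
      also have "\<dots> = exp (g z) * deriv g z"
        using holomorphic_derivI[OF g(1) open_ball zb]
        by (intro DERIV_imp_deriv) (auto intro!: derivative_eq_intros)
      finally have Gd: "deriv G z / G z = deriv g z" using g(2)[OF zb] by simp
      have "deriv F z = F z * ((\<Sum>x\<leftarrow>xs. 1 / (z - x)) + deriv g z)"
      proof -
        have "F = (\<lambda>z. (\<Prod>x\<leftarrow>xs. z - x) * G z)" using xs(2) by (rule ext)
        then show ?thesis using deriv_root_list[OF xs(1) zn Gz] Gd by (simp only:)
      qed
      moreover have "cmod (\<Sum>x\<leftarrow>xs. 1 / (z - x)) \<le> length xs * (1 / \<delta>)"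
        using far
      proof (induction xs)
        case (Cons x xs)
        then have "\<delta> \<le> cmod (z - x)" by simp
        then have "1 / cmod (z - x) \<le> 1 / \<delta>" using \<delta> by (intro divide_left_mono mult_pos_pos) auto
        then show ?case using Cons norm_triangle_ineq[of "1 / (z - x)" "\<Sum>x\<leftarrow>xs. 1 / (z - x)"]
          by (simp add: norm_divide algebra_simps add_divide_distrib)
      qed simp
      moreover have "length xs * (1 / \<delta>) \<le> K * R * (1 / \<delta>)" using len \<delta> by (intro mult_right_mono) auto
      moreover have "cmod (deriv g z) \<le> K * R"
      proof -
        have "6 * B * 1 \<le> K * R" using R B by (intro mult_mono) (auto simp: K_def)
        then show ?thesis using gd[OF z] by simp
      qed
      ultimately have "cmod (deriv F z) \<le> cmod (F z) * (K * R * (1 / \<delta>) + K * R)"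
        using norm_triangle_ineq[of "\<Sum>x\<leftarrow>xs. 1 / (z - x)" "deriv g z"]
        unfolding norm_mult by (smt (verit) mult_left_mono norm_ge_zero norm_mult)
      then show "cmod (deriv F z) \<le> (K / \<delta> + K) * R * cmod (F z)"
        by (simp add: algebra_simps)
    qed simp
  qed
  show thesis using that[OF K main] by blast
qed

text \<open>The exceptional sets of finitely many functions together still have \<open>O(R)\<close>
  points, so one circle keeps a fixed distance from all of them.\<close>

lemma good_circles:
  assumes "finite S" "\<And>F. F \<in> S \<Longrightarrow> exp_type a F \<and> F a \<noteq> 0"
  obtains C where "C \<ge> 0" "\<And>R. R \<ge> 1 \<Longrightarrow> \<exists>r. R \<le> r \<and> r \<le> 2 * R \<and>
      (\<forall>F\<in>S. \<forall>z. cmod (z - a) = r \<longrightarrow> F z \<noteq> 0 \<and> cmod (deriv F z) \<le> C * r * cmod (F z))"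
proof -
  define Q where "Q K F R X \<longleftrightarrow> finite X \<and> real (card X) \<le> K * R \<and>
      (\<forall>\<delta> z. \<delta> > 0 \<longrightarrow> cmod (z - a) \<le> 2 * R \<longrightarrow> (\<forall>x\<in>X. cmod (z - x) \<ge> \<delta>) \<longrightarrow>
        F z \<noteq> 0 \<and> cmod (deriv F z) \<le> (K / \<delta> + K) * R * cmod (F z))" for K F and R :: real and X
  have "\<forall>F\<in>S. \<exists>K\<ge>0. \<forall>R\<ge>1. \<exists>X. Q K F R X"
  proof
    fix F assume "F \<in> S"
    then have "exp_type a F" "F a \<noteq> 0" using assms by auto
    then show "\<exists>K\<ge>0. \<forall>R\<ge>1. \<exists>X. Q K F R X"
      using exp_type_log_deriv[of a F] unfolding Q_def by metis
  qed
  then obtain K where K: "\<And>F. F \<in> S \<Longrightarrow> K F \<ge> 0" "\<And>F R. F \<in> S \<Longrightarrow> R \<ge> 1 \<Longrightarrow> \<exists>X. Q (K F) F R X"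
    by metis
  then obtain X where X: "\<And>F R. F \<in> S \<Longrightarrow> R \<ge> 1 \<Longrightarrow> Q (K F) F R (X F R)" by metis
  define L where "L = (\<Sum>F\<in>S. K F)"
  have L: "L \<ge> 0" unfolding L_def by (intro sum_nonneg K)
  define \<delta> where "\<delta> = 1 / (2 * (L + 1))"
  have \<delta>: "\<delta> > 0" using L by (simp add: \<delta>_def)
  define C where "C = L / \<delta> + L"
  show thesis
  proof
    show "C \<ge> 0" using L \<delta> by (simp add: C_def)
    fix R :: real assume R: "R \<ge> 1"
    define Y where "Y = (\<Union>F\<in>S. X F R)"
    have finY: "finite Y" unfolding Y_def using assms(1) X[OF _ R] by (auto simp: Q_def)
    have "real (card Y) \<le> (\<Sum>F\<in>S. real (card (X F R)))"
      unfolding Y_def of_nat_sum[symmetric] of_nat_le_iff by (rule card_UN_le[OF assms(1)])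
    also have "\<dots> \<le> (\<Sum>F\<in>S. K F * R)" by (intro sum_mono) (use X[OF _ R] in \<open>auto simp: Q_def\<close>)
    finally have "real (card Y) \<le> L * R" by (simp add: L_def sum_distrib_right)
    from good_radius[OF finY this R L] obtain r where r: "R \<le> r" "r \<le> 2 * R"
      "\<And>x z. x \<in> Y \<Longrightarrow> cmod (z - a) = r \<Longrightarrow> cmod (z - x) \<ge> \<delta>" unfolding \<delta>_def by blast
    show "\<exists>r. R \<le> r \<and> r \<le> 2 * R \<and>
      (\<forall>F\<in>S. \<forall>z. cmod (z - a) = r \<longrightarrow> F z \<noteq> 0 \<and> cmod (deriv F z) \<le> C * r * cmod (F z))"
    proof (intro exI[of _ r] conjI ballI allI impI r(1,2))
      fix F z assume F: "F \<in> S" and z: "cmod (z - a) = r"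
      have *: "F z \<noteq> 0 \<and> cmod (deriv F z) \<le> (K F / \<delta> + K F) * R * cmod (F z)"
      proof -
        have "\<forall>x\<in>X F R. cmod (z - x) \<ge> \<delta>" using r(3) z F by (auto simp: Y_def)
        moreover have "cmod (z - a) \<le> 2 * R" using r(2) z by simp
        moreover note X[OF F R]
        ultimately show ?thesis using \<delta> unfolding Q_def by blast
      qed
      then show "F z \<noteq> 0" by simp
      have "K F \<le> L" unfolding L_def using K(1) by (intro member_le_sum F assms(1)) auto
      then have "(K F / \<delta> + K F) * R \<le> C * r"
        using r R \<delta> L K(1)[OF F] unfolding C_def
        by (intro mult_mono add_mono divide_right_mono) auto
      then have "(K F / \<delta> + K F) * R * cmod (F z) \<le> C * r * cmod (F z)"
        by (rule mult_right_mono) simp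
      then show "cmod (deriv F z) \<le> C * r * cmod (F z)" using * by linarith
    qed
  qed
qed

section \<open>Counting roots of polynomials\<close>

text \<open>A point of order \<open>m\<close> for \<open>E\<close> and \<open>n\<close> for \<open>P\<close> has order at least \<open>m + n - 1\<close> for the Wronskian.\<close>

lemma degree_le_roots_Wronskian:
  fixes E P :: "complex poly" and w :: nat
  defines "J \<equiv> pderiv E * P - smult (of_nat w) (E * pderiv P)"
  assumes "E \<noteq> 0" "P \<noteq> 0" "J \<noteq> 0"
  shows "degree E + degree P \<le> degree J + card {z. poly (E * P) z = 0}"
proof -
  let ?R = "{z. poly (E * P) z = 0}"
  have EP: "E * P \<noteq> 0" using assms by simp
  have fin: "finite ?R" using EP by (rule poly_roots_finite)
  have le: "order z (E * P) \<le> order z J + 1" for z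
  proof -
    define m where "m = order z E"
    define n where "n = order z P"
    obtain E1 where E1: "E = [:-z, 1:] ^ m * E1" using order_1[of z E] unfolding m_def by (auto elim: dvdE)
    obtain P1 where P1: "P = [:-z, 1:] ^ n * P1" using order_1[of z P] unfolding n_def by (auto elim: dvdE)
    let ?X = "[:-z, 1:]"
    have dE: "?X ^ (m - 1) dvd pderiv E"
      unfolding E1 pderiv_mult by (cases m) (auto simp del: power_Suc simp: pderiv_power_Suc intro!: dvd_add dvd_smult dvd_mult2[OF le_imp_power_dvd])
    have dP: "?X ^ (n - 1) dvd pderiv P"
      unfolding P1 pderiv_mult by (cases n) (auto simp del: power_Suc simp: pderiv_power_Suc intro!: dvd_add dvd_smult dvd_mult2[OF le_imp_power_dvd])
    have "?X ^ (m + n - 1) dvd pderiv E * P"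
    proof (cases m)
      case 0
      then have "?X ^ (m + n - 1) dvd ?X ^ n" by (intro le_imp_power_dvd) auto
      then show ?thesis unfolding P1 by (intro dvd_mult dvd_mult2)
    next
      case (Suc m')
      then have "m + n - 1 = (m - 1) + n" by simp
      then show ?thesis by (simp only: power_add) (intro mult_dvd_mono dE, simp add: P1)
    qed
    moreover have "?X ^ (m + n - 1) dvd E * pderiv P"
    proof (cases n)
      case 0
      then have "?X ^ (m + n - 1) dvd ?X ^ m" by (intro le_imp_power_dvd) auto
      then show ?thesis unfolding E1 by (intro dvd_mult2)
    next
      case (Suc n')
      then have "m + n - 1 = m + (n - 1)" by simp
      then show ?thesis by (simp only: power_add) (intro mult_dvd_mono dP, simp add: E1)
    qed
    ultimately have "?X ^ (m + n - 1) dvd J" unfolding J_def by (intro dvd_diff dvd_smult)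
    then have "m + n - 1 \<le> order z J" using assms(4) by (simp add: order_divides)
    moreover have "order z (E * P) = m + n" using order_mult[OF EP] by (simp add: m_def n_def)
    ultimately show ?thesis by simp
  qed
  have "degree E + degree P = degree (E * P)" using assms by (simp add: degree_mult_eq)
  also have "\<dots> = size (proots (E * P))" by (simp add: size_proots_complex)
  also have "\<dots> = (\<Sum>z\<in>?R. order z (E * P))"
    using EP by (simp add: size_multiset_overloaded_eq)
  also have "\<dots> \<le> (\<Sum>z\<in>?R. order z J + 1)" by (intro sum_mono le)
  also have "\<dots> = (\<Sum>z\<in>?R. count (proots J) z) + card ?R" 
    unfolding sum.distrib by (simp add: assms(4) del: poly_mult)
  also have "(\<Sum>z\<in>?R. count (proots J) z) \<le> (\<Sum>z\<in>?R \<union> set_mset (proots J). count (proots J) z)"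
    by (rule sum_mono2) (use fin in auto)
  also have "\<dots> = size (proots J)"
    unfolding size_multiset_overloaded_eq
    by (rule sum.mono_neutral_right) (use fin in \<open>auto simp: not_in_iff\<close>)
  also have "\<dots> = degree J" by (simp add: size_proots_complex)
  finally show ?thesis by simp
qed

text \<open>The two leading coefficients combine to a multiple of
  \<open>degree K - w * degree P\<close>, so unequal degrees exclude cancellation.\<close>

lemma degree_Wronskian:
  fixes K P :: "complex poly" and w :: nat
  assumes "K \<noteq> 0" "P \<noteq> 0" "degree K \<noteq> w * degree P" "degree P > 0"
  shows "pderiv K * P - smult (of_nat w) (K * pderiv P) \<noteq> 0"
    and "degree (pderiv K * P - smult (of_nat w) (K * pderiv P)) = degree K + degree P - 1"
    and "lead_coeff (pderiv K * P - smult (of_nat w) (K * pderiv P))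
      = (of_nat (degree K) - of_nat w * of_nat (degree P)) * lead_coeff K * lead_coeff P"
proof -
  let ?J = "pderiv K * P - smult (of_nat w) (K * pderiv P)"
  let ?n = "degree K + degree P - 1"
  have "degree (pderiv K * P) \<le> ?n"
  proof (cases "degree K = 0")
    case True
    then have "pderiv K = 0" by (simp add: pderiv_eq_0_iff)
    then show ?thesis by simp
  next
    case False
    then show ?thesis using degree_mult_le[of "pderiv K" P] by (simp add: degree_pderiv)
  qed
  moreover have "degree (smult (of_nat w) (K * pderiv P)) \<le> ?n"
    using degree_smult_le[of "of_nat w" "K * pderiv P"] degree_mult_le[of K "pderiv P"] assms(4)
    by (simp add: degree_pderiv)
  ultimately have le: "degree ?J \<le> ?n" by (rule degree_diff_le)
  have c1: "coeff (pderiv K * P) ?n = of_nat (degree K) * lead_coeff K * lead_coeff P"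
  proof (cases "degree K = 0")
    case True
    then have "pderiv K = 0" by (simp add: pderiv_eq_0_iff)
    then show ?thesis using True by simp
  next
    case False
    then have "?n = degree (pderiv K) + degree P" by (simp add: degree_pderiv)
    then show ?thesis using False unfolding \<open>?n = _\<close> coeff_mult_degree_sum by (simp add: degree_pderiv coeff_pderiv)
  qed
  have "?n = degree K + degree (pderiv P)" using assms(4) by (simp add: degree_pderiv)
  then have c2: "coeff (K * pderiv P) ?n = lead_coeff K * (of_nat (degree P) * lead_coeff P)"
    using assms(4) unfolding \<open>?n = _\<close> coeff_mult_degree_sum by (simp add: degree_pderiv coeff_pderiv)
  have c: "coeff ?J ?n = (of_nat (degree K) - of_nat w * of_nat (degree P)) * lead_coeff K * lead_coeff P"
    using c1 c2 by (simp add: algebra_simps)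
  have "of_nat (degree K) - of_nat w * of_nat (degree P) \<noteq> (0::complex)"
    using assms(3) by (metis of_nat_eq_iff of_nat_mult right_minus_eq)
  then have nz: "coeff ?J ?n \<noteq> 0" unfolding c using assms by simp
  then show "?J \<noteq> 0" by auto
  show d: "degree ?J = ?n" using le nz le_degree[of ?J ?n] by simp
  show "lead_coeff ?J = (of_nat (degree K) - of_nat w * of_nat (degree P)) * lead_coeff K * lead_coeff P"
    unfolding d by (rule c)
qed

fun recip_num_poly :: "complex poly \<Rightarrow> nat \<Rightarrow> nat \<Rightarrow> complex poly" where
  "recip_num_poly P p 0 = 1"
| "recip_num_poly P p (Suc j) = pderiv (recip_num_poly P p j) * P - smult (of_nat (p + j)) (recip_num_poly P p j * pderiv P)"

text \<open>\<open>p > 0\<close> keeps \<open>j * (degree P - 1)\<close> below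
  \<open>(p + j) * degree P\<close>, so no step of the recursion loses its leading term, and each
  raises the degree by \<open>degree P - 1\<close>.\<close>

lemma recip_num_poly_degree:
  assumes "degree P > 0" "p > 0"
  shows "recip_num_poly P p j \<noteq> 0 \<and> degree (recip_num_poly P p j) = j * (degree P - 1)"
proof (induction j)
  case (Suc j)
  have P: "P \<noteq> 0" using assms by auto
  have ne: "degree (recip_num_poly P p j) \<noteq> (p + j) * degree P"
  proof -
    have "j * (degree P - 1) \<le> j * degree P" by simp
    also have "\<dots> < (p + j) * degree P" using assms by simp
    finally show ?thesis using Suc by simp
  qed
  have "degree (recip_num_poly P p (Suc j)) = j * (degree P - 1) + degree P - 1"
    using degree_Wronskian(2)[OF _ P ne assms(1)] Suc by simp
  also have "\<dots> = Suc j * (degree P - 1)" using assms by simp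
  finally show ?case using degree_Wronskian(1)[OF _ P ne assms(1)] Suc by simp
qed simp

text \<open>The term \<open>c * P ^ w\<close> drops out of the Wronskian of \<open>E\<close> and \<open>P\<close>, which therefore has small degree.\<close>

lemma card_roots_off:
  fixes K P :: "complex poly" and w :: nat and c :: complex
  defines "E \<equiv> K - smult c (P ^ w)"
  assumes "K \<noteq> 0" "degree P > 0" "degree K < w * degree P" "c \<noteq> 0"
  shows "E \<noteq> 0"
    and "w * degree P + 1 \<le> degree K + card {z. poly P z = 0} + card {z. poly E z = 0 \<and> poly P z \<noteq> 0}"
proof -
  have P: "P \<noteq> 0" using assms by auto
  have dw: "degree (smult c (P ^ w)) = w * degree P" using assms P by (simp add: degree_power_eq)
  have dE: "degree E = w * degree P"
  proof -
    have "degree (- smult c (P ^ w) + K) = degree (- smult c (P ^ w))"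
      by (rule degree_add_eq_left) (use dw assms in simp)
    then show ?thesis unfolding E_def using dw by simp
  qed
  then show E: "E \<noteq> 0" using assms by auto
  define J where "J = pderiv K * P - smult (of_nat w) (K * pderiv P)"
  have J: "J \<noteq> 0" "degree J = degree K + degree P - 1"
    unfolding J_def using degree_Wronskian[of K P w] assms P by auto
  have "w > 0" using assms by (cases w) auto
  then have "pderiv (P ^ w) * P = smult (of_nat w) (P ^ w * pderiv P)"
  proof (cases w)
    case (Suc v)
    show ?thesis unfolding Suc pderiv_power_Suc mult_smult_left by (simp only: power_Suc mult_ac)
  qed simp
  then have JE: "J = pderiv E * P - smult (of_nat w) (E * pderiv P)"
    unfolding J_def E_def
    by (simp add: pderiv_diff pderiv_smult algebra_simps smult_diff_right)
  have "degree E + degree P \<le> degree J + card {z. poly (E * P) z = 0}"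
    unfolding JE by (rule degree_le_roots_Wronskian) (use E P J JE in auto)
  also have "{z. poly (E * P) z = 0} = {z. poly P z = 0} \<union> {z. poly E z = 0 \<and> poly P z \<noteq> 0}" by auto
  also have "card \<dots> \<le> card {z. poly P z = 0} + card {z. poly E z = 0 \<and> poly P z \<noteq> 0}"
    by (rule card_Un_le)
  finally show "w * degree P + 1 \<le> degree K + card {z. poly P z = 0} + card {z. poly E z = 0 \<and> poly P z \<noteq> 0}"
    unfolding dE J(2) using assms(3) by linarith
qed

lemma card_roots_le_degree:
  fixes P :: "complex poly" assumes "P \<noteq> 0" shows "card {z. poly P z = 0} \<le> degree P"
proof -
  have "card (set_mset (proots P)) \<le> size (proots P)"
    unfolding size_multiset_overloaded_eq card_eq_sum by (rule sum_mono) simp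
  then show ?thesis using assms by (simp add: size_proots_complex)
qed

lemma card_multiple_roots:
  fixes P :: "complex poly" assumes "P \<noteq> 0" "\<And>z. poly P z = 0 \<Longrightarrow> poly (pderiv P) z = 0"
  shows "2 * card {z. poly P z = 0} \<le> degree P"
proof -
  let ?R = "{z. poly P z = 0}"
  have "2 * card ?R = (\<Sum>z\<in>?R. 2)" by simp
  also have "\<dots> \<le> (\<Sum>z\<in>?R. order z P)"
  proof (rule sum_mono)
    fix z assume "z \<in> ?R"
    then have z: "poly P z = 0" "poly (pderiv P) z = 0" using assms by auto
    have "pderiv P \<noteq> 0"
    proof
      assume "pderiv P = 0"
      then obtain c where "P = [:c:]" by (metis degree_eq_zeroE pderiv_eq_0_iff)
      then show False using z(1) assms(1) by simp
    qed
    then have "order z (pderiv P) > 0" using z by (simp add: order_root)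
    moreover have "order z P = Suc (order z (pderiv P))"
      using order_pderiv[of P z] \<open>pderiv P \<noteq> 0\<close> z assms(1) by (metis order_root)
    ultimately show "2 \<le> order z P" by simp
  qed
  also have "\<dots> = size (proots P)" using assms(1) by (simp add: size_multiset_overloaded_eq)
  finally show ?thesis by (simp add: size_proots_complex)
qed

section \<open>Locally uniform convergence\<close>

text \<open>Locally uniform convergence at \<open>z\<close>, expressed as continuous convergence:
  \<open>F n x\<close> tends to \<open>g z\<close> as \<open>n\<close> and \<open>x\<close> tend to infinity and to \<open>z\<close> independently.\<close>

definition conv_at :: "(nat \<Rightarrow> complex \<Rightarrow> complex) \<Rightarrow> (complex \<Rightarrow> complex) \<Rightarrow> complex \<Rightarrow> bool" where
  "conv_at F g z \<longleftrightarrow> ((\<lambda>(n, x). F n x) \<longlongrightarrow> g z) (sequentially \<times>\<^sub>F nhds z)"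

definition conv_inf_at :: "(nat \<Rightarrow> complex \<Rightarrow> complex) \<Rightarrow> complex \<Rightarrow> bool" where
  "conv_inf_at F z \<longleftrightarrow> filterlim (\<lambda>(n, x). F n x) at_infinity (sequentially \<times>\<^sub>F nhds z)"

text \<open>Rescaled functions live on discs that grow with \<open>n\<close>, so on a fixed disc
  they are holomorphic only from some index on.\<close>

definition holo_near :: "(nat \<Rightarrow> complex \<Rightarrow> complex) \<Rightarrow> complex \<Rightarrow> bool" where
  "holo_near F z \<longleftrightarrow> (\<exists>r>0. \<forall>\<^sub>F n in sequentially. F n holomorphic_on ball z r)"

lemma eventually_seq_nhds:
  "eventually P (sequentially \<times>\<^sub>F nhds (z::complex)) \<longleftrightarrow> (\<exists>N. \<exists>r>0. \<forall>n\<ge>N. \<forall>x\<in>ball z r. P (n, x))"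
proof
  assume "eventually P (sequentially \<times>\<^sub>F nhds z)"
  then obtain Pf Pg where "eventually Pf sequentially" "eventually Pg (nhds z)" "\<And>x y. Pf x \<Longrightarrow> Pg y \<Longrightarrow> P (x, y)"
    unfolding eventually_prod_filter by auto
  then show "\<exists>N. \<exists>r>0. \<forall>n\<ge>N. \<forall>x\<in>ball z r. P (n, x)"
    unfolding eventually_sequentially eventually_nhds_metric by (metis dist_commute mem_ball)
next
  assume "\<exists>N. \<exists>r>0. \<forall>n\<ge>N. \<forall>x\<in>ball z r. P (n, x)"
  then obtain N r where "r > 0" "\<forall>n\<ge>N. \<forall>x\<in>ball z r. P (n, x)" by auto
  then show "eventually P (sequentially \<times>\<^sub>F nhds z)"
    unfolding eventually_prod_filter
    by (intro exI[of _ "\<lambda>n. n \<ge> N"] exI[of _ "\<lambda>x. x \<in> ball z r"])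
      (auto intro!: eventually_nhds_in_open eventually_ge_at_top simp flip: mem_ball)
qed

lemma conv_at_iff:
  "conv_at F g z \<longleftrightarrow> (\<forall>e>0. \<exists>N. \<exists>r>0. \<forall>n\<ge>N. \<forall>x\<in>ball z r. dist (F n x) (g z) < e)"
  unfolding conv_at_def tendsto_iff eventually_seq_nhds by simp

lemma conv_inf_at_iff:
  "conv_inf_at F z \<longleftrightarrow> (\<forall>B. \<exists>N. \<exists>r>0. \<forall>n\<ge>N. \<forall>x\<in>ball z r. B < norm (F n x))"
proof -
  have "conv_inf_at F z \<longleftrightarrow> (\<forall>B. \<forall>\<^sub>F p in sequentially \<times>\<^sub>F nhds z. B < norm ((\<lambda>(n, x). F n x) p))"
    unfolding conv_inf_at_def filterlim_at_infinity_conv_norm_at_top filterlim_at_top_dense ..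
  then show ?thesis unfolding eventually_seq_nhds by simp
qed

lemma conv_at_seq:
  assumes "conv_at F g z" "x \<longlonglongrightarrow> z" shows "(\<lambda>n. F n (x n)) \<longlonglongrightarrow> g z"
proof -
  have "filterlim (\<lambda>n. (n, x n)) (sequentially \<times>\<^sub>F nhds z) sequentially"
    by (intro filterlim_Pair filterlim_ident assms)
  from filterlim_compose[OF assms(1)[unfolded conv_at_def] this] show ?thesis by simp
qed

lemma conv_at_pointwise: "conv_at F g z \<Longrightarrow> (\<lambda>n. F n z) \<longlonglongrightarrow> g z"
  by (rule conv_at_seq) auto

lemma conv_inf_at_seq:
  assumes "conv_inf_at F z" "x \<longlonglongrightarrow> z" shows "filterlim (\<lambda>n. F n (x n)) at_infinity sequentially"
proof -
  have "filterlim (\<lambda>n. (n, x n)) (sequentially \<times>\<^sub>F nhds z) sequentially"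
    by (intro filterlim_Pair filterlim_ident assms)
  from filterlim_compose[OF assms(1)[unfolded conv_inf_at_def] this] show ?thesis by simp
qed

lemma not_conv_at_conv_inf_at: assumes "conv_at F g z" "conv_inf_at F z" shows False
  using conv_at_pointwise[OF assms(1)] conv_inf_at_seq[OF assms(2) tendsto_const]
  by (metis not_tendsto_and_filterlim_at_infinity trivial_limit_sequentially)

lemma conv_at_const: "conv_at (\<lambda>_ _. c) (\<lambda>_. c) z"
  by (simp add: conv_at_def case_prod_unfold)

lemma conv_at_mult: "conv_at F f z \<Longrightarrow> conv_at G g z \<Longrightarrow> conv_at (\<lambda>n x. F n x * G n x) (\<lambda>x. f x * g x) z"
  unfolding conv_at_def case_prod_unfold by (rule tendsto_mult)

lemma conv_at_diff: "conv_at F f z \<Longrightarrow> conv_at G g z \<Longrightarrow> conv_at (\<lambda>n x. F n x - G n x) (\<lambda>x. f x - g x) z"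
  unfolding conv_at_def case_prod_unfold by (rule tendsto_diff)

lemma conv_at_power: "conv_at F f z \<Longrightarrow> conv_at (\<lambda>n x. F n x ^ k) (\<lambda>x. f x ^ k) z"
  unfolding conv_at_def case_prod_unfold by (rule tendsto_power)

lemma conv_at_prod: "(\<And>i. i \<in> I \<Longrightarrow> conv_at (F i) (f i) z) \<Longrightarrow> conv_at (\<lambda>n x. \<Prod>i\<in>I. F i n x) (\<lambda>x. \<Prod>i\<in>I. f i x) z"
  unfolding conv_at_def case_prod_unfold by (rule tendsto_prod)

lemma filterlim_subseq_nhds:
  assumes "strict_mono s"
  shows "filterlim (\<lambda>(n, x). (s n, x)) (sequentially \<times>\<^sub>F nhds z) (sequentially \<times>\<^sub>F nhds z)"
  unfolding case_prod_unfold
  by (intro filterlim_Pair filterlim_compose[OF filterlim_subseq[OF assms]] filterlim_fst filterlim_snd)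

lemma conv_at_subseq: "conv_at F g z \<Longrightarrow> strict_mono s \<Longrightarrow> conv_at (\<lambda>n. F (s n)) g z"
  using filterlim_compose[OF _ filterlim_subseq_nhds, of "\<lambda>(n, x). F n x" "nhds (g z)" z s]
  by (simp add: conv_at_def case_prod_unfold)

lemma conv_inf_at_subseq: "conv_inf_at F z \<Longrightarrow> strict_mono s \<Longrightarrow> conv_inf_at (\<lambda>n. F (s n)) z"
  using filterlim_compose[OF _ filterlim_subseq_nhds, of "\<lambda>(n, x). F n x" at_infinity z s]
  by (simp add: conv_inf_at_def case_prod_unfold)

lemma conv_at_shift: assumes "conv_at (\<lambda>n. F (k + n)) g z" shows "conv_at F g z"
  unfolding conv_at_iff
proof (intro allI impI)
  fix e :: real assume "e > 0"
  then obtain N r where r: "r > 0" "\<And>n x. n \<ge> N \<Longrightarrow> x \<in> ball z r \<Longrightarrow> dist (F (k + n) x) (g z) < e"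
    using assms unfolding conv_at_iff by meson
  then have "dist (F n x) (g z) < e" if "n \<ge> N + k" "x \<in> ball z r" for n x
    using r(2)[of "n - k" x] that by simp
  then show "\<exists>N. \<exists>r>0. \<forall>n\<ge>N. \<forall>x\<in>ball z r. dist (F n x) (g z) < e" using r(1) by blast
qed

lemma conv_inf_at_shift: assumes "conv_inf_at (\<lambda>n. F (k + n)) z" shows "conv_inf_at F z"
  unfolding conv_inf_at_iff
proof
  fix B
  obtain N r where r: "r > 0" "\<And>n x. n \<ge> N \<Longrightarrow> x \<in> ball z r \<Longrightarrow> B < norm (F (k + n) x)"
    using assms unfolding conv_inf_at_iff by meson
  then have "B < norm (F n x)" if "n \<ge> N + k" "x \<in> ball z r" for n x
    using r(2)[of "n - k" x] that by simp
  then show "\<exists>N. \<exists>r>0. \<forall>n\<ge>N. \<forall>x\<in>ball z r. B < norm (F n x)" using r(1) by blast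
qed

lemma conv_at_uniform:
  assumes "compact K" "\<And>z. z \<in> K \<Longrightarrow> conv_at F g z"
  shows "uniform_limit K F g sequentially"
  unfolding uniform_limit_iff
proof (intro allI impI)
  fix e :: real assume e: "e > 0"
  have "\<forall>z\<in>K. \<exists>N. \<exists>r>0. \<forall>n\<ge>N. \<forall>x\<in>ball z r. dist (F n x) (g z) < e / 2"
    using assms(2) e unfolding conv_at_iff by (metis half_gt_zero)
  then obtain N r where Nr: "\<And>z. z \<in> K \<Longrightarrow> r z > 0"
    "\<And>z n x. z \<in> K \<Longrightarrow> n \<ge> N z \<Longrightarrow> x \<in> ball z (r z) \<Longrightarrow> dist (F n x) (g z) < e / 2"
    by metis
  have "K \<subseteq> (\<Union>z\<in>K. ball z (r z))" using Nr(1) by force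
  then obtain T where T: "T \<subseteq> K" "finite T" "K \<subseteq> (\<Union>z\<in>T. ball z (r z))"
    using compactE_image[OF assms(1), of K "\<lambda>z. ball z (r z)"] by (metis open_ball)
  define M where "M = Max (insert 0 (N ` T))"
  have "dist (F n x) (g x) < e" if n: "n \<ge> M" and x: "x \<in> K" for n x
  proof -
    obtain z where z: "z \<in> T" "x \<in> ball z (r z)" using T(3) x by blast
    then have zK: "z \<in> K" using T by auto
    have "N z \<le> M" unfolding M_def using z T by (intro Max_ge) auto
    then have 1: "dist (F n x) (g z) < e / 2" using Nr(2)[OF zK _ z(2)] n by simp
    \<comment> \<open>Letting \<open>n\<close> tend to infinity at the fixed point \<open>x\<close>
      bounds the oscillation of \<open>g\<close> itself, which makes the estimate uniform on the
      ball.\<close>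
    have "dist (g x) (g z) \<le> e / 2"
    proof (rule tendsto_upperbound)
      show "((\<lambda>n. dist (F n x) (g z)) \<longlongrightarrow> dist (g x) (g z)) sequentially"
        by (intro tendsto_intros conv_at_pointwise assms x)
      show "\<forall>\<^sub>F n in sequentially. dist (F n x) (g z) \<le> e / 2"
        using Nr(2)[OF zK _ z(2)] by (intro eventually_sequentiallyI[of "N z"]) (auto intro: less_imp_le)
    qed simp
    then show ?thesis using 1 dist_triangle2[of "F n x" "g x" "g z"] by linarith
  qed
  then show "\<forall>\<^sub>F n in sequentially. \<forall>x\<in>K. dist (F n x) (g x) < e"
    by (intro eventually_sequentiallyI[of M]) auto
qed

lemma conv_inf_at_uniform:
  assumes "compact K" "\<And>z. z \<in> K \<Longrightarrow> conv_inf_at F z"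
  shows "\<forall>\<^sub>F n in sequentially. \<forall>x\<in>K. B < norm (F n x)"
proof -
  have "\<forall>z\<in>K. \<exists>N. \<exists>r>0. \<forall>n\<ge>N. \<forall>x\<in>ball z r. B < norm (F n x)"
    using assms(2) unfolding conv_inf_at_iff by metis
  then obtain N r where Nr: "\<And>z. z \<in> K \<Longrightarrow> r z > 0"
    "\<And>z n x. z \<in> K \<Longrightarrow> n \<ge> N z \<Longrightarrow> x \<in> ball z (r z) \<Longrightarrow> B < norm (F n x)"
    by metis
  have "K \<subseteq> (\<Union>z\<in>K. ball z (r z))" using Nr(1) by force
  then obtain T where T: "T \<subseteq> K" "finite T" "K \<subseteq> (\<Union>z\<in>T. ball z (r z))"
    using compactE_image[OF assms(1), of K "\<lambda>z. ball z (r z)"] by (metis open_ball)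
  define M where "M = Max (insert 0 (N ` T))"
  have "B < norm (F n x)" if n: "n \<ge> M" and x: "x \<in> K" for n x
  proof -
    obtain z where z: "z \<in> T" "x \<in> ball z (r z)" using T(3) x by blast
    then have zK: "z \<in> K" using T by auto
    have "N z \<le> M" unfolding M_def using z T by (intro Max_ge) auto
    then show ?thesis using Nr(2)[OF zK _ z(2)] n by simp
  qed
  then show ?thesis by (intro eventually_sequentiallyI[of M]) auto
qed

lemma uniform_imp_conv_at:
  assumes "open S" "uniform_limit S F g sequentially" "continuous_on S g" "z \<in> S"
  shows "conv_at F g z"
  unfolding conv_at_iff
proof (intro allI impI)
  fix e :: real assume e: "e > 0"
  obtain N where N: "\<And>n x. n \<ge> N \<Longrightarrow> x \<in> S \<Longrightarrow> dist (F n x) (g x) < e / 2"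
    using assms(2) e unfolding uniform_limit_iff eventually_sequentially by (meson half_gt_zero)
  obtain d where d: "d > 0" "\<And>x. x \<in> S \<Longrightarrow> dist x z < d \<Longrightarrow> dist (g x) (g z) < e / 2"
    using assms(3,4) e unfolding continuous_on_iff by (meson half_gt_zero)
  obtain r where r: "r > 0" "ball z r \<subseteq> S" using assms(1,4) open_contains_ball by blast
  have "dist (F n x) (g z) < e" if "n \<ge> N" "x \<in> ball z (min d r)" for n x
  proof -
    have "x \<in> S" "dist x z < d" using that r by (auto simp: dist_commute)
    then show ?thesis using N[OF that(1)] d(2) dist_triangle_half_l dist_commute
      by (metis dist_triangle_half_r)
  qed
  then show "\<exists>N. \<exists>r>0. \<forall>n\<ge>N. \<forall>x\<in>ball z r. dist (F n x) (g z) < e"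
    using d r by (intro exI[of _ N] exI[of _ "min d r"]) auto
qed

lemma conv_at_holomorphic:
  assumes "open S" "\<And>z. z \<in> S \<Longrightarrow> conv_at F g z" "\<And>z. z \<in> S \<Longrightarrow> holo_near F z"
  shows "g holomorphic_on S"
proof -
  have "g analytic_on S" unfolding analytic_on_def
  proof
    fix z assume z: "z \<in> S"
    obtain r where r: "r > 0" "\<forall>\<^sub>F n in sequentially. F n holomorphic_on ball z r"
      using assms(3)[OF z] by (auto simp: holo_near_def)
    obtain d where d: "d > 0" "ball z d \<subseteq> S" using assms(1) z open_contains_ball by blast
    define e where "e = min r d / 2"
    have e: "e > 0" "cball z e \<subseteq> ball z r" "cball z e \<subseteq> S" using r d by (auto simp: e_def subset_iff)
    have "\<forall>\<^sub>F n in sequentially. continuous_on (cball z e) (F n) \<and> F n holomorphic_on ball z e"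
      using r(2)
    proof eventually_elim
      case (elim n)
      then show ?case using e
        by (meson ball_subset_cball holomorphic_on_imp_continuous_on holomorphic_on_subset)
    qed
    moreover have "uniform_limit (cball z e) F g sequentially"
      by (rule conv_at_uniform) (use assms(2) e in auto)
    ultimately have "g holomorphic_on ball z e"
      by (rule holomorphic_uniform_limit) auto
    then show "\<exists>\<epsilon>>0. g holomorphic_on ball z \<epsilon>" using e by auto
  qed
  then show ?thesis by (rule analytic_imp_holomorphic)
qed

lemma conv_at_deriv:
  assumes "open S" "\<And>z. z \<in> S \<Longrightarrow> conv_at F g z" "\<And>z. z \<in> S \<Longrightarrow> holo_near F z" "z \<in> S"
  shows "conv_at (\<lambda>n. deriv (F n)) (deriv g) z"
proof -
  have g: "g holomorphic_on S" by (rule conv_at_holomorphic) fact+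
  obtain r where r: "r > 0" "\<forall>\<^sub>F n in sequentially. F n holomorphic_on ball z r"
    using assms(3)[OF assms(4)] by (auto simp: holo_near_def)
  obtain d where d: "d > 0" "ball z d \<subseteq> S" using assms(1,4) open_contains_ball by blast
  define e where "e = min r d / 2"
  have e: "e > 0" "cball z e \<subseteq> ball z r" "cball z e \<subseteq> S" using r d by (auto simp: e_def subset_iff)
  have ul: "uniform_limit (cball z e) F g sequentially"
    by (rule conv_at_uniform) (use assms(2) e in auto)
  show ?thesis
  proof (rule uniform_imp_conv_at)
    show "continuous_on (ball z (e/2)) (deriv g)"
      using e by (intro holomorphic_on_imp_continuous_on holomorphic_deriv holomorphic_on_subset[OF g])
        (auto simp: subset_iff)
    show "uniform_limit (ball z (e/2)) (\<lambda>n. deriv (F n)) (deriv g) sequentially"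
      unfolding uniform_limit_iff
    proof (intro allI impI)
      fix \<epsilon> :: real assume "\<epsilon> > 0"
      \<comment> \<open>Cauchy's inequality with radius \<open>e / 2\<close> turns
        \<open>\<epsilon> * e / 4\<close> into \<open>\<epsilon> / 2\<close>.\<close>
      then have "\<forall>\<^sub>F n in sequentially. \<forall>x\<in>cball z e. dist (F n x) (g x) < \<epsilon> * e / 4"
        using ul e unfolding uniform_limit_iff by (elim allE[of _ "\<epsilon> * e / 4"] impE) auto
      then show "\<forall>\<^sub>F n in sequentially. \<forall>x\<in>ball z (e/2). dist (deriv (F n) x) (deriv g x) < \<epsilon>"
        using r(2)
      proof eventually_elim
        case (elim n)
        show ?case
        proof
          fix x assume x: "x \<in> ball z (e/2)"
          have sub: "cball x (e/2) \<subseteq> cball z e"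
          proof
            fix y assume "y \<in> cball x (e/2)"
            then show "y \<in> cball z e" using x dist_triangle[of z y x] by auto
          qed
          have hF: "F n holomorphic_on cball z e" using elim(2) e(2) by (rule holomorphic_on_subset)
          have hg: "g holomorphic_on cball z e" using g e(3) by (rule holomorphic_on_subset)
          have hd: "(\<lambda>y. F n y - g y) holomorphic_on cball x (e/2)"
            by (intro holomorphic_intros holomorphic_on_subset[OF hF] holomorphic_on_subset[OF hg] sub)
          have "norm ((deriv ^^ 1) (\<lambda>y. F n y - g y) x) \<le> fact 1 * (\<epsilon> * e / 4) / (e/2) ^ 1"
          proof (rule Cauchy_inequality)
            show "(\<lambda>y. F n y - g y) holomorphic_on ball x (e/2)"
              using hd by (rule holomorphic_on_subset) auto
            show "continuous_on (cball x (e/2)) (\<lambda>y. F n y - g y)"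
              using hd by (rule holomorphic_on_imp_continuous_on)
            fix y assume "norm (x - y) = e/2"
            then have "y \<in> cball z e" using sub by (auto simp: dist_norm)
            then show "norm (F n y - g y) \<le> \<epsilon> * e / 4" using elim(1) by (auto simp: dist_norm intro: less_imp_le)
          qed (use e in auto)
          also have "fact 1 * (\<epsilon> * e / 4) / (e/2) ^ 1 = \<epsilon> / 2" using e by simp
          finally have "norm (deriv (\<lambda>y. F n y - g y) x) \<le> \<epsilon> / 2" by simp
          moreover have "deriv (\<lambda>y. F n y - g y) x = deriv (F n) x - deriv g x"
          proof (rule deriv_diff)
            have xb: "x \<in> ball z r" "x \<in> S" using x e by (auto simp: subset_iff)
            show "F n field_differentiable at x"
              using elim(2) xb by (auto intro: holomorphic_on_imp_differentiable_at)
            show "g field_differentiable at x"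
              using g xb assms(1) by (auto intro: holomorphic_on_imp_differentiable_at)
          qed
          ultimately show "dist (deriv (F n) x) (deriv g x) < \<epsilon>" using \<open>\<epsilon> > 0\<close> by (simp add: dist_norm)
        qed
      qed
    qed
  qed (use e in auto)
qed

text \<open>If infinitely many \<open>F n\<close> were zero-free near \<open>z0\<close>, Hurwitz's
  theorem along that subsequence would forbid a zero of \<open>g\<close> unless \<open>g\<close> is
  constant nearby. In that case the identity theorem makes \<open>g\<close> vanish on all of
  \<open>S\<close>.\<close>

lemma Hurwitz_zero:
  assumes S: "open S" "connected S" and F: "\<And>z. z \<in> S \<Longrightarrow> conv_at F g z" "\<And>z. z \<in> S \<Longrightarrow> holo_near F z"
    and z0: "z0 \<in> S" "g z0 = 0" and nz: "\<not> (\<forall>z\<in>S. g z = 0)" and "e > 0"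
  shows "\<forall>\<^sub>F n in sequentially. \<exists>x\<in>ball z0 e. F n x = 0"
proof (rule ccontr)
  assume neg: "\<not> ?thesis"
  have g: "g holomorphic_on S" by (rule conv_at_holomorphic) fact+
  obtain r where r: "r > 0" "\<forall>\<^sub>F n in sequentially. F n holomorphic_on ball z0 r"
    using F(2)[OF z0(1)] by (auto simp: holo_near_def)
  obtain d where d: "d > 0" "ball z0 d \<subseteq> S" using S(1) z0 open_contains_ball by blast
  define \<rho> where "\<rho> = min e (min r d)"
  have \<rho>: "\<rho> > 0" "ball z0 \<rho> \<subseteq> S" "ball z0 \<rho> \<subseteq> ball z0 e" "ball z0 \<rho> \<subseteq> ball z0 r"
    using r d \<open>e > 0\<close> by (auto simp: \<rho>_def subset_iff)
  have "\<exists>\<^sub>F n in sequentially. \<forall>x\<in>ball z0 e. F n x \<noteq> 0"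
    using neg by (simp add: not_eventually)
  then have "\<exists>\<^sub>F n in sequentially. (\<forall>x\<in>ball z0 e. F n x \<noteq> 0) \<and> F n holomorphic_on ball z0 r"
    using r(2) by (rule frequently_eventually_frequently)
  then have "infinite {n. (\<forall>x\<in>ball z0 e. F n x \<noteq> 0) \<and> F n holomorphic_on ball z0 r}"
    by (simp add: frequently_cofinite flip: cofinite_eq_sequentially)
  then obtain t :: "nat \<Rightarrow> nat" where t: "strict_mono t"
    "\<And>n. (\<forall>x\<in>ball z0 e. F (t n) x \<noteq> 0) \<and> F (t n) holomorphic_on ball z0 r"
    by (auto dest!: infinite_enumerate)
  have nc: "\<not> g constant_on ball z0 \<rho>"
  proof
    assume "g constant_on ball z0 \<rho>"
    then have 0: "g x = 0" if "x \<in> ball z0 \<rho>" for x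
      using that z0 \<rho>(1) by (metis centre_in_ball constant_on_def)
    have "g x = 0" if "x \<in> S" for x
      by (rule analytic_continuation_open[of "ball z0 \<rho>" S g "\<lambda>_. 0"]) (use \<rho> S g 0 that in auto)
    then show False using nz by blast
  qed
  have "g z0 \<noteq> 0"
  proof (rule Hurwitz_no_zeros[of "ball z0 \<rho>" "\<lambda>n. F (t n)" g])
    show "F (t n) holomorphic_on ball z0 \<rho>" for n
      using t(2) \<rho>(4) holomorphic_on_subset by blast
    show "g holomorphic_on ball z0 \<rho>" using g \<rho>(2) by (rule holomorphic_on_subset)
    show "uniform_limit K (\<lambda>n. F (t n)) g sequentially" if "compact K" "K \<subseteq> ball z0 \<rho>" for K
      using that \<rho>(2) by (intro conv_at_uniform conv_at_subseq[OF F(1) t(1)]) auto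
    show "F (t n) z \<noteq> 0" if "z \<in> ball z0 \<rho>" for n z using t(2) \<rho>(3) that by blast
  qed (use \<rho> nc in auto)
  then show False using z0 by simp
qed

section \<open>Spherical limits of holomorphic functions\<close>

definition conv_on :: "(nat \<Rightarrow> complex \<Rightarrow> complex) \<Rightarrow> complex set \<Rightarrow> bool" where
  "conv_on F S \<longleftrightarrow> (\<exists>g. \<forall>z\<in>S. conv_at F g z) \<or> (\<forall>z\<in>S. conv_inf_at F z)"

lemma conv_on_subset: "conv_on F S \<Longrightarrow> T \<subseteq> S \<Longrightarrow> conv_on F T"
  unfolding conv_on_def by blast

lemma conv_on_subseq: "conv_on F S \<Longrightarrow> strict_mono s \<Longrightarrow> conv_on (\<lambda>n. F (s n)) S"
  unfolding conv_on_def using conv_at_subseq conv_inf_at_subseq by blast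

lemma conv_on_shift: "conv_on (\<lambda>n. F (k + n)) S \<Longrightarrow> conv_on F S"
  unfolding conv_on_def using conv_at_shift conv_inf_at_shift by blast

text \<open>A diagonal sequence over a countable basis converges near every point; the regions of finite
  and of infinite limit are both open, so one of them is empty.\<close>

lemma conv_on_patch:
  fixes F :: "nat \<Rightarrow> complex \<Rightarrow> complex"
  assumes S: "open S" "connected S"
    and loc: "\<And>z s. z \<in> S \<Longrightarrow> strict_mono s \<Longrightarrow>
      \<exists>t r. strict_mono (t :: nat \<Rightarrow> nat) \<and> r > 0 \<and> conv_on (\<lambda>n. F (s (t n))) (ball z r)"
  shows "\<exists>t. strict_mono t \<and> conv_on (\<lambda>n. F (t n)) S"
proof -
  obtain \<B> :: "complex set set" where \<B>: "countable \<B>" "topological_basis \<B>"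
    using ex_countable_basis by auto
  have ne: "\<B> \<noteq> {}" using \<B>(2) topological_basisE[of \<B> UNIV 0] by auto
  define B where "B = from_nat_into \<B>"
  \<comment> \<open>Either the sequence already converges on the basis set or no subsequence does.
    Some subsequence always has this property and it passes to further subsequences, as the diagonal
    construction demands; \<open>loc\<close> later rules out the second alternative on small basis
    sets.\<close>
  define P where "P k s \<longleftrightarrow> conv_on (\<lambda>n. F (s n)) (B k) \<or>
    (\<forall>t. strict_mono t \<longrightarrow> \<not> conv_on (\<lambda>n. F (s (t n))) (B k))" for k and s :: "nat \<Rightarrow> nat"
  interpret subseqs P
  proof
    fix n and s :: "nat \<Rightarrow> nat"
    show "\<exists>r'. strict_mono r' \<and> P n (s \<circ> r')"
    proof (cases "\<exists>t. strict_mono t \<and> conv_on (\<lambda>n. F (s (t n))) (B n)")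
      case True
      then show ?thesis unfolding P_def o_def by blast
    next
      case False
      then show ?thesis unfolding P_def o_def by (intro exI[of _ "\<lambda>x. x"]) (auto simp: strict_mono_def)
    qed
  qed
  have P: "P k (diagseq \<circ> ((+) (Suc k)))" for k
  proof (rule diagseq_holds)
    fix r s :: "nat \<Rightarrow> nat" and n assume r: "strict_mono r" and Ps: "P n s"
    then show "P n (s \<circ> r)" unfolding P_def o_def
      using conv_on_subseq[of "\<lambda>n. F (s n)" "B n" r] strict_mono_o[OF r, unfolded o_def] by blast
  qed
  define d where "d = diagseq"
  have d: "strict_mono d" unfolding d_def by (rule subseq_diagseq)
  define F' where "F' = (\<lambda>n. F (d n))"
  have nb: "\<exists>U. open U \<and> z \<in> U \<and> conv_on F' U" if z: "z \<in> S" for z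
  proof -
    obtain t r where t: "strict_mono t" "r > 0" "conv_on (\<lambda>n. F (d (t n))) (ball z r)"
      using loc[OF z d] by blast
    obtain U where U: "U \<in> \<B>" "z \<in> U" "U \<subseteq> ball z r"
      using topological_basisE[OF \<B>(2), of "ball z r" z] t(2) by auto
    obtain k where k: "U = B k" using U(1) \<B>(1) unfolding B_def by (metis from_nat_into_surj)
    \<comment> \<open>The property is known for the diagonal sequence shifted by
      \<open>Suc k\<close>, so the subsequence \<open>t\<close> is re-indexed as a subsequence of
      that shift; \<open>seq_suble\<close> keeps the subtraction exact.\<close>
    define t' where "t' = (\<lambda>n. t (Suc k + n) - Suc k)"
    have ge: "t (Suc k + n) \<ge> Suc k + n" for n using t(1) by (rule seq_suble)
    have t': "strict_mono t'" unfolding strict_mono_Suc_iff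
    proof
      fix n
      have "t (Suc k + n) < t (Suc k + Suc n)" using t(1) by (simp add: strict_mono_def)
      then show "t' n < t' (Suc n)" using ge[of n] ge[of "Suc n"] unfolding t'_def by linarith
    qed
    have eq: "(d \<circ> (+) (Suc k)) (t' n) = d (t (Suc k + n))" for n
      using ge[of n] unfolding t'_def by simp
    have "conv_on (\<lambda>n. F (d (t (Suc k + n)))) (B k)"
      using conv_on_subseq[OF conv_on_subset[OF t(3), of U], of "\<lambda>n. Suc k + n"] U(3) k
      by (simp add: strict_mono_def)
    then have "conv_on (\<lambda>n. F ((d \<circ> (+) (Suc k)) (t' n))) (B k)" unfolding eq .
    then have "conv_on (\<lambda>n. F ((d \<circ> (+) (Suc k)) n)) (B k)"
      using P[of k] t' unfolding P_def d_def by blast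
    then have "conv_on (\<lambda>n. F' (Suc k + n)) (B k)" by (simp add: F'_def)
    then have "conv_on F' (B k)" by (rule conv_on_shift)
    moreover have "open U" using U(1) \<B>(2) by (simp add: topological_basis_open)
    ultimately show ?thesis using U k by blast
  qed
  \<comment> \<open>Pointwise limits glue the limit functions of the various neighbourhoods into
    one.\<close>
  define g where "g x = lim (\<lambda>n. F' n x)" for x
  have glim: "conv_at F' g x" if "conv_at F' h x" for h x
  proof -
    have "g x = h x" unfolding g_def using conv_at_pointwise[OF that] by (rule limI)
    then show ?thesis using that by (simp add: conv_at_def)
  qed
  define A where "A = \<Union>{U. open U \<and> (\<forall>x\<in>U. conv_at F' g x)}"
  define C where "C = \<Union>{U. open U \<and> (\<forall>x\<in>U. conv_inf_at F' x)}"
  have "open A" "open C" by (auto simp: A_def C_def)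
  moreover have "S \<subseteq> A \<union> C"
  proof
    fix z assume "z \<in> S"
    from nb[OF this] obtain U where "open U" "z \<in> U" "conv_on F' U" by blast
    then show "z \<in> A \<union> C" unfolding conv_on_def A_def C_def using glim by blast
  qed
  moreover have "A \<inter> C = {}" unfolding A_def C_def using not_conv_at_conv_inf_at by blast
  ultimately have "A \<inter> S = {} \<or> C \<inter> S = {}" using S(2) connectedD by blast
  then have "(\<forall>z\<in>S. conv_inf_at F' z) \<or> (\<forall>z\<in>S. conv_at F' g z)"
    using \<open>S \<subseteq> A \<union> C\<close> unfolding A_def C_def by blast
  then have "conv_on F' S" unfolding conv_on_def by blast
  then show ?thesis using d unfolding F'_def by blast
qed

lemma Montel_conv_at:
  assumes "open S" "\<And>n. F n holomorphic_on S" "\<And>n x. x \<in> S \<Longrightarrow> norm (F n x) \<le> B"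
  shows "\<exists>t g. strict_mono (t :: nat \<Rightarrow> nat) \<and> g holomorphic_on S \<and> (\<forall>x\<in>S. conv_at (\<lambda>n. F (t n)) g x)"
proof -
  obtain g t where gt: "g holomorphic_on S" "strict_mono (t :: nat \<Rightarrow> nat)"
    "\<And>K. compact K \<Longrightarrow> K \<subseteq> S \<Longrightarrow> uniform_limit K (F \<circ> t) g sequentially"
  proof (rule Montel[OF assms(1), of "range F" F])
    show "\<exists>B. \<forall>h\<in>range F. \<forall>z\<in>K. norm (h z) \<le> B" if "K \<subseteq> S" for K
      using assms(3) that by blast
  qed (use assms(2) in auto)
  have "conv_at (\<lambda>n. F (t n)) g x" if x: "x \<in> S" for x
  proof -
    obtain r where r: "r > 0" "cball x r \<subseteq> S" using assms(1) x open_contains_cball by blast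
    show ?thesis
    proof (rule uniform_imp_conv_at[of "ball x r"])
      show "uniform_limit (ball x r) (\<lambda>n. F (t n)) g sequentially"
        using gt(3)[of "cball x r"] r by (auto simp: o_def intro: uniform_limit_on_subset)
      show "continuous_on (ball x r) g"
        using gt(1) r by (meson ball_subset_cball holomorphic_on_imp_continuous_on holomorphic_on_subset)
    qed (use r in auto)
  qed
  then show ?thesis using gt by blast
qed

text \<open>The reciprocals are bounded by 2 and zero-free, so a subsequence of them converges. By
  Hurwitz its limit vanishes identically, and then \<open>F\<close> tends to infinity, or it has no
  zero, and then its reciprocal is the limit of \<open>F\<close>.\<close>

lemma Montel_conv_on:
  assumes F: "\<And>n. F n holomorphic_on ball z r" "\<And>n x. x \<in> ball z r \<Longrightarrow> norm (F n x) \<ge> 1/2" "r > 0"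
  shows "\<exists>t. strict_mono (t :: nat \<Rightarrow> nat) \<and> conv_on (\<lambda>n. F (t n)) (ball z r)"
proof -
  have nz: "F n x \<noteq> 0" if "x \<in> ball z r" for n x using F(2)[OF that, of n] by auto
  have "\<exists>t g. strict_mono (t :: nat \<Rightarrow> nat) \<and> g holomorphic_on ball z r \<and>
      (\<forall>x\<in>ball z r. conv_at (\<lambda>n x. inverse (F (t n) x)) g x)"
  proof (rule Montel_conv_at[where B = 2])
    show "(\<lambda>x. inverse (F n x)) holomorphic_on ball z r" for n
      using F(1) nz by (intro holomorphic_intros) auto
    show "norm (inverse (F n x)) \<le> 2" if "x \<in> ball z r" for n x
    proof -
      have "inverse (norm (F n x)) \<le> inverse (1/2)"
        using F(2)[OF that, of n] by (intro le_imp_inverse_le) auto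
      then show ?thesis by (simp add: norm_inverse)
    qed
  qed simp
  then obtain t g where t: "strict_mono (t :: nat \<Rightarrow> nat)" "g holomorphic_on ball z r"
      "\<And>x. x \<in> ball z r \<Longrightarrow> conv_at (\<lambda>n x. inverse (F (t n) x)) g x" by blast
  have "(\<forall>x\<in>ball z r. g x = 0) \<or> (\<forall>x\<in>ball z r. g x \<noteq> 0)"
  proof (cases "g constant_on ball z r")
    case True
    then show ?thesis unfolding constant_on_def by metis
  next
    case False
    have "g x \<noteq> 0" if "x \<in> ball z r" for x
    proof (rule Hurwitz_no_zeros[of "ball z r" "\<lambda>n x. inverse (F (t n) x)" g])
      show "(\<lambda>x. inverse (F (t n) x)) holomorphic_on ball z r" for n
        using F(1) nz by (intro holomorphic_intros) auto
      show "uniform_limit K (\<lambda>n x. inverse (F (t n) x)) g sequentially" if "compact K" "K \<subseteq> ball z r" for K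
        using that t(3) by (intro conv_at_uniform) auto
    qed (use that False t nz in auto)
    then show ?thesis by blast
  qed
  then have "conv_on (\<lambda>n. F (t n)) (ball z r)"
  proof
    assume 0: "\<forall>x\<in>ball z r. g x = 0"
    have "conv_inf_at (\<lambda>n. F (t n)) x" if x: "x \<in> ball z r" for x
    proof -
      have "((\<lambda>p. inverse (F (t (fst p)) (snd p))) \<longlongrightarrow> 0) (sequentially \<times>\<^sub>F nhds x)"
        using t(3)[OF x] 0 x by (simp add: conv_at_def case_prod_unfold)
      moreover have "\<forall>\<^sub>F p in sequentially \<times>\<^sub>F nhds x. inverse (F (t (fst p)) (snd p)) \<noteq> 0"
        unfolding eventually_seq_nhds using nz x openE[OF open_ball x]
        by (metis fst_conv inverse_nonzero_iff_nonzero snd_conv subsetD)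
      ultimately have "filterlim (\<lambda>p. inverse (inverse (F (t (fst p)) (snd p)))) at_infinity (sequentially \<times>\<^sub>F nhds x)"
        by (intro filterlim_compose[OF filterlim_inverse_at_infinity] filterlim_atI)
      then show ?thesis by (simp add: conv_inf_at_def case_prod_unfold)
    qed
    then show ?thesis by (simp add: conv_on_def)
  next
    assume n0: "\<forall>x\<in>ball z r. g x \<noteq> 0"
    have "conv_at (\<lambda>n. F (t n)) (\<lambda>x. inverse (g x)) x" if x: "x \<in> ball z r" for x
    proof -
      have "((\<lambda>p. inverse (inverse (F (t (fst p)) (snd p)))) \<longlongrightarrow> inverse (g x)) (sequentially \<times>\<^sub>F nhds x)"
        using t(3)[OF x] n0 x by (intro tendsto_inverse) (auto simp: conv_at_def case_prod_unfold)
      then show ?thesis by (simp add: conv_at_def case_prod_unfold)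
    qed
    then show ?thesis unfolding conv_on_def by blast
  qed
  then show ?thesis using t(1) by blast
qed

section \<open>Normality from a bounded spherical derivative\<close>

lemma first_exit:
  fixes u :: "real \<Rightarrow> real"
  assumes "continuous_on {0..1} u" "u 0 < b" "b \<le> u 1"
  obtains t where "0 \<le> t" "t \<le> 1" "u t = b" "\<And>s. 0 \<le> s \<Longrightarrow> s \<le> t \<Longrightarrow> u s \<le> b"
proof -
  define T where "T = {t \<in> {0..1}. b \<le> u t}"
  have T: "closed T" unfolding T_def
    using continuous_on_closed_Collect_le[of "{0..1}" "\<lambda>_. b" u] assms(1) by auto
  have ne: "T \<noteq> {}" "bdd_below T" using assms by (auto simp: T_def intro!: exI[of _ 1])
  define t where "t = Inf T"
  have tT: "t \<in> T" unfolding t_def by (rule closed_contains_Inf[OF ne T])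
  have lt: "u s < b" if "0 \<le> s" "s < t" for s
  proof (rule ccontr)
    assume "\<not> u s < b"
    then have "s \<in> T" using that tT by (auto simp: T_def)
    then have "t \<le> s" unfolding t_def using ne by (intro cInf_lower)
    then show False using that by simp
  qed
  have "u t \<le> b"
  proof (rule ccontr)
    assume "\<not> u t \<le> b"
    moreover have "\<exists>x\<ge>0. x \<le> t \<and> u x = b"
    proof (rule IVT')
      show "continuous_on {0..t} u" using assms(1) by (rule continuous_on_subset) (use tT in \<open>auto simp: T_def\<close>)
    qed (use assms tT in \<open>auto simp: T_def\<close>)
    ultimately show False using lt by (metis leI less_irrefl order_antisym_conv)
  qed
  then show thesis using that[of t] tT lt by (force simp: T_def le_less)
qed

text \<open>While \<open>cmod f \<le> 2\<close> the hypothesis bounds \<open>deriv f\<close> by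
  \<open>5 * M\<close>, so along a segment shorter than \<open>1 / (5 * M)\<close> the modulus
  cannot climb from 1 to 2. The same argument for \<open>1 / f\<close>, whose derivative is at most
  \<open>5 * M\<close> while \<open>cmod f \<ge> 1/2\<close>, gives the second claim.\<close>

lemma spherical_deriv_bound_small:
  assumes f: "f holomorphic_on ball z r" and M: "M > 0" "r \<le> 1 / (5 * M)"
    and bd: "\<And>x. x \<in> ball z r \<Longrightarrow> cmod (deriv f x) \<le> M * (1 + (cmod (f x))\<^sup>2)" and x: "x \<in> ball z r"
  shows "cmod (f z) \<le> 1 \<Longrightarrow> cmod (f x) \<le> 2" and "cmod (f z) \<ge> 1 \<Longrightarrow> cmod (f x) \<ge> 1/2"
proof -
  define \<gamma> where "\<gamma> = (\<lambda>t::real. z + of_real t * (x - z))"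
  have \<gamma>: "\<gamma> t \<in> ball z r" if "0 \<le> t" "t \<le> 1" for t
  proof -
    have "cmod (of_real t * (x - z)) \<le> cmod (x - z)" using that by (simp add: norm_mult mult_left_le_one_le)
    then show ?thesis using x by (simp add: \<gamma>_def dist_norm norm_minus_commute)
  qed
  have dist: "5 * M * cmod (\<gamma> t - z) < 1" if "0 \<le> t" "t \<le> 1" for t
  proof -
    have "5 * M * cmod (\<gamma> t - z) < 5 * M * r"
      using \<gamma>[OF that] M by (intro mult_strict_left_mono) (auto simp: dist_norm norm_minus_commute)
    also have "\<dots> \<le> 1" using M by (simp add: field_simps)
    finally show ?thesis .
  qed
  have cont: "continuous_on {0..1} (\<lambda>t. cmod (f (\<gamma> t)))"
  proof (intro continuous_intros continuous_on_compose2[OF holomorphic_on_imp_continuous_on[OF f], of _ \<gamma>])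
    show "continuous_on {0..1} \<gamma>" unfolding \<gamma>_def by (intro continuous_intros)
    show "\<gamma> ` {0..1} \<subseteq> ball z r" using \<gamma> by auto
  qed
  have seg: "closed_segment z (\<gamma> t) \<subseteq> \<gamma> ` {0..t}" if "0 \<le> t" for t
  proof
    fix y assume "y \<in> closed_segment z (\<gamma> t)"
    then obtain u where u: "0 \<le> u" "u \<le> 1" "y = (1 - u) *\<^sub>R z + u *\<^sub>R \<gamma> t" by (auto simp: in_segment)
    have "y = \<gamma> (u * t)" unfolding u(3) \<gamma>_def by (simp add: scaleR_conv_of_real algebra_simps)
    moreover have "u * t \<in> {0..t}" using u that by (simp add: mult_left_le_one_le)
    ultimately show "y \<in> \<gamma> ` {0..t}" by blast
  qed
  have df: "(f has_field_derivative deriv f y) (at y)" if "y \<in> ball z r" for y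
    using holomorphic_derivI[OF f open_ball that] .
  show "cmod (f x) \<le> 2" if fz: "cmod (f z) \<le> 1"
  proof (rule ccontr)
    assume "\<not> cmod (f x) \<le> 2"
    obtain t where t: "0 \<le> t" "t \<le> 1" "cmod (f (\<gamma> t)) = 2" "\<And>s. 0 \<le> s \<Longrightarrow> s \<le> t \<Longrightarrow> cmod (f (\<gamma> s)) \<le> 2"
    proof (rule first_exit[OF cont, of 2])
      show "cmod (f (\<gamma> 0)) < 2" using fz by (simp add: \<gamma>_def)
      show "2 \<le> cmod (f (\<gamma> 1))" using \<open>\<not> cmod (f x) \<le> 2\<close> by (simp add: \<gamma>_def)
    qed (auto intro: that)
    have "cmod (f (\<gamma> t) - f z) \<le> 5 * M * cmod (\<gamma> t - z)"
    proof (rule field_differentiable_bound[of "closed_segment z (\<gamma> t)" f "deriv f"])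
      fix y assume "y \<in> closed_segment z (\<gamma> t)"
      then obtain s where s: "0 \<le> s" "s \<le> t" "y = \<gamma> s" using seg[OF t(1)] by fastforce
      then have yb: "y \<in> ball z r" using \<gamma> t by auto
      show "(f has_field_derivative deriv f y) (at y within closed_segment z (\<gamma> t))"
        using df[OF yb] by (rule has_field_derivative_at_within)
      have "(cmod (f y))\<^sup>2 \<le> 2\<^sup>2" using t(4) s by (intro power_mono) auto
      then have "M * (1 + (cmod (f y))\<^sup>2) \<le> M * 5" using M by (intro mult_left_mono) auto
      then show "cmod (deriv f y) \<le> 5 * M" using bd[OF yb] by simp
    qed auto
    then have "cmod (f (\<gamma> t) - f z) < 1" using dist[OF t(1,2)] by linarith
    then show False using t(3) that norm_triangle_ineq2[of "f (\<gamma> t)" "f z"] by linarith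
  qed
  show "cmod (f x) \<ge> 1/2" if fz: "cmod (f z) \<ge> 1"
  proof (rule ccontr)
    assume "\<not> cmod (f x) \<ge> 1/2"
    have contm: "continuous_on {0..1} (\<lambda>t. - cmod (f (\<gamma> t)))" by (intro continuous_intros cont)
    obtain t where t: "0 \<le> t" "t \<le> 1" "cmod (f (\<gamma> t)) = 1/2" "\<And>s. 0 \<le> s \<Longrightarrow> s \<le> t \<Longrightarrow> cmod (f (\<gamma> s)) \<ge> 1/2"
    proof (rule first_exit[OF contm, of "-1/2"])
      show "- cmod (f (\<gamma> 0)) < -1/2" using fz by (simp add: \<gamma>_def)
      show "-1/2 \<le> - cmod (f (\<gamma> 1))" using \<open>\<not> cmod (f x) \<ge> 1/2\<close> by (simp add: \<gamma>_def)
    qed (auto simp: minus_equation_iff)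
    have "cmod (inverse (f (\<gamma> t)) - inverse (f z)) \<le> 5 * M * cmod (\<gamma> t - z)"
    proof (rule field_differentiable_bound[of "closed_segment z (\<gamma> t)" "\<lambda>x. inverse (f x)" "\<lambda>x. - deriv f x / (f x)\<^sup>2"])
      fix y assume "y \<in> closed_segment z (\<gamma> t)"
      then obtain s where s: "0 \<le> s" "s \<le> t" "y = \<gamma> s" using seg[OF t(1)] by fastforce
      then have yb: "y \<in> ball z r" using \<gamma> t by auto
      have fy: "cmod (f y) \<ge> 1/2" using t(4) s by auto
      then have "f y \<noteq> 0" by auto
      then show "((\<lambda>x. inverse (f x)) has_field_derivative - deriv f y / (f y)\<^sup>2) (at y within closed_segment z (\<gamma> t))"
        using has_field_derivative_at_within[OF DERIV_inverse'[OF df[OF yb] \<open>f y \<noteq> 0\<close>]]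
        by (simp add: power2_eq_square field_simps)
      have "(1/2)\<^sup>2 \<le> (cmod (f y))\<^sup>2" using fy by (intro power_mono) auto
      then have "1 + (cmod (f y))\<^sup>2 \<le> 5 * (cmod (f y))\<^sup>2" by (simp add: power2_eq_square)
      then have "M * (1 + (cmod (f y))\<^sup>2) \<le> M * (5 * (cmod (f y))\<^sup>2)" using M by (intro mult_left_mono) auto
      then have "cmod (deriv f y) \<le> M * (5 * (cmod (f y))\<^sup>2)" using bd[OF yb] by linarith
      then show "cmod (- deriv f y / (f y)\<^sup>2) \<le> 5 * M"
        using \<open>f y \<noteq> 0\<close> by (simp add: norm_divide norm_power divide_simps mult_ac)
    qed auto
    then have "cmod (inverse (f (\<gamma> t)) - inverse (f z)) < 1" using dist[OF t(1,2)] by linarith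
    moreover have "cmod (inverse (f (\<gamma> t))) = 2" unfolding norm_inverse t(3) by simp
    moreover have "cmod (inverse (f z)) \<le> 1" using that by (simp add: norm_inverse inverse_le_1_iff)
    ultimately show False using norm_triangle_ineq2[of "inverse (f (\<gamma> t))" "inverse (f z)"] by linarith
  qed
qed

text \<open>Infinitely many \<open>F n\<close> satisfy \<open>cmod (F n z) \<le> 1\<close> or
  infinitely many do not. On a small disc the former are bounded by 2 and the latter bounded below
  by \<open>1/2\<close>, so Montel's theorem applies to the functions or to their
  reciprocals.\<close>

lemma Marty_conv_on:
  assumes F: "\<And>n. F n holomorphic_on ball z r" and "r > 0" and M: "M > 0"
    and bd: "\<And>n x. x \<in> ball z r \<Longrightarrow> cmod (deriv (F n) x) \<le> M * (1 + (cmod (F n x))\<^sup>2)"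
  shows "\<exists>t \<delta>. strict_mono (t :: nat \<Rightarrow> nat) \<and> \<delta> > 0 \<and> conv_on (\<lambda>n. F (t n)) (ball z \<delta>)"
proof -
  define \<delta> where "\<delta> = min r (1 / (5 * M))"
  have \<delta>: "\<delta> > 0" "\<delta> \<le> 1 / (5 * M)" "ball z \<delta> \<subseteq> ball z r" using M \<open>r > 0\<close> by (auto simp: \<delta>_def)
  have F': "F n holomorphic_on ball z \<delta>" for n using F \<delta>(3) holomorphic_on_subset by blast
  note sb = spherical_deriv_bound_small[OF F' M \<delta>(2)]
  have "infinite {n. cmod (F n z) \<le> 1} \<or> infinite {n. \<not> cmod (F n z) \<le> 1}"
  proof -
    have "{n. cmod (F n z) \<le> 1} \<union> {n. \<not> cmod (F n z) \<le> 1} = UNIV" by auto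
    then show ?thesis by (metis finite_Un infinite_UNIV_nat)
  qed
  then show ?thesis
  proof
    assume "infinite {n. cmod (F n z) \<le> 1}"
    then obtain s :: "nat \<Rightarrow> nat" where s: "strict_mono s" "\<And>n. cmod (F (s n) z) \<le> 1"
      by (auto dest!: infinite_enumerate)
    have "\<exists>t g. strict_mono (t :: nat \<Rightarrow> nat) \<and> g holomorphic_on ball z \<delta> \<and> (\<forall>x\<in>ball z \<delta>. conv_at (\<lambda>n. F (s (t n))) g x)"
      by (rule Montel_conv_at[of _ "\<lambda>n. F (s n)" 2]) (use F' sb(1) bd \<delta>(3) s(2) in \<open>auto simp: subset_iff\<close>)
    then obtain t g where t: "strict_mono (t :: nat \<Rightarrow> nat)" "\<forall>x\<in>ball z \<delta>. conv_at (\<lambda>n. F (s (t n))) g x" by blast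
    have "strict_mono (\<lambda>n. s (t n))" using s(1) t(1) by (simp add: strict_mono_def)
    then show ?thesis using t \<delta>(1) unfolding conv_on_def by (intro exI[of _ "\<lambda>n. s (t n)"] exI[of _ \<delta>]) blast
  next
    assume "infinite {n. \<not> cmod (F n z) \<le> 1}"
    then obtain s :: "nat \<Rightarrow> nat" where s: "strict_mono s" "\<And>n. \<not> cmod (F (s n) z) \<le> 1"
      by (auto dest!: infinite_enumerate)
    have s': "cmod (F (s n) z) \<ge> 1" for n using s(2)[of n] by simp
    have "\<exists>t. strict_mono (t :: nat \<Rightarrow> nat) \<and> conv_on (\<lambda>n. F (s (t n))) (ball z \<delta>)"
      by (rule Montel_conv_on[of "\<lambda>n. F (s n)"]) (use F' sb(2) bd \<delta>(1,3) s' in \<open>auto simp: subset_iff\<close>)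
    then obtain t where t: "strict_mono (t :: nat \<Rightarrow> nat)" "conv_on (\<lambda>n. F (s (t n))) (ball z \<delta>)" by blast
    have "strict_mono (\<lambda>n. s (t n))" using s(1) t(1) by (simp add: strict_mono_def)
    then show ?thesis using t \<delta>(1) by (intro exI[of _ "\<lambda>n. s (t n)"] exI[of _ \<delta>]) blast
  qed
qed

section \<open>Polynomial boundedness on circles\<close>

text \<open>The zero sets are countable while the plane is not. The point found serves as the common
  centre of the good circles.\<close>

lemma entire_nonzero_common_point:
  assumes "finite S" "\<And>F. F \<in> S \<Longrightarrow> F holomorphic_on UNIV \<and> (\<exists>z. F z \<noteq> 0)"
  shows "\<exists>a::complex. \<forall>F\<in>S. F a \<noteq> 0"
proof -
  have "countable {z. F z = 0}" if F: "F \<in> S" for F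
  proof (cases "F constant_on UNIV")
    case True
    then have "{z. F z = 0} = {}" using assms(2)[OF F] unfolding constant_on_def by auto
    then show ?thesis by simp
  next
    case False
    then show ?thesis
      using holomorphic_countable_zeros[of F UNIV] assms(2)[OF F] connected_UNIV
      by simp
  qed
  then have "countable (\<Union>F\<in>S. {z. F z = 0})"
    using assms(1) by (intro countable_UN) (auto intro: countable_finite)
  moreover have "uncountable (UNIV :: complex set)" by (rule uncountable_UNIV_complex)
  ultimately show ?thesis by (metis (mono_tags, lifting) UNIV_eq_I UN_I mem_Collect_eq)
qed

text \<open>The limit is the order of \<open>F\<close> at \<open>z0\<close>: splitting off
  \<open>(z - z0) ^ n\<close> leaves a logarithmic derivative that is continuous there. Combinations
  of logarithmic derivatives therefore have at most simple poles.\<close>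

lemma entire_log_deriv_limit:
  assumes F: "F holomorphic_on UNIV" and nz: "F a \<noteq> 0"
  shows "\<exists>l. ((\<lambda>z. (z - z0) * (deriv F z / F z)) \<longlongrightarrow> l) (at z0)"
proof -
  obtain n g r where r: "r > 0" "g holomorphic_on ball z0 r"
    "\<And>w. w \<in> ball z0 r \<Longrightarrow> F w = (w - z0) ^ n * g w" "\<And>w. w \<in> ball z0 r \<Longrightarrow> g w \<noteq> (0::complex)"
  proof (cases "F z0 = 0")
    case True
    then have "\<not> F constant_on UNIV" using nz unfolding constant_on_def using True by (metis UNIV_I)
    then show ?thesis
      using holomorphic_factor_zero_nonconstant[OF F _ _ _ True] that by (metis UNIV_I connected_UNIV open_UNIV)
  next
    case False
    have "isCont F z0" using F by (auto simp: continuous_on_eq_continuous_at dest: holomorphic_on_imp_continuous_on)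
    then obtain e where "e > 0" "\<And>y. dist z0 y < e \<Longrightarrow> F y \<noteq> 0"
      using continuous_at_avoid[of z0 F 0] False by auto
    then show ?thesis
      by (intro that[of e F 0]) (use F in \<open>auto intro: holomorphic_on_subset\<close>)
  qed
  have dg: "(g has_field_derivative deriv g w) (at w)" if "w \<in> ball z0 r" for w
    using holomorphic_derivI[OF r(2) open_ball that] .
  have eq: "(w - z0) * (deriv F w / F w) = of_nat n + (w - z0) * (deriv g w / g w)"
    if w: "w \<in> ball z0 r" "w \<noteq> z0" for w
  proof -
    have "deriv F w = deriv (\<lambda>w. (w - z0) ^ n * g w) w"
      using r(3) eventually_nhds_in_open[of "ball z0 r" w] w(1)
      by (intro deriv_cong_ev) (auto elim!: eventually_mono)
    also have "\<dots> = of_nat n * (w - z0) ^ (n - 1) * g w + (w - z0) ^ n * deriv g w"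
      using dg[OF w(1)] by (intro DERIV_imp_deriv) (auto intro!: derivative_eq_intros)
    finally have dF: "deriv F w = of_nat n * (w - z0) ^ (n - 1) * g w + (w - z0) ^ n * deriv g w" .
    have "(w - z0) * deriv F w = of_nat n * ((w - z0) ^ n * g w) + (w - z0) * ((w - z0) ^ n * deriv g w)"
    proof (cases n)
      case (Suc m)
      have "u * (of_nat (Suc m) * u ^ m * v + u ^ Suc m * v') = of_nat (Suc m) * (u ^ Suc m * v) + u * (u ^ Suc m * v')"
        for u v v' :: complex by (simp add: distrib_left mult_ac)
      then show ?thesis unfolding dF Suc diff_Suc_1 .
    qed (simp add: dF)
    then have "(w - z0) * (deriv F w / F w)
        = (of_nat n * ((w - z0) ^ n * g w) + (w - z0) * ((w - z0) ^ n * deriv g w)) / ((w - z0) ^ n * g w)"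
      using r(3)[OF w(1)] by simp
    then show ?thesis using r(4)[OF w(1)] w(2) by (simp add: add_divide_distrib)
  qed
  have "isCont (\<lambda>w. of_nat n + (w - z0) * (deriv g w / g w)) z0"
  proof -
    have c: "z0 \<in> ball z0 r" using r(1) by simp
    have "isCont g z0"
      using r(2) c by (auto simp: continuous_on_eq_continuous_at dest: holomorphic_on_imp_continuous_on)
    moreover have "deriv g holomorphic_on ball z0 r" using r(2) by (intro holomorphic_deriv) auto
    then have "isCont (deriv g) z0"
      using c by (auto simp: continuous_on_eq_continuous_at dest: holomorphic_on_imp_continuous_on)
    ultimately show ?thesis using r(4)[OF c] by (intro continuous_intros)
  qed
  then have "((\<lambda>w. of_nat n + (w - z0) * (deriv g w / g w)) \<longlongrightarrow> of_nat n) (at z0)"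
    by (simp add: isCont_def)
  moreover have "\<forall>\<^sub>F w in at z0. of_nat n + (w - z0) * (deriv g w / g w) = (w - z0) * (deriv F w / F w)"
  proof -
    have "\<forall>\<^sub>F w in at z0. w \<in> ball z0 r - {z0}" using r(1) by (intro eventually_at_in_open) auto
    then show ?thesis by eventually_elim (use eq in auto)
  qed
  ultimately have "((\<lambda>w. (w - z0) * (deriv F w / F w)) \<longlongrightarrow> of_nat n) (at z0)"
    by (rule Lim_transform_eventually)
  then show ?thesis by blast
qed

text \<open>The equation says that \<open>f / g ^ n\<close> has derivative zero where
  \<open>g\<close> does not vanish; the identity theorem extends the resulting relation from a disc
  to the plane.\<close>

lemma proportional_power:
  assumes f: "f holomorphic_on UNIV" "\<exists>z. f z \<noteq> 0" and g: "g holomorphic_on UNIV" "\<exists>z. g z \<noteq> 0"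
    and W: "\<And>z. deriv f z * g z = of_nat n * (f z * deriv g z)"
  obtains C :: complex where "C \<noteq> 0" "\<And>z. f z = C * g z ^ n"
proof -
  obtain a where a: "f a \<noteq> 0" "g a \<noteq> 0"
    using entire_nonzero_common_point[of "{f, g}"] f g by auto
  have "isCont g a" using g(1) by (auto simp: continuous_on_eq_continuous_at dest: holomorphic_on_imp_continuous_on)
  then obtain e where e: "e > 0" "\<And>y. y \<in> ball a e \<Longrightarrow> g y \<noteq> 0"
    using continuous_at_avoid[of a g 0] a(2) by auto
  have df: "(f has_field_derivative deriv f z) (at z)" and dg: "(g has_field_derivative deriv g z) (at z)" for z
    using f(1) g(1) by (auto intro: holomorphic_derivI)
  have d0: "((\<lambda>z. f z / g z ^ n) has_field_derivative 0) (at z)" if z: "z \<in> ball a e" for z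
  proof -
    have gz: "g z \<noteq> 0" using e(2)[OF z] .
    have "((\<lambda>z. g z ^ n) has_field_derivative of_nat n * g z ^ (n - 1) * deriv g z) (at z)"
      using DERIV_power[OF dg[of z], of n] by (simp add: mult_ac)
    from DERIV_divide[OF df[of z] this] gz
    have "((\<lambda>z. f z / g z ^ n) has_field_derivative
        (deriv f z * g z ^ n - f z * (of_nat n * g z ^ (n - 1) * deriv g z)) / (g z ^ n * g z ^ n)) (at z)"
      by simp
    moreover have "deriv f z * g z ^ n - f z * (of_nat n * g z ^ (n - 1) * deriv g z) = 0"
    proof (cases n)
      case (Suc m)
      have "deriv f z * g z ^ n - f z * (of_nat n * g z ^ (n - 1) * deriv g z)
          = g z ^ m * (deriv f z * g z - of_nat n * (f z * deriv g z))"
        unfolding Suc by (simp add: algebra_simps)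
      then show ?thesis using W[of z] by simp
    qed (use W[of z] gz in simp)
    ultimately show ?thesis by simp
  qed
  obtain C where C: "\<And>z. z \<in> ball a e \<Longrightarrow> f z / g z ^ n = C"
  proof -
    have "\<exists>C. \<forall>z\<in>ball a e. f z / g z ^ n = C"
      by (rule has_field_derivative_zero_constant[OF convex_ball]) (rule has_field_derivative_at_within[OF d0])
    then show thesis using that by blast
  qed
  have "f z = C * g z ^ n" for z
  proof (rule analytic_continuation_open[of "ball a e" UNIV f "\<lambda>z. C * g z ^ n"])
    show "(\<lambda>z. C * g z ^ n) holomorphic_on UNIV" using g(1) by (intro holomorphic_intros)
    show "f z = C * g z ^ n" if "z \<in> ball a e" for z using C[OF that] e(2)[OF that] by (simp add: field_simps)
  qed (use e f in auto)
  moreover from this have "C \<noteq> 0" using f(2) by auto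
  ultimately show thesis using that by blast
qed

text \<open>Quotients have poles, so growth is controlled only on circles about \<open>a\<close>
  whose radii lie in \<open>G\<close>. In the application \<open>G\<close> consists of good radii,
  on which the denominators do not vanish.\<close>

definition poly_bounded :: "real set \<Rightarrow> complex \<Rightarrow> (complex \<Rightarrow> complex) \<Rightarrow> bool" where
  "poly_bounded G a f \<longleftrightarrow> (\<exists>C m R0. C \<ge> 0 \<and> R0 \<ge> 1 \<and>
     (\<forall>r z. r \<in> G \<longrightarrow> r \<ge> R0 \<longrightarrow> cmod (z - a) = r \<longrightarrow> cmod (f z) \<le> C * r ^ m))"

lemma poly_bounded_I:
  assumes "C \<ge> 0" "R0 \<ge> 1" "\<And>r z. r \<in> G \<Longrightarrow> r \<ge> R0 \<Longrightarrow> cmod (z - a) = r \<Longrightarrow> cmod (f z) \<le> C * r ^ m"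
  shows "poly_bounded G a f"
  using assms unfolding poly_bounded_def by blast

lemma poly_bounded_mono:
  assumes "poly_bounded G a f" "\<And>r z. r \<in> G \<Longrightarrow> r \<ge> R1 \<Longrightarrow> cmod (z - a) = r \<Longrightarrow> cmod (g z) \<le> cmod (f z)"
  shows "poly_bounded G a g"
proof -
  obtain C m R0 where C: "C \<ge> 0" "R0 \<ge> 1"
    "\<And>r z. r \<in> G \<Longrightarrow> r \<ge> R0 \<Longrightarrow> cmod (z - a) = r \<Longrightarrow> cmod (f z) \<le> C * r ^ m"
    using assms(1) unfolding poly_bounded_def by blast
  show ?thesis
  proof (rule poly_bounded_I[of C "max R0 R1" G a g m])
    fix r z assume "r \<in> G" "max R0 R1 \<le> r" "cmod (z - a) = r"
    then have "cmod (g z) \<le> cmod (f z)" "cmod (f z) \<le> C * r ^ m" using assms(2) C(3) by auto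
    then show "cmod (g z) \<le> C * r ^ m" by linarith
  qed (use C in auto)
qed

lemma poly_bounded_cong:
  assumes "poly_bounded G a f" "\<And>r z. r \<in> G \<Longrightarrow> r \<ge> R1 \<Longrightarrow> cmod (z - a) = r \<Longrightarrow> g z = f z"
  shows "poly_bounded G a g"
  by (rule poly_bounded_mono[OF assms(1), of R1]) (simp add: assms(2))

lemma poly_bounded_mult:
  assumes "poly_bounded G a f" "poly_bounded G a g" shows "poly_bounded G a (\<lambda>z. f z * g z)"
proof -
  obtain C m R0 where C: "C \<ge> 0" "R0 \<ge> 1"
    "\<And>r z. r \<in> G \<Longrightarrow> r \<ge> R0 \<Longrightarrow> cmod (z - a) = r \<Longrightarrow> cmod (f z) \<le> C * r ^ m"
    using assms(1) unfolding poly_bounded_def by blast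
  obtain D n S0 where D: "D \<ge> 0" "S0 \<ge> 1"
    "\<And>r z. r \<in> G \<Longrightarrow> r \<ge> S0 \<Longrightarrow> cmod (z - a) = r \<Longrightarrow> cmod (g z) \<le> D * r ^ n"
    using assms(2) unfolding poly_bounded_def by blast
  show ?thesis
  proof (rule poly_bounded_I[of "C * D" "max R0 S0" _ _ _ "m + n"])
    fix r z assume r: "r \<in> G" "max R0 S0 \<le> r" "cmod (z - a) = r"
    then have "cmod (f z) * cmod (g z) \<le> (C * r ^ m) * (D * r ^ n)"
      using C D by (intro mult_mono) auto
    then show "cmod (f z * g z) \<le> C * D * r ^ (m + n)" by (simp add: norm_mult power_add mult_ac)
  qed (use C D in auto)
qed

lemma poly_bounded_add:
  assumes "poly_bounded G a f" "poly_bounded G a g" shows "poly_bounded G a (\<lambda>z. f z + g z)"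
proof -
  obtain C m R0 where C: "C \<ge> 0" "R0 \<ge> 1"
    "\<And>r z. r \<in> G \<Longrightarrow> r \<ge> R0 \<Longrightarrow> cmod (z - a) = r \<Longrightarrow> cmod (f z) \<le> C * r ^ m"
    using assms(1) unfolding poly_bounded_def by blast
  obtain D n S0 where D: "D \<ge> 0" "S0 \<ge> 1"
    "\<And>r z. r \<in> G \<Longrightarrow> r \<ge> S0 \<Longrightarrow> cmod (z - a) = r \<Longrightarrow> cmod (g z) \<le> D * r ^ n"
    using assms(2) unfolding poly_bounded_def by blast
  show ?thesis
  proof (rule poly_bounded_I[of "C + D" "max R0 S0" _ _ _ "m + n"])
    fix r z assume r: "r \<in> G" "max R0 S0 \<le> r" "cmod (z - a) = r"
    then have r1: "r \<ge> 1" using C(2) by auto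
    have "cmod (f z) \<le> C * r ^ m" "cmod (g z) \<le> D * r ^ n" using C D r by auto
    moreover have "C * r ^ m \<le> C * r ^ (m + n)" "D * r ^ n \<le> D * r ^ (m + n)"
      using C D r1 by (auto intro!: mult_left_mono power_increasing)
    ultimately show "cmod (f z + g z) \<le> (C + D) * r ^ (m + n)"
      using norm_triangle_ineq[of "f z" "g z"] by (simp add: distrib_right)
  qed (use C D in auto)
qed

lemma poly_bounded_const: "poly_bounded G a (\<lambda>_. c)"
  by (rule poly_bounded_I[of "cmod c" 1 _ _ _ 0]) auto

lemma poly_bounded_diff: assumes "poly_bounded G a f" "poly_bounded G a g" shows "poly_bounded G a (\<lambda>z. f z - g z)"
  using poly_bounded_add[OF assms(1) poly_bounded_mult[OF poly_bounded_const[of G a "-1"] assms(2)]] by simp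

lemma poly_bounded_power: "poly_bounded G a f \<Longrightarrow> poly_bounded G a (\<lambda>z. f z ^ n)"
  by (induction n) (auto intro: poly_bounded_mult poly_bounded_const)

lemma poly_bounded_prod: "finite I \<Longrightarrow> (\<And>i. i \<in> I \<Longrightarrow> poly_bounded G a (f i)) \<Longrightarrow> poly_bounded G a (\<lambda>z. \<Prod>i\<in>I. f i z)"
  by (induction I rule: finite_induct) (auto intro: poly_bounded_mult poly_bounded_const)

lemma poly_bounded_ident: "poly_bounded G a (\<lambda>z. z)"
proof -
  have "poly_bounded G a (\<lambda>z. (z - a) + a)"
    by (intro poly_bounded_add poly_bounded_const) (rule poly_bounded_I[of 1 1 _ _ _ 1], auto)
  then show ?thesis by simp
qed

lemma poly_bounded_poly: "poly_bounded G a (poly P)"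
proof -
  have "poly_bounded G a (\<lambda>z. poly P z)"
    by (induction P) (auto intro!: poly_bounded_add poly_bounded_mult poly_bounded_const poly_bounded_ident)
  then show ?thesis by simp
qed

lemma poly_bounded_root: assumes "poly_bounded G a (\<lambda>z. f z ^ d)" "d > 0" shows "poly_bounded G a f"
proof -
  have "poly_bounded G a (\<lambda>z. of_real (1 + cmod (f z ^ d)))"
    unfolding of_real_add
    by (intro poly_bounded_add poly_bounded_const, rule poly_bounded_mono[OF assms(1), of 1]) (auto simp: norm_power)
  then show ?thesis
  proof (rule poly_bounded_mono)
    fix r :: real and z assume "1 \<le> r"
    have "cmod (f z) \<le> 1 + cmod (f z) ^ d"
    proof (cases "cmod (f z) \<le> 1")
      case True
      then show ?thesis by (smt (verit) norm_ge_zero zero_le_power)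
    next
      case False
      then have "cmod (f z) ^ 1 \<le> cmod (f z) ^ d" using assms(2) by (intro power_increasing) auto
      then show ?thesis by simp
    qed
    moreover have "cmod (of_real (1 + cmod (f z ^ d))) = 1 + cmod (f z) ^ d"
      unfolding norm_of_real by (simp add: norm_power)
    ultimately show "cmod (f z) \<le> cmod (of_real (1 + cmod (f z ^ d)) :: complex)" by simp
  qed
qed

lemma poly_lower_bound:
  fixes P :: "complex poly" assumes "P \<noteq> 0"
  obtains \<delta> R where "\<delta> > 0" "\<And>z. cmod z \<ge> R \<Longrightarrow> cmod (poly P z) \<ge> \<delta>"
proof (cases P)
  case (pCons c Q)
  show thesis
  proof (cases "Q = 0")
    case True
    then show thesis using that[of "cmod c" 0] pCons assms by auto
  next
    case False
    then show thesis using poly_infinity[OF False, of 1 c] pCons that[of 1] by auto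
  qed
qed

lemma poly_bounded_inverse_poly: assumes "P \<noteq> 0" shows "poly_bounded G a (\<lambda>z. 1 / poly P z)"
proof -
  obtain \<delta> R where d: "\<delta> > 0" "\<And>z. cmod z \<ge> R \<Longrightarrow> cmod (poly P z) \<ge> \<delta>"
    using poly_lower_bound[OF assms] by blast
  show ?thesis
  proof (rule poly_bounded_I[of "1 / \<delta>" "max 1 (R + cmod a)" _ _ _ 0])
    fix r z assume "max 1 (R + cmod a) \<le> r" "cmod (z - a) = r"
    then have "cmod z \<ge> R" using norm_triangle_ineq4[of z a] by linarith
    from d(2)[OF this] have "1 / cmod (poly P z) \<le> 1 / \<delta>"
      using d(1) by (intro divide_left_mono mult_pos_pos) auto
    then show "cmod (1 / poly P z) \<le> 1 / \<delta> * r ^ 0" by (simp add: norm_divide)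
  qed (use d in auto)
qed

lemma poly_nonzero_far:
  assumes "P \<noteq> (0 :: complex poly)"
  obtains R where "\<And>z. cmod (z - a) \<ge> R \<Longrightarrow> poly P z \<noteq> 0"
proof -
  obtain \<delta> R where d: "\<delta> > 0" "\<And>z. cmod z \<ge> R \<Longrightarrow> cmod (poly P z) \<ge> \<delta>"
    using poly_lower_bound[OF assms] by blast
  have "poly P z \<noteq> 0" if "cmod (z - a) \<ge> R + cmod a" for z
      proof -
    have "R \<le> cmod z" using that norm_triangle_sub[of "z - a" z] norm_triangle_ineq4[of z a] by linarith
    then show ?thesis using d(1) d(2)[of z] by (metis norm_zero not_less)
  qed
  then show thesis using that by blast
qed

text \<open>A radius of \<open>G\<close> in every interval from \<open>R\<close> to
  \<open>2 * R\<close> and the maximum principle carry the bound from the circles to all large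
  discs; Liouville's theorem for polynomial growth finishes.\<close>

lemma poly_bounded_imp_poly:
  assumes f: "f holomorphic_on UNIV" and "poly_bounded G a f" and G: "\<And>R. R \<ge> 1 \<Longrightarrow> \<exists>r\<in>G. R \<le> r \<and> r \<le> 2 * R"
  shows "\<exists>P. f = poly P"
proof -
  obtain C m R0 where C: "C \<ge> 0" "R0 \<ge> 1"
    "\<And>r z. r \<in> G \<Longrightarrow> r \<ge> R0 \<Longrightarrow> cmod (z - a) = r \<Longrightarrow> cmod (f z) \<le> C * r ^ m"
    using assms(2) unfolding poly_bounded_def by blast
  have bd: "cmod (f z) \<le> C * (2 * R) ^ m" if R: "R \<ge> R0" and z: "cmod (z - a) \<le> R" for R z
  proof -
    obtain r where r: "r \<in> G" "R \<le> r" "r \<le> 2 * R" using G[of R] R C(2) by auto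
    have "cmod (f z) \<le> C * r ^ m"
    proof (rule cball_max_modulus[OF f])
      show "cmod (f x) \<le> C * r ^ m" if "cmod (x - a) = r" for x
        using C(3)[OF r(1) _ that] r R by simp
    qed (use C r R z in auto)
    also have "\<dots> \<le> C * (2 * R) ^ m" using C r R by (intro mult_left_mono power_mono) auto
    finally show ?thesis .
  qed
  have "f z = (\<Sum>k\<le>m. (deriv ^^ k) f 0 / fact k * z ^ k)" for z
  proof (rule Liouville_polynomial[OF f])
    fix z assume z: "max R0 (cmod a) \<le> cmod z"
    have "cmod (z - a) \<le> 2 * cmod z" using norm_triangle_ineq4[of z a] z by simp
    then have "cmod (f z) \<le> C * (2 * (2 * cmod z)) ^ m" using z C(2) by (intro bd) auto
    also have "\<dots> = C * 4 ^ m * cmod z ^ m" by (simp add: power_mult_distrib)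
    finally show "cmod (f z) \<le> C * 4 ^ m * cmod z ^ m" .
  qed
  then have "f = poly (\<Sum>k\<le>m. monom ((deriv ^^ k) f 0 / fact k) k)"
    by (intro ext) (simp add: poly_sum poly_monom)
  then show ?thesis by blast
qed

section \<open>Numerators of derivatives of reciprocal powers\<close>

text \<open>With \<open>f = 1 / \<phi>\<close> one has \<open>(f ^ p)\<^bsup>(j)\<^esup> = recip_num \<phi> p j / \<phi> ^ (p + j)\<close>.\<close>

fun recip_num :: "(complex \<Rightarrow> complex) \<Rightarrow> nat \<Rightarrow> nat \<Rightarrow> complex \<Rightarrow> complex" where
  "recip_num f p 0 = (\<lambda>z. 1)"
| "recip_num f p (Suc j) = (\<lambda>z. deriv (recip_num f p j) z * f z - of_nat (p + j) * (recip_num f p j z * deriv f z))"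

lemma recip_num_holomorphic: "open S \<Longrightarrow> f holomorphic_on S \<Longrightarrow> recip_num f p j holomorphic_on S"
  by (induction j) (auto intro!: holomorphic_intros holomorphic_deriv)

lemma deriv_cong_open:
  assumes "open S" "z \<in> S" "\<And>x. x \<in> S \<Longrightarrow> f x = g x" shows "deriv f z = deriv g z"
  using eventually_nhds_in_open[OF assms(1,2)] by (intro deriv_cong_ev) (auto elim: eventually_mono simp: assms(3))

lemma deriv_poly [simp]: "deriv (poly P) z = poly (pderiv P) z" for z :: complex
  by (intro DERIV_imp_deriv poly_DERIV)

lemma recip_num_poly: "recip_num (poly P) p j = poly (recip_num_poly P p j)"
proof (induction j)
  case (Suc j)
  show ?case unfolding recip_num.simps recip_num_poly.simps Suc by (rule ext) simp
qed auto

lemma recip_num_exp_type: "exp_type a f \<Longrightarrow> exp_type a (recip_num f p j)"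
  by (induction j) (auto intro!: exp_type_diff exp_type_mult exp_type_const exp_type_deriv)

lemma deriv_affine:
  assumes "open S" "G holomorphic_on S" "b + \<rho> * \<zeta> \<in> S"
  shows "deriv (\<lambda>\<zeta>. c * G (b + \<rho> * \<zeta>)) \<zeta> = c * \<rho> * deriv G (b + \<rho> * \<zeta>)"
proof (rule DERIV_imp_deriv)
  have "(G has_field_derivative deriv G (b + \<rho> * \<zeta>)) (at (b + \<rho> * \<zeta>))"
    using holomorphic_derivI assms by blast
  moreover have "((\<lambda>\<zeta>. b + \<rho> * \<zeta>) has_field_derivative \<rho>) (at \<zeta>)" by (auto intro!: derivative_eq_intros)
  ultimately have "((\<lambda>\<zeta>. G (b + \<rho> * \<zeta>)) has_field_derivative deriv G (b + \<rho> * \<zeta>) * \<rho>) (at \<zeta>)"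
    by (rule DERIV_chain2)
  then show "((\<lambda>\<zeta>. c * G (b + \<rho> * \<zeta>)) has_field_derivative c * \<rho> * deriv G (b + \<rho> * \<zeta>)) (at \<zeta>)"
    by (auto intro!: derivative_eq_intros)
qed

text \<open>Every term of \<open>recip_num f p j\<close> has degree \<open>j\<close> in
  \<open>f\<close> and its derivatives and contains \<open>j\<close> differentiations in total,
  hence the factor \<open>(a * \<rho>) ^ j\<close>.\<close>

lemma recip_num_affine:
  assumes "open S" "f holomorphic_on S" "b + \<rho> * \<zeta> \<in> S"
  shows "recip_num (\<lambda>\<zeta>. a * f (b + \<rho> * \<zeta>)) p j \<zeta> = (a * \<rho>) ^ j * recip_num f p j (b + \<rho> * \<zeta>)"
  using assms(3)
proof (induction j arbitrary: \<zeta>)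
  case (Suc j)
  define T where "T = {\<zeta>. b + \<rho> * \<zeta> \<in> S}"
  have T: "open T" unfolding T_def using open_vimage[OF assms(1), of "\<lambda>\<zeta>. b + \<rho> * \<zeta>"]
    by (simp add: vimage_def continuous_intros)
  have "deriv (recip_num (\<lambda>\<zeta>. a * f (b + \<rho> * \<zeta>)) p j) \<zeta> = deriv (\<lambda>\<zeta>. (a * \<rho>) ^ j * recip_num f p j (b + \<rho> * \<zeta>)) \<zeta>"
    by (rule deriv_cong_open[OF T]) (use Suc in \<open>auto simp: T_def\<close>)
  also have "\<dots> = (a * \<rho>) ^ j * \<rho> * deriv (recip_num f p j) (b + \<rho> * \<zeta>)"
    using recip_num_holomorphic[OF assms(1,2)] Suc.prems by (intro deriv_affine[OF assms(1)])
  finally have 1: "deriv (recip_num (\<lambda>\<zeta>. a * f (b + \<rho> * \<zeta>)) p j) \<zeta> = (a * \<rho>) ^ j * \<rho> * deriv (recip_num f p j) (b + \<rho> * \<zeta>)" .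
  have 2: "deriv (\<lambda>\<zeta>. a * f (b + \<rho> * \<zeta>)) \<zeta> = a * \<rho> * deriv f (b + \<rho> * \<zeta>)"
    by (rule deriv_affine) (use assms Suc.prems in auto)
  show ?case using Suc.IH[OF Suc.prems] 1 2 by (simp add: algebra_simps)
qed simp

lemma higher_deriv_inverse_power:
  assumes "open S" "f holomorphic_on S" "\<And>x. x \<in> S \<Longrightarrow> f x \<noteq> 0" "z \<in> S"
  shows "(deriv ^^ j) (\<lambda>x. inverse (f x) ^ p) z = recip_num f p j z / f z ^ (p + j)"
  using assms(4)
proof (induction j arbitrary: z)
  case 0
  then show ?case by (simp add: power_inverse divide_inverse)
next
  case (Suc j)
  have df: "(f has_field_derivative deriv f z) (at z)"
    using holomorphic_derivI assms(1,2) Suc.prems by blast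
  have dN: "(recip_num f p j has_field_derivative deriv (recip_num f p j) z) (at z)"
    using holomorphic_derivI recip_num_holomorphic[OF assms(1,2)] assms(1) Suc.prems by blast
  have fz: "f z \<noteq> 0" using assms(3) Suc.prems by simp
  have "(deriv ^^ Suc j) (\<lambda>x. inverse (f x) ^ p) z = deriv (\<lambda>z. recip_num f p j z / f z ^ (p + j)) z"
    unfolding funpow.simps o_def
    by (rule deriv_cong_open[OF assms(1) Suc.prems]) (use Suc.IH in auto)
  also have "\<dots> = (deriv (recip_num f p j) z * f z ^ (p + j) - recip_num f p j z * (of_nat (p + j) * f z ^ (p + j - 1) * deriv f z))
      / (f z ^ (p + j) * f z ^ (p + j))"
  proof (rule DERIV_imp_deriv)
    have "((\<lambda>z. f z ^ (p + j)) has_field_derivative of_nat (p + j) * f z ^ (p + j - 1) * deriv f z) (at z)"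
      using DERIV_power[OF df, of "p + j"] by (simp add: mult_ac)
    from DERIV_divide[OF dN this] fz
    show "((\<lambda>z. recip_num f p j z / f z ^ (p + j)) has_field_derivative
      (deriv (recip_num f p j) z * f z ^ (p + j) - recip_num f p j z * (of_nat (p + j) * f z ^ (p + j - 1) * deriv f z))
      / (f z ^ (p + j) * f z ^ (p + j))) (at z)" by simp
  qed
  also have "\<dots> = recip_num f p (Suc j) z / f z ^ (p + Suc j)"
  proof (cases "p + j")
    case 0
    then show ?thesis using fz by simp
  next
    case (Suc m)
    \<comment> \<open>Cancelling \<open>v ^ m\<close> after the quotient rule leaves exactly the
      recursion of \<open>recip_num\<close>.\<close>
    have *: "(u * v ^ Suc m - n * (of_nat (Suc m) * v ^ m * d)) / (v ^ Suc m * v ^ Suc m)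
        = (u * v - of_nat (Suc m) * (n * d)) / v ^ Suc (Suc m)" if "v \<noteq> 0" for u v n d :: complex
    proof -
      have "(u * v ^ Suc m - n * (of_nat (Suc m) * v ^ m * d)) = v ^ m * (u * v - of_nat (Suc m) * (n * d))"
        by (simp add: algebra_simps)
      then show ?thesis using that by (simp add: mult_ac)
    qed
    have "p + Suc j = Suc (Suc m)" using Suc by simp
    then show ?thesis unfolding recip_num.simps Suc using *[OF fz] by simp
  qed
  finally show ?case .
qed

lemma holo_near_recip_num: "holo_near F z \<Longrightarrow> holo_near (\<lambda>n. recip_num (F n) p j) z"
  unfolding holo_near_def by (meson recip_num_holomorphic eventually_mono open_ball)

lemma conv_at_recip_num:
  assumes "open S" "\<And>z. z \<in> S \<Longrightarrow> conv_at F g z" "\<And>z. z \<in> S \<Longrightarrow> holo_near F z" "z \<in> S"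
  shows "conv_at (\<lambda>n. recip_num (F n) p j) (recip_num g p j) z"
  using assms(4)
proof (induction j arbitrary: z)
  case (Suc j)
  have "conv_at (\<lambda>n. deriv (recip_num (F n) p j)) (deriv (recip_num g p j)) z"
    using assms(1) Suc.IH holo_near_recip_num[OF assms(3)] Suc.prems by (rule conv_at_deriv)
  moreover have "conv_at (\<lambda>n. deriv (F n)) (deriv g) z"
    using assms(1-3) Suc.prems by (rule conv_at_deriv)
  ultimately show ?case
    unfolding recip_num.simps using assms(2)[OF Suc.prems] Suc.IH[OF Suc.prems]
    by (intro conv_at_diff conv_at_mult conv_at_const)
qed (simp add: conv_at_const)

text \<open>Hopf-type estimate: \<open>log \<bar>f\<bar>\<close> is a positive harmonic function on the largest disc about \<open>z0\<close> in
  \<open>\<bar>f\<bar> > 1\<close>; it vanishes at some boundary point, where its gradient is at most \<open>2 * M\<close>.\<close>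

lemma spherical_deriv_growth:
  assumes f: "f holomorphic_on UNIV" and M: "M > 0"
    and bd: "\<And>z. cmod (deriv f z) \<le> M * (1 + (cmod (f z))\<^sup>2)"
    and z1: "cmod (f z1) \<le> 1" and z0: "cmod (f z0) > 1"
  shows "ln (cmod (f z0)) \<le> 4 * M * cmod (z0 - z1)"
proof -
  define A where "A = {z. cmod (f z) \<le> 1}"
  have cf: "continuous_on UNIV f" using f by (rule holomorphic_on_imp_continuous_on)
  have A: "closed A" "A \<noteq> {}" using z1 cf
    by (auto simp: A_def intro!: closed_Collect_le continuous_intros)
  obtain \<zeta> where \<zeta>: "\<zeta> \<in> A" "\<And>x. x \<in> A \<Longrightarrow> dist z0 \<zeta> \<le> dist z0 x"
    using distance_attains_inf[OF A] by blast
  define r where "r = cmod (\<zeta> - z0)"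
  have r: "r > 0" using \<zeta>(1) z0 by (auto simp: r_def A_def)
  have big: "cmod (f x) > 1" if "x \<in> ball z0 r" for x
    using \<zeta>(2)[of x] that by (force simp: A_def r_def dist_norm norm_minus_commute)
  define \<gamma> where "\<gamma> = (\<lambda>s::real. \<zeta> + of_real s * (z0 - \<zeta>))"
  have \<gamma>b: "\<gamma> s \<in> ball z0 r" if "0 < s" "s \<le> 1" for s
  proof -
    have "z0 - \<gamma> s = of_real (1 - s) * (z0 - \<zeta>)" by (simp add: \<gamma>_def algebra_simps)
    then have "cmod (z0 - \<gamma> s) = \<bar>1 - s\<bar> * cmod (z0 - \<zeta>)" by (simp only: norm_mult norm_of_real)
    then have "cmod (z0 - \<gamma> s) = (1 - s) * r" using that by (simp add: r_def norm_minus_commute)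
    also have "\<dots> < r" using that r by (simp add: algebra_simps)
    finally show ?thesis by (simp add: dist_norm)
  qed
  have "\<exists>g. g holomorphic_on ball z0 r \<and> (\<forall>z\<in>ball z0 r. f z = exp (g z))"
  proof (rule contractible_imp_holomorphic_log[of f "ball z0 r"])
    show "f z \<noteq> 0" if "z \<in> ball z0 r" for z using big[OF that] by auto
  qed (use f in \<open>auto intro: holomorphic_on_subset convex_imp_contractible\<close>)
  then obtain g where g: "g holomorphic_on ball z0 r" "\<And>z. z \<in> ball z0 r \<Longrightarrow> f z = exp (g z)" by auto
  have Reg: "Re (g z) = ln (cmod (f z))" if "z \<in> ball z0 r" for z using g(2)[OF that] by simp
  have pos: "Re (g z) > 0" if "z \<in> ball z0 r" for z using ln_gt_zero[OF big[OF that]] Reg[OF that] by simp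
  define a where "a = ln (cmod (f z0))"
  \<comment> \<open>At most 1 because \<open>\<zeta>\<close> lies in \<open>A\<close>; at least 1
    because \<open>\<gamma>\<close> approaches \<open>\<zeta>\<close> from inside the disc, where
    the modulus exceeds 1.\<close>
  have fz: "cmod (f \<zeta>) = 1"
  proof -
    have \<gamma>0: "(\<gamma> \<longlongrightarrow> \<gamma> 0) (at_right 0)" unfolding \<gamma>_def by (intro tendsto_intros)
    have "isCont f (\<gamma> 0)" using cf by (auto simp: continuous_on_eq_continuous_at)
    from tendsto_norm[OF isCont_tendsto_compose[OF this \<gamma>0]] have "((\<lambda>s. cmod (f (\<gamma> s))) \<longlongrightarrow> cmod (f (\<gamma> 0))) (at_right 0)" .
    then have "((\<lambda>s. cmod (f (\<gamma> s))) \<longlongrightarrow> cmod (f \<zeta>)) (at_right 0)"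
      by (simp add: \<gamma>_def)
    then have "1 \<le> cmod (f \<zeta>)"
    proof (rule tendsto_lowerbound)
      show "\<forall>\<^sub>F s in at_right 0. 1 \<le> cmod (f (\<gamma> s))"
      proof (rule eventually_at_rightI[of 0 1])
        fix s :: real assume "s \<in> {0<..<1}"
        then show "1 \<le> cmod (f (\<gamma> s))" using big[OF \<gamma>b[of s]] by simp
      qed simp
    qed simp
    then show ?thesis using \<zeta>(1) by (auto simp: A_def)
  qed
  \<comment> \<open>Harnack's factor decays only linearly towards the boundary: at
    \<open>\<gamma> s\<close> it is \<open>1 - (1 - s) = s\<close>. With
    \<open>ln x \<le> x - 1\<close> and \<open>cmod (f \<zeta>) = 1\<close> it becomes a lower bound
    for the difference quotient at \<open>\<zeta>\<close>.\<close>
  have low: "a / 2 \<le> cmod ((f (\<gamma> s) - f \<zeta>) / of_real s)" if s: "0 < s" "s \<le> 1" for s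
  proof -
    have "Re (g (\<gamma> s)) \<ge> Re (g z0) * (1 - cmod (\<gamma> s - z0) / r) / 2"
      by (rule half_plane_Harnack[OF g(1) r pos \<gamma>b[OF s]])
    moreover have "cmod (\<gamma> s - z0) / r = 1 - s"
    proof -
      have "\<gamma> s - z0 = of_real (1 - s) * (\<zeta> - z0)" by (simp add: \<gamma>_def algebra_simps)
      then have "cmod (\<gamma> s - z0) = \<bar>1 - s\<bar> * cmod (\<zeta> - z0)" by (simp only: norm_mult norm_of_real)
      then have "cmod (\<gamma> s - z0) = (1 - s) * r" using s by (simp add: r_def)
      then show ?thesis using r by simp
    qed
    ultimately have 1: "a * s / 2 \<le> ln (cmod (f (\<gamma> s)))"
      using Reg[OF \<gamma>b[OF s]] Reg[of z0] r by (simp add: a_def)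
    have "ln (cmod (f (\<gamma> s))) \<le> cmod (f (\<gamma> s)) - 1" using big[OF \<gamma>b[OF s]] by (intro ln_le_minus_one) auto
    also have "\<dots> \<le> cmod (f (\<gamma> s) - f \<zeta>)" using norm_triangle_ineq2[of "f (\<gamma> s)" "f \<zeta>"] fz by simp
    finally have "a / 2 * s \<le> cmod (f (\<gamma> s) - f \<zeta>)" using 1 by simp
    then have "a / 2 \<le> cmod (f (\<gamma> s) - f \<zeta>) / s" using s by (simp only: pos_le_divide_eq)
    then show ?thesis using s by (simp add: norm_divide)
  qed
  have "((\<lambda>s. (f (\<gamma> s) - f \<zeta>) / of_real s) \<longlongrightarrow> deriv f \<zeta> * (z0 - \<zeta>)) (at_right 0)"
  proof -
    have "((\<lambda>w. f (\<zeta> + w * (z0 - \<zeta>))) has_field_derivative deriv f \<zeta> * (z0 - \<zeta>)) (at 0)"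
    proof (rule DERIV_chain2[of f "deriv f \<zeta>"])
      show "(f has_field_derivative deriv f \<zeta>) (at (\<zeta> + 0 * (z0 - \<zeta>)))"
        using f by (auto intro: holomorphic_derivI)
      show "((\<lambda>w. \<zeta> + w * (z0 - \<zeta>)) has_field_derivative z0 - \<zeta>) (at 0)"
        by (auto intro!: derivative_eq_intros)
    qed
    then have "((\<lambda>w. (f (\<zeta> + w * (z0 - \<zeta>)) - f \<zeta>) / w) \<longlongrightarrow> deriv f \<zeta> * (z0 - \<zeta>)) (at 0)"
      by (simp add: DERIV_def)
    moreover have "filterlim (\<lambda>s::real. of_real s :: complex) (at 0) (at_right 0)"
      by (intro filterlim_atI tendsto_eq_intros)
        (auto intro!: tendsto_of_real eventually_at_rightI[of 0 1] simp: tendsto_ident_at)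
    ultimately show ?thesis unfolding \<gamma>_def by (rule filterlim_compose)
  qed
  then have "((\<lambda>s. cmod ((f (\<gamma> s) - f \<zeta>) / of_real s)) \<longlongrightarrow> cmod (deriv f \<zeta> * (z0 - \<zeta>))) (at_right 0)"
    by (rule tendsto_norm)
  then have "a / 2 \<le> cmod (deriv f \<zeta> * (z0 - \<zeta>))"
  proof (rule tendsto_lowerbound)
    show "\<forall>\<^sub>F s in at_right 0. a / 2 \<le> cmod ((f (\<gamma> s) - f \<zeta>) / of_real s)"
      by (rule eventually_at_rightI[of 0 1]) (use low in force)+
  qed simp
  \<comment> \<open>At \<open>\<zeta>\<close> the modulus is 1, so the spherical bound reads
    \<open>cmod (deriv f \<zeta>) \<le> 2 * M\<close>.\<close>
  also have "\<dots> \<le> (2 * M) * r"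
    unfolding norm_mult using bd[of \<zeta>] fz r M by (intro mult_mono) (auto simp: r_def norm_minus_commute)
  finally have "a \<le> 4 * M * r" by simp
  also have "r \<le> cmod (z0 - z1)"
    using \<zeta>(2)[of z1] z1 by (simp add: A_def r_def dist_norm norm_minus_commute)
  then have "4 * M * r \<le> 4 * M * cmod (z0 - z1)" using M by simp
  finally show ?thesis by (simp add: a_def)
qed

text \<open>If \<open>cmod f\<close> exceeds 1 everywhere, then \<open>1 / f\<close> is bounded and
  \<open>f\<close> is constant; otherwise the growth estimate applies with a point \<open>z1\<close>
  of modulus at most 1 as base.\<close>

lemma spherical_deriv_exp_type:
  assumes f: "f holomorphic_on UNIV" and M: "M > 0"
    and bd: "\<And>z. cmod (deriv f z) \<le> M * (1 + (cmod (f z))\<^sup>2)"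
  shows "exp_type 0 f"
proof (cases "\<exists>z1. cmod (f z1) \<le> 1")
  case True
  then obtain z1 where z1: "cmod (f z1) \<le> 1" by blast
  define A where "A = 4 * M * (1 + cmod z1)"
  have "cmod (f z) \<le> exp (A * (1 + cmod (z - 0)))" for z
  proof (cases "cmod (f z) > 1")
    case True
    have "ln (cmod (f z)) \<le> 4 * M * cmod (z - z1)"
      by (rule spherical_deriv_growth[OF f M bd z1 True])
    also have "\<dots> \<le> 4 * M * ((1 + cmod z1) * (1 + cmod z))"
    proof (intro mult_left_mono)
      show "cmod (z - z1) \<le> (1 + cmod z1) * (1 + cmod z)"
      proof -
        have "(1 + cmod z1) * (1 + cmod z) = 1 + cmod z1 + cmod z + cmod z1 * cmod z" by (simp add: algebra_simps)
        moreover have "0 \<le> cmod z1 * cmod z" by simp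
        ultimately show ?thesis using norm_triangle_ineq4[of z z1] by linarith
      qed
    qed (use M in auto)
    finally have "ln (cmod (f z)) \<le> A * (1 + cmod z)" by (simp add: A_def mult.assoc)
    then have "exp (ln (cmod (f z))) \<le> exp (A * (1 + cmod z))" by simp
    moreover have "cmod (f z) > 0" using True by linarith
    ultimately show ?thesis by (simp only: exp_ln diff_zero)
  next
    case False
    have "0 \<le> A * (1 + cmod z)" using M by (simp add: A_def)
    then show ?thesis using False by (smt (verit) one_le_exp_iff diff_zero)
  qed
  then show ?thesis unfolding exp_type_def using f M
    by (intro conjI exI[of _ A]) (auto simp: A_def)
next
  case False
  then have big: "cmod (f z) > 1" for z by (meson not_less)
  then have nz: "f z \<noteq> 0" for z by (metis norm_zero not_one_less_zero)
  have "(\<lambda>z. inverse (f z)) holomorphic_on UNIV" using f nz by (intro holomorphic_intros)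
  moreover have "bounded (range (\<lambda>z. inverse (f z)))"
    unfolding bounded_iff using big by (intro exI[of _ 1]) (auto simp: norm_inverse inverse_le_1_iff less_imp_le)
  ultimately have "(\<lambda>z. inverse (f z)) constant_on UNIV" by (rule Liouville_theorem)
  then obtain c where c: "\<And>z. inverse (f z) = c" by (auto simp: constant_on_def)
  then have "f = (\<lambda>_. inverse c)" by (metis inverse_inverse_eq ext)
  then show ?thesis using exp_type_const by metis
qed

section \<open>Excluding transcendental functions\<close>

locale diffpoly_exponents =
  fixes k :: nat and p q :: "nat \<Rightarrow> nat"
  assumes q_le_p: "\<And>i. i \<in> {1..k} \<Longrightarrow> q i \<le> p i"
    and q_sum_pos: "(\<Sum>i\<in>{1..k}. q i) > 0"
begin

definition dp_deg :: nat where "dp_deg = p 0 + (\<Sum>i\<in>{1..k}. p i)"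
definition dp_ord :: nat where "dp_ord = (\<Sum>i\<in>{1..k}. q i)"
definition dp_weight :: nat where "dp_weight = dp_deg + dp_ord"

text \<open>The numerator of \<open>Q[1 / \<phi>] = diffpoly_num \<phi> / \<phi> ^ dp_weight\<close>.\<close>

definition diffpoly_num :: "(complex \<Rightarrow> complex) \<Rightarrow> complex \<Rightarrow> complex" where
  "diffpoly_num f z = (\<Prod>i\<in>{1..k}. recip_num f (p i) (q i) z)"

lemma dp_ord_pos: "dp_ord > 0" using q_sum_pos by (simp add: dp_ord_def)

lemma dp_deg_pos: "dp_deg > 0"
proof -
  have "dp_ord \<le> (\<Sum>i\<in>{1..k}. p i)" unfolding dp_ord_def by (intro sum_mono q_le_p)
  then show ?thesis using dp_ord_pos by (simp add: dp_deg_def)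
qed

lemma diffpoly_num_holomorphic: "open S \<Longrightarrow> f holomorphic_on S \<Longrightarrow> diffpoly_num f holomorphic_on S"
  unfolding diffpoly_num_def by (intro holomorphic_on_prod recip_num_holomorphic)

text \<open>Put \<open>Q = Q[1 / \<phi>]\<close>. The function \<open>\<phi> ^ d * (Q' / (Q - c))\<close> has finitely many poles, vanishes at the zeros of
  \<open>\<phi>\<close> because these are multiple, and equals
  \<open>(1 / c) * \<phi> ^ d * Q * (Q' / (Q - c) - Q' / Q)\<close>, where \<open>\<phi> ^ d * Q\<close> is built from logarithmic
  derivatives. It is thus polynomially bounded on good circles, hence rational.\<close>

lemma transcendental_excluded:
  assumes \<phi>: "exp_type 0 \<phi>" and mult: "\<And>z. \<phi> z = 0 \<Longrightarrow> deriv \<phi> z = 0" and c: "c \<noteq> 0"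
    and few_solutions: "(\<forall>z. \<phi> z \<noteq> 0 \<longrightarrow> diffpoly_num \<phi> z = c * \<phi> z ^ dp_weight) \<or> finite {z. \<phi> z \<noteq> 0 \<and> diffpoly_num \<phi> z = c * \<phi> z ^ dp_weight}"
  shows "\<exists>P. \<phi> = poly P"
proof (cases "\<exists>z. \<phi> z \<noteq> 0")
  case False
  then have "\<phi> = poly 0" by auto
  then show ?thesis by blast
next
  case True
  define E where "E = (\<lambda>z. diffpoly_num \<phi> z - c * \<phi> z ^ dp_weight)"
  \<comment> \<open>All functions whose logarithmic derivatives will occur. \<open>S\<close>
    discards those that vanish identically, so that a common centre \<open>a\<close> and common good
    circles exist for the rest.\<close>
  define S0 where "S0 = {\<phi>, diffpoly_num \<phi>, E} \<union> (\<Union>i\<in>{1..k}. (\<lambda>j. recip_num \<phi> (p i) j) ` {..q i})"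
  define S where "S = {F \<in> S0. \<exists>z. F z \<noteq> 0}"
  have finS: "finite S" by (simp add: S_def S0_def)
  have eH: "exp_type 0 (diffpoly_num \<phi>)"
    unfolding diffpoly_num_def by (intro exp_type_prod recip_num_exp_type \<phi>) simp
  have eE: "exp_type 0 E" unfolding E_def by (intro exp_type_diff exp_type_mult exp_type_const exp_type_power \<phi> eH)
  have eS: "exp_type b F" if "F \<in> S" for F b
  proof -
    have "exp_type 0 F" using that \<phi> eH eE recip_num_exp_type[OF \<phi>] by (auto simp: S_def S0_def)
    then show ?thesis by (rule exp_type_center)
  qed
  have hS: "F holomorphic_on UNIV" if "F \<in> S" for F using eS[OF that] by (rule exp_type_holo)
  have h\<phi>: "\<phi> holomorphic_on UNIV" using \<phi> by (rule exp_type_holo)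
  have hH: "diffpoly_num \<phi> holomorphic_on UNIV" using eH by (rule exp_type_holo)
  have hE: "E holomorphic_on UNIV" using eE by (rule exp_type_holo)
  obtain a where a: "\<And>F. F \<in> S \<Longrightarrow> F a \<noteq> 0"
    using entire_nonzero_common_point[OF finS] hS by (auto simp: S_def)
  obtain C where C: "C \<ge> 0" "\<And>R. R \<ge> 1 \<Longrightarrow> \<exists>r. R \<le> r \<and> r \<le> 2 * R \<and>
      (\<forall>F\<in>S. \<forall>z. cmod (z - a) = r \<longrightarrow> F z \<noteq> 0 \<and> cmod (deriv F z) \<le> C * r * cmod (F z))"
    using good_circles[OF finS, of a] eS a by blast
  define G where "G = {r. \<forall>F\<in>S. \<forall>z. cmod (z - a) = r \<longrightarrow> F z \<noteq> 0 \<and> cmod (deriv F z) \<le> C * r * cmod (F z)}"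
  have G: "\<exists>r\<in>G. R \<le> r \<and> r \<le> 2 * R" if "R \<ge> 1" for R using C(2)[OF that] by (auto simp: G_def)
  have nz: "F z \<noteq> 0" if "F \<in> S" "r \<in> G" "cmod (z - a) = r" for F r z using that by (auto simp: G_def)
  have ld: "poly_bounded G a (\<lambda>z. deriv F z / F z)" if F: "F \<in> S" for F
  proof (rule poly_bounded_I[of C 1 _ _ _ 1])
    fix r z assume "r \<in> G" "1 \<le> r" "cmod (z - a) = r"
    then have "F z \<noteq> 0" "cmod (deriv F z) \<le> C * r * cmod (F z)" using F by (auto simp: G_def)
    then show "cmod (deriv F z / F z) \<le> C * r ^ 1" by (simp add: norm_divide divide_le_eq)
  qed (use C in auto)
  have \<phi>S: "\<phi> \<in> S" using True by (auto simp: S_def S0_def)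
  have poly_if: "\<exists>P. \<phi> = poly P" if "poly_bounded G a (\<lambda>z. \<phi> z ^ n)" "n > 0" for n
    using poly_bounded_imp_poly[OF h\<phi> poly_bounded_root[OF that] G] .
  \<comment> \<open>Dividing the recursion by \<open>\<phi> ^ Suc j\<close> expresses each quotient
    through the previous one and the logarithmic derivatives of
    \<open>recip_num \<phi> (p i) j\<close> and of \<open>\<phi>\<close>.\<close>
  have NNpb: "poly_bounded G a (\<lambda>z. recip_num \<phi> (p i) j z / \<phi> z ^ j)" if i: "i \<in> {1..k}" and j: "j \<le> q i" for i j
    using j
  proof (induction j)
    case (Suc j)
    let ?N = "recip_num \<phi> (p i) j"
    show ?case
    proof (cases "\<exists>z. ?N z \<noteq> 0")
      case True
      then have NS: "?N \<in> S" using i Suc.prems by (force simp: S_def S0_def)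
      have "poly_bounded G a (\<lambda>z. (deriv ?N z / ?N z) * (?N z / \<phi> z ^ j) - of_nat (p i + j) * ((deriv \<phi> z / \<phi> z) * (?N z / \<phi> z ^ j)))"
        using Suc by (intro poly_bounded_diff poly_bounded_mult poly_bounded_const ld NS \<phi>S) auto
      then show ?thesis
      proof (rule poly_bounded_cong)
        fix r z assume "r \<in> G" "cmod (z - a) = r"
        then have "?N z \<noteq> 0" "\<phi> z \<noteq> 0" using nz NS \<phi>S by auto
        then show "recip_num \<phi> (p i) (Suc j) z / \<phi> z ^ Suc j
          = (deriv ?N z / ?N z) * (?N z / \<phi> z ^ j) - of_nat (p i + j) * ((deriv \<phi> z / \<phi> z) * (?N z / \<phi> z ^ j))"
          by (simp add: diff_divide_distrib del: of_nat_add)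
      qed
    next
      case False
      then have "?N = (\<lambda>_. 0)" by auto
      then show ?thesis by (simp add: poly_bounded_const)
    qed
  qed (simp add: poly_bounded_const)
  show ?thesis
  proof (cases "\<exists>i\<in>{1..k}. \<forall>z. recip_num \<phi> (p i) (q i) z = 0")
    case True
    then obtain i where i: "i \<in> {1..k}" "\<forall>z. recip_num \<phi> (p i) (q i) z = 0" by blast
    \<comment> \<open>For the least vanishing index \<open>j = Suc j'\<close> the recursion makes
      \<open>recip_num \<phi> (p i) j'\<close> a non-zero multiple of
      \<open>\<phi> ^ (p i + j')\<close>; that is, the derivative of order \<open>j'\<close> of
      \<open>1 / \<phi> ^ p i\<close> is a non-zero constant. Comparison with \<open>NNpb\<close>
      bounds \<open>\<phi> ^ p i\<close>.\<close>
    define j where "j = (LEAST j. \<forall>z. recip_num \<phi> (p i) j z = 0)"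
    have j: "\<forall>z. recip_num \<phi> (p i) j z = 0" "j \<le> q i"
      unfolding j_def by (rule LeastI[of _ "q i"], rule i(2)) (rule Least_le, rule i(2))
    then obtain j' where j': "j = Suc j'" by (cases j) auto
    have "\<exists>z. recip_num \<phi> (p i) j' z \<noteq> 0"
      using not_less_Least[of j' "\<lambda>j. \<forall>z. recip_num \<phi> (p i) j z = 0"] j' by (auto simp: j_def)
    moreover have "deriv (recip_num \<phi> (p i) j') z * \<phi> z = of_nat (p i + j') * (recip_num \<phi> (p i) j' z * deriv \<phi> z)" for z
      using j(1) unfolding j' by simp
    ultimately obtain D where D: "D \<noteq> 0" "\<And>z. recip_num \<phi> (p i) j' z = D * \<phi> z ^ (p i + j')"
      using proportional_power[of "recip_num \<phi> (p i) j'" \<phi> "p i + j'"] \<open>\<exists>z. \<phi> z \<noteq> 0\<close> h\<phi> recip_num_holomorphic[OF open_UNIV h\<phi>]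
      by blast
    have "poly_bounded G a (\<lambda>z. 1 / D * (recip_num \<phi> (p i) j' z / \<phi> z ^ j'))"
      using j(2) j' by (intro poly_bounded_mult poly_bounded_const NNpb i) auto
    then have "poly_bounded G a (\<lambda>z. \<phi> z ^ p i)"
      by (rule poly_bounded_cong) (use D nz[OF \<phi>S] in \<open>simp add: power_add\<close>)
    moreover have "p i > 0" using q_le_p[OF i(1)] j(2) j' by simp
    ultimately show ?thesis by (rule poly_if)
  next
    case False
    have "\<exists>z. \<forall>F\<in>(\<lambda>i. recip_num \<phi> (p i) (q i)) ` {1..k}. F z \<noteq> 0"
      by (rule entire_nonzero_common_point) (use False recip_num_holomorphic[OF open_UNIV h\<phi>] in auto)
    then have "\<exists>z. diffpoly_num \<phi> z \<noteq> 0" by (auto simp: diffpoly_num_def)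
    then have HS: "diffpoly_num \<phi> \<in> S" by (auto simp: S_def S0_def)
    have HHpb: "poly_bounded G a (\<lambda>z. diffpoly_num \<phi> z / \<phi> z ^ dp_ord)"
    proof -
      have "poly_bounded G a (\<lambda>z. \<Prod>i\<in>{1..k}. recip_num \<phi> (p i) (q i) z / \<phi> z ^ q i)"
        by (intro poly_bounded_prod NNpb) auto
      then show ?thesis by (simp add: diffpoly_num_def dp_ord_def prod_dividef power_sum)
    qed
    \<comment> \<open>If \<open>Q\<close> is a non-zero constant \<open>D\<close>, then
      \<open>\<phi> ^ d = \<phi> ^ d * Q / D\<close> is bounded on good circles.\<close>
    have propo: "\<exists>P. \<phi> = poly P" if "D \<noteq> 0" "\<And>z. diffpoly_num \<phi> z = D * \<phi> z ^ dp_weight" for D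
    proof -
      have "poly_bounded G a (\<lambda>z. 1 / D * (diffpoly_num \<phi> z / \<phi> z ^ dp_ord))" by (intro poly_bounded_mult poly_bounded_const HHpb)
      then have "poly_bounded G a (\<lambda>z. \<phi> z ^ dp_deg)"
        by (rule poly_bounded_cong) (use that nz[OF \<phi>S] in \<open>simp add: dp_weight_def power_add\<close>)
      then show ?thesis using dp_deg_pos by (rule poly_if)
    qed
    show ?thesis
    proof (cases "\<forall>z. E z = 0")
      case True
      then show ?thesis using propo[OF c] by (simp add: E_def)
    next
      case False
      then have ES: "E \<in> S" by (auto simp: S_def S0_def)
      define Z where "Z = {z. \<phi> z \<noteq> 0 \<and> E z = 0}"
      have finZ: "finite Z"
        using few_solutions
      proof
        assume "\<forall>z. \<phi> z \<noteq> 0 \<longrightarrow> diffpoly_num \<phi> z = c * \<phi> z ^ dp_weight"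
        then have "E a = 0" using a[OF \<phi>S] by (simp add: E_def)
        then show ?thesis using a[OF ES] by simp
      qed (simp add: Z_def E_def)
      \<comment> \<open>Up to a power of \<open>\<phi>\<close>, \<open>J\<close> is the derivative
        of \<open>Q\<close>; if it vanishes identically, \<open>Q\<close> is constant.\<close>
      define J where "J = (\<lambda>z. deriv (diffpoly_num \<phi>) z * \<phi> z - of_nat dp_weight * (diffpoly_num \<phi> z * deriv \<phi> z))"
      have d\<phi>: "(\<phi> has_field_derivative deriv \<phi> z) (at z)" for z using h\<phi> by (auto intro: holomorphic_derivI)
      have dH: "(diffpoly_num \<phi> has_field_derivative deriv (diffpoly_num \<phi>) z) (at z)" for z using hH by (auto intro: holomorphic_derivI)
      have wpos: "dp_weight > 0" using dp_deg_pos by (simp add: dp_weight_def)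
      have JE: "J z = deriv E z * \<phi> z - of_nat dp_weight * (E z * deriv \<phi> z)" for z
      proof -
        have "((\<lambda>z. \<phi> z ^ dp_weight) has_field_derivative of_nat dp_weight * \<phi> z ^ (dp_weight - 1) * deriv \<phi> z) (at z)"
          using DERIV_power[OF d\<phi>[of z], of dp_weight] by (simp add: mult_ac)
        then have "(E has_field_derivative deriv (diffpoly_num \<phi>) z - c * (of_nat dp_weight * \<phi> z ^ (dp_weight - 1) * deriv \<phi> z)) (at z)"
          unfolding E_def by (intro DERIV_diff dH DERIV_cmult)
        then have dE: "deriv E z = deriv (diffpoly_num \<phi>) z - c * (of_nat dp_weight * \<phi> z ^ (dp_weight - 1) * deriv \<phi> z)"
          by (rule DERIV_imp_deriv)
        have "\<phi> z ^ dp_weight = \<phi> z ^ (dp_weight - 1) * \<phi> z" using wpos by (metis power_minus_mult)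
        then show ?thesis unfolding J_def dE by (simp add: E_def algebra_simps)
      qed
      show ?thesis
      proof (cases "\<forall>z. J z = 0")
        case True
        then have "deriv (diffpoly_num \<phi>) z * \<phi> z = of_nat dp_weight * (diffpoly_num \<phi> z * deriv \<phi> z)" for z by (simp add: J_def)
        then obtain D where "D \<noteq> 0" "\<And>z. diffpoly_num \<phi> z = D * \<phi> z ^ dp_weight"
          using proportional_power[OF hH \<open>\<exists>z. diffpoly_num \<phi> z \<noteq> 0\<close> h\<phi> \<open>\<exists>z. \<phi> z \<noteq> 0\<close>, of dp_weight] by blast
        then show ?thesis by (rule propo)
      next
        case False
        \<comment> \<open>\<open>X\<close> is \<open>(Q - c)' / (Q - c)\<close> and \<open>Y\<close>
          is \<open>Q' / Q\<close>, written with the entire functions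
          \<open>E = (Q - c) * \<phi> ^ w\<close> and
          \<open>diffpoly_num \<phi> = Q * \<phi> ^ w\<close>. The fact \<open>XY\<close> below is
          the identity \<open>(Q - c) * X = Q * Y\<close>.\<close>
        define X where "X = (\<lambda>z. deriv E z / E z - of_nat dp_weight * (deriv \<phi> z / \<phi> z))"
        define Y where "Y = (\<lambda>z. deriv (diffpoly_num \<phi>) z / diffpoly_num \<phi> z - of_nat dp_weight * (deriv \<phi> z / \<phi> z))"
        have Xpb: "poly_bounded G a X" and Ypb: "poly_bounded G a Y"
          unfolding X_def Y_def by (intro poly_bounded_diff poly_bounded_mult poly_bounded_const ld ES HS \<phi>S)+
        have XJ: "E z * \<phi> z * X z = J z" if "E z \<noteq> 0" "\<phi> z \<noteq> 0" for z
          using that unfolding X_def JE by (simp add: field_simps)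
        have YJ: "diffpoly_num \<phi> z * \<phi> z * Y z = J z" if "diffpoly_num \<phi> z \<noteq> 0" "\<phi> z \<noteq> 0" for z
          using that unfolding Y_def J_def by (simp add: field_simps)
        have XY: "E z * X z = diffpoly_num \<phi> z * Y z" if "r \<in> G" "cmod (z - a) = r" for r z
        proof -
          have n: "E z \<noteq> 0" "\<phi> z \<noteq> 0" "diffpoly_num \<phi> z \<noteq> 0" using nz ES \<phi>S HS that by auto
          have "\<phi> z * (E z * X z) = \<phi> z * (diffpoly_num \<phi> z * Y z)"
            using XJ[of z] YJ[of z] n by (simp add: mult_ac)
          then show ?thesis using n by simp
        qed
        \<comment> \<open>At the finitely many solutions outside the zeros of \<open>\<phi>\<close>
          the function \<open>X\<close> can have simple poles; \<open>B\<close> cancels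
          them.\<close>
        define B where "B = (\<Prod>b\<in>Z. [:-b, 1:])"
        have B: "poly B z = (\<Prod>b\<in>Z. z - b)" for z by (simp add: B_def poly_prod)
        have B0: "B \<noteq> 0" using finZ by (simp add: B_def)
        define W where "W = (\<lambda>z. poly B z * (\<phi> z ^ dp_deg * X z))"
        define A where "A = remove_sings W"
        have limX: "\<exists>l. ((\<lambda>z. (z - z0) * X z) \<longlongrightarrow> l) (at z0)" for z0
        proof -
          obtain l1 where l1: "((\<lambda>z. (z - z0) * (deriv E z / E z)) \<longlongrightarrow> l1) (at z0)"
            using entire_log_deriv_limit[OF hE a[OF ES]] by blast
          obtain l2 where l2: "((\<lambda>z. (z - z0) * (deriv \<phi> z / \<phi> z)) \<longlongrightarrow> l2) (at z0)"
            using entire_log_deriv_limit[OF h\<phi> a[OF \<phi>S]] by blast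
          have "((\<lambda>z. (z - z0) * (deriv E z / E z) - of_nat dp_weight * ((z - z0) * (deriv \<phi> z / \<phi> z))) \<longlongrightarrow> l1 - of_nat dp_weight * l2) (at z0)"
            by (intro tendsto_intros l1 l2)
          then show ?thesis unfolding X_def by (auto simp: algebra_simps)
        qed
        have cont\<phi>: "(\<phi> \<longlongrightarrow> \<phi> z0) (at z0)" for z0
          using DERIV_isCont[OF d\<phi>[of z0]] by (simp add: isCont_def)
        have contp: "(poly P \<longlongrightarrow> poly P z0) (at z0)" for P :: "complex poly" and z0
          using poly_isCont[of z0 P] by (simp add: isCont_def)
        \<comment> \<open>\<open>X\<close> has at most a simple pole at \<open>z0\<close>, and the
          factor \<open>\<phi> z / (z - z0)\<close> tends to 0 because the zero is multiple.\<close>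
        have lim0: "(W \<longlongrightarrow> 0) (at z0)" if z0: "\<phi> z0 = 0" for z0
        proof -
          obtain l where l: "((\<lambda>z. (z - z0) * X z) \<longlongrightarrow> l) (at z0)" using limX by blast
          have "((\<lambda>z. (\<phi> z - \<phi> z0) / (z - z0)) \<longlongrightarrow> 0) (at z0)"
            using d\<phi>[of z0] mult[OF z0] by (simp add: has_field_derivative_iff)
          then have "((\<lambda>z. \<phi> z / (z - z0)) \<longlongrightarrow> 0) (at z0)" using z0 by simp
          then have "((\<lambda>z. poly B z * (\<phi> z ^ (dp_deg - 1) * ((\<phi> z / (z - z0)) * ((z - z0) * X z)))) \<longlongrightarrow> poly B z0 * (\<phi> z0 ^ (dp_deg - 1) * (0 * l))) (at z0)"
            by (intro tendsto_mult tendsto_power cont\<phi> contp l)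
          moreover have "\<forall>\<^sub>F z in at z0. poly B z * (\<phi> z ^ (dp_deg - 1) * ((\<phi> z / (z - z0)) * ((z - z0) * X z))) = W z"
            using eventually_neq_at_within[of z0]
          proof eventually_elim
            case (elim z)
            have "\<phi> z ^ dp_deg = \<phi> z ^ (dp_deg - 1) * \<phi> z" using dp_deg_pos by (metis power_minus_mult)
            then show ?case using elim unfolding W_def by simp
          qed
          ultimately show ?thesis using tendsto_cong by fastforce
        qed
        have anaX: "X analytic_on {z0}" if "E z0 \<noteq> 0" "\<phi> z0 \<noteq> 0" for z0
        proof -
          have "E analytic_on UNIV" "\<phi> analytic_on UNIV" using hE h\<phi> by (simp_all add: analytic_on_open)
          then have e: "E analytic_on {z0}" "\<phi> analytic_on {z0}" by (auto intro: analytic_on_subset)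
          then have "deriv E analytic_on {z0}" "deriv \<phi> analytic_on {z0}" by (auto intro: analytic_deriv)
          then show ?thesis unfolding X_def
            by (intro analytic_on_diff analytic_on_mult analytic_on_divide analytic_on_const e) (use that in auto)
        qed
        have anaW: "W analytic_on {z0}" if "E z0 \<noteq> 0" "\<phi> z0 \<noteq> 0" for z0
        proof -
          have "\<phi> analytic_on {z0}" using h\<phi> by (simp add: analytic_on_open analytic_on_subset[of \<phi> UNIV])
          moreover have "poly B holomorphic_on UNIV"
            unfolding holomorphic_on_def field_differentiable_def
            using poly_DERIV has_field_derivative_at_within by blast
          then have "poly B analytic_on {z0}" by (simp add: analytic_on_open analytic_on_subset[of "poly B" UNIV])
          ultimately show ?thesis unfolding W_def by (intro analytic_intros anaX that)
        qed
        have iso: "isolated_singularity_at W z0" for z0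
        proof -
          have "\<forall>\<^sub>F z in at z0. E z \<noteq> 0" "\<forall>\<^sub>F z in at z0. \<phi> z \<noteq> 0"
            using non_zero_neighbour_alt[OF hE open_UNIV connected_UNIV UNIV_I UNIV_I a[OF ES], of z0]
              non_zero_neighbour_alt[OF h\<phi> open_UNIV connected_UNIV UNIV_I UNIV_I a[OF \<phi>S], of z0]
            by (auto elim: eventually_mono)
          then have "\<forall>\<^sub>F z in at z0. W analytic_on {z}" by eventually_elim (rule anaW)
          then show ?thesis
            unfolding isolated_singularity_at_altdef by simp
        qed
        have limW: "\<exists>l. (W \<longlongrightarrow> l) (at z0)" for z0
        proof (cases "\<phi> z0 = 0")
          case True
          then show ?thesis using lim0 by blast
        next
          case \<phi>0: False
          show ?thesis
          proof (cases "E z0 = 0")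
            case True
            then have zZ: "z0 \<in> Z" using \<phi>0 by (simp add: Z_def)
            obtain l where l: "((\<lambda>z. (z - z0) * X z) \<longlongrightarrow> l) (at z0)" using limX by blast
            define B1 where "B1 = (\<Prod>b\<in>Z - {z0}. [:-b, 1:])"
            have BB: "B = [:-z0, 1:] * B1" unfolding B_def B1_def by (rule prod.remove[OF finZ zZ])
            have "poly B z = (z - z0) * poly B1 z" for z unfolding BB by (simp add: algebra_simps)
            then have "W = (\<lambda>z. poly B1 z * (\<phi> z ^ dp_deg * ((z - z0) * X z)))"
              unfolding W_def by (intro ext) (simp only: mult_ac)
            moreover have "((\<lambda>z. poly B1 z * (\<phi> z ^ dp_deg * ((z - z0) * X z))) \<longlongrightarrow> poly B1 z0 * (\<phi> z0 ^ dp_deg * l)) (at z0)"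
              by (intro tendsto_mult tendsto_power cont\<phi> contp l)
            ultimately show ?thesis by auto
          next
            case False
            then show ?thesis using anaW[of z0] \<phi>0 by (meson analytic_at_imp_isCont isCont_def)
          qed
        qed
        have hA: "A holomorphic_on UNIV"
        proof -
          have "A analytic_on {z}" for z
            unfolding A_def using remove_sings_analytic_at[OF iso] limW by blast
          then have "A analytic_on UNIV" by (meson analytic_on_analytic_at)
          then show ?thesis by (rule analytic_imp_holomorphic)
        qed
        have AW: "A z = W z" if "r \<in> G" "cmod (z - a) = r" for r z
          unfolding A_def using anaW[of z] nz[OF ES that] nz[OF \<phi>S that] by simp
        \<comment> \<open>From \<open>(Q - c) * X = Q * Y\<close> one gets
          \<open>c * X = Q * (X - Y)\<close>; after multiplication by \<open>\<phi> ^ d\<close> the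
          right-hand side is bounded, because \<open>\<phi> ^ d * Q\<close> is.\<close>
        have Upb: "poly_bounded G a (\<lambda>z. \<phi> z ^ dp_deg * X z)"
        proof -
          have "poly_bounded G a (\<lambda>z. 1 / c * (diffpoly_num \<phi> z / \<phi> z ^ dp_ord * X z - diffpoly_num \<phi> z / \<phi> z ^ dp_ord * Y z))"
            by (intro poly_bounded_mult poly_bounded_diff poly_bounded_const HHpb Xpb Ypb)
          then show ?thesis
          proof (rule poly_bounded_cong)
            fix r z assume rz: "r \<in> G" "cmod (z - a) = r"
            have n: "\<phi> z \<noteq> 0" using nz \<phi>S rz by auto
            have "diffpoly_num \<phi> z * X z - diffpoly_num \<phi> z * Y z = c * \<phi> z ^ dp_weight * X z"
              unfolding XY[OF rz, symmetric] by (simp add: E_def algebra_simps)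
            then have "diffpoly_num \<phi> z / \<phi> z ^ dp_ord * X z - diffpoly_num \<phi> z / \<phi> z ^ dp_ord * Y z = c * (\<phi> z ^ dp_deg * X z)"
              using n by (simp add: dp_weight_def power_add diff_divide_distrib [symmetric] divide_simps mult_ac)
            then show "\<phi> z ^ dp_deg * X z = 1 / c * (diffpoly_num \<phi> z / \<phi> z ^ dp_ord * X z - diffpoly_num \<phi> z / \<phi> z ^ dp_ord * Y z)"
              using c by simp
          qed
        qed
        have "poly_bounded G a W" unfolding W_def by (intro poly_bounded_mult poly_bounded_poly Upb)
        then have "poly_bounded G a A" by (rule poly_bounded_cong) (rule AW)
        then obtain PA where PA: "A = poly PA" using poly_bounded_imp_poly[OF hA _ G] by blast
        \<comment> \<open>Otherwise \<open>X\<close>, and with it \<open>J\<close>, vanishes on all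
          large good circles, and the maximum principle spreads this to the plane.\<close>
        have PA0: "PA \<noteq> 0"
        proof
          assume 0: "PA = 0"
          obtain RB where RB: "\<And>z. cmod (z - a) \<ge> RB \<Longrightarrow> poly B z \<noteq> 0" using poly_nonzero_far[OF B0] by blast
          have Jc: "J z = 0" if "r \<in> G" "cmod (z - a) = r" "r \<ge> RB" for r z
          proof -
            have n: "E z \<noteq> 0" "\<phi> z \<noteq> 0" "poly B z \<noteq> 0" using nz ES \<phi>S that RB by auto
            have "W z = 0" using AW[OF that(1,2)] PA 0 by simp
            then have "X z = 0" using n by (simp add: W_def)
            then show ?thesis using XJ[of z] n by simp
          qed
          have hJ: "J holomorphic_on UNIV"
            unfolding J_def using hH h\<phi> by (intro holomorphic_intros holomorphic_deriv) auto
          have "J z = 0" for z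
          proof -
            have "1 \<le> max (max 1 RB) (cmod (z - a))" by simp
            from G[OF this] obtain r where r: "r \<in> G" "max (max 1 RB) (cmod (z - a)) \<le> r" by blast
            have "cmod (J z) \<le> 0"
              by (rule cball_max_modulus[OF hJ, of a r]) (use Jc r in auto)
            then show ?thesis by simp
          qed
          then show False using \<open>\<not> (\<forall>z. J z = 0)\<close> by blast
        qed
        \<comment> \<open>All zeros of \<open>\<phi>\<close> are thus roots of the polynomial
          \<open>PA\<close>, so they lie in a disc and can be split off by a polynomial
          \<open>P0\<close>.\<close>
        have Azero: "poly PA z = 0" if "\<phi> z = 0" for z
        proof -
          have "A z = 0" unfolding A_def using lim0[OF that] by (rule remove_sings_eqI)
          then show ?thesis by (simp add: PA)
        qed
        obtain RA where RA: "\<And>z. cmod (z - a) \<ge> RA \<Longrightarrow> poly PA z \<noteq> 0" using poly_nonzero_far[OF PA0] by blast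
        define R where "R = max 1 RA"
        have R: "R > 0" "R \<ge> RA" by (auto simp: R_def)
        obtain xs \<phi>0 where xs: "\<phi>0 holomorphic_on UNIV" "\<And>z. \<phi> z = (\<Prod>x\<leftarrow>xs. z - x) * \<phi>0 z"
          "\<And>z. cmod (z - a) \<le> 4 * R \<Longrightarrow> \<phi>0 z \<noteq> 0"
          using holomorphic_factor_roots[OF h\<phi> a[OF \<phi>S] R(1)] by metis
        define P0 where "P0 = (\<Prod>x\<leftarrow>xs. [:-x, 1:])"
        have P0: "poly P0 z = (\<Prod>x\<leftarrow>xs. z - x)" for z unfolding P0_def by (induction xs) (auto simp: algebra_simps)
        have \<phi>P: "\<phi> z = poly P0 z * \<phi>0 z" for z using xs(2) P0 by simp
        have nz0: "\<phi>0 z \<noteq> 0" for z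
        proof (cases "cmod (z - a) \<le> 4 * R")
          case False
          then have "poly PA z \<noteq> 0" using RA R by auto
          then show ?thesis using Azero[of z] \<phi>P[of z] by auto
        qed (rule xs(3))
        \<comment> \<open>Now that \<open>A = B * \<phi> ^ d * X\<close> is a polynomial,
          \<open>Q - c = B * (\<phi> ^ d * Q * Y) / A\<close> bounds \<open>Q\<close> itself on the
          good circles.\<close>
        have Qpb: "poly_bounded G a (\<lambda>z. diffpoly_num \<phi> z / \<phi> z ^ dp_weight)"
        proof -
          have "poly_bounded G a (\<lambda>z. poly B z * (diffpoly_num \<phi> z / \<phi> z ^ dp_ord * Y z) * (1 / poly PA z) + c)"
            by (intro poly_bounded_add poly_bounded_mult poly_bounded_poly HHpb Ypb poly_bounded_inverse_poly PA0 poly_bounded_const)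
          then show ?thesis
          proof (rule poly_bounded_cong[where ?R1.0 = R])
            fix r z assume rz: "r \<in> G" "R \<le> r" "cmod (z - a) = r"
            have n: "\<phi> z \<noteq> 0" "poly PA z \<noteq> 0" using nz \<phi>S rz RA R by auto
            have "poly B z * (diffpoly_num \<phi> z / \<phi> z ^ dp_ord * Y z) = poly B z * (E z * X z / \<phi> z ^ dp_ord)"
              using XY[OF rz(1,3)] by simp
            also have "\<dots> = poly B z * (\<phi> z ^ dp_deg * X z) * (E z / \<phi> z ^ dp_weight)"
              using n by (simp add: dp_weight_def power_add)
            also have "poly B z * (\<phi> z ^ dp_deg * X z) = poly PA z"
              using AW[OF rz(1,3)] PA by (simp add: W_def)
            finally show "diffpoly_num \<phi> z / \<phi> z ^ dp_weight = poly B z * (diffpoly_num \<phi> z / \<phi> z ^ dp_ord * Y z) * (1 / poly PA z) + c"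
              using n by (simp add: E_def diff_divide_distrib)
          qed
        qed
        \<comment> \<open>\<open>T\<close> is the entire extension of \<open>P0 ^ w * Q\<close>,
          hence a polynomial. Dividing \<open>\<phi> ^ d * Q * P0 ^ q'\<close> by it then recovers
          \<open>\<phi>0 ^ d\<close>.\<close>
        define T where "T = (\<lambda>z. diffpoly_num \<phi> z / \<phi>0 z ^ dp_weight)"
        have hT: "T holomorphic_on UNIV" unfolding T_def using hH xs(1) nz0 by (intro holomorphic_intros) auto
        have "poly_bounded G a (\<lambda>z. poly P0 z ^ dp_weight * (diffpoly_num \<phi> z / \<phi> z ^ dp_weight))" by (intro poly_bounded_mult poly_bounded_power poly_bounded_poly Qpb)
        then have "poly_bounded G a T"
          by (rule poly_bounded_cong) (use nz[OF \<phi>S] in \<open>auto simp: T_def \<phi>P power_mult_distrib\<close>)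
        then obtain PT where PT: "T = poly PT" using poly_bounded_imp_poly[OF hT _ G] by blast
        have PT0: "PT \<noteq> 0"
          using \<open>\<exists>z. diffpoly_num \<phi> z \<noteq> 0\<close> PT nz0 by (auto simp: T_def fun_eq_iff)
        obtain RT where RT: "\<And>z. cmod (z - a) \<ge> RT \<Longrightarrow> poly PT z \<noteq> 0" using poly_nonzero_far[OF PT0] by blast
        have "poly_bounded G a (\<lambda>z. diffpoly_num \<phi> z / \<phi> z ^ dp_ord * poly P0 z ^ dp_ord * (1 / poly PT z))"
          by (intro poly_bounded_mult HHpb poly_bounded_power poly_bounded_poly poly_bounded_inverse_poly PT0)
        then have "poly_bounded G a (\<lambda>z. \<phi>0 z ^ dp_deg)"
        proof (rule poly_bounded_cong[where ?R1.0 = RT])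
          fix r z assume rz: "r \<in> G" "RT \<le> r" "cmod (z - a) = r"
          have n: "poly P0 z \<noteq> 0" "poly PT z \<noteq> 0" using nz[OF \<phi>S rz(1,3)] RT rz by (auto simp: \<phi>P)
          have "diffpoly_num \<phi> z = poly PT z * \<phi>0 z ^ dp_weight"
            using fun_cong[OF PT, of z] nz0[of z] by (simp add: T_def field_simps)
          then have "diffpoly_num \<phi> z / \<phi> z ^ dp_ord * poly P0 z ^ dp_ord = poly PT z * \<phi>0 z ^ dp_deg"
            using n nz0[of z] by (simp add: dp_weight_def power_add \<phi>P power_mult_distrib)
          then show "\<phi>0 z ^ dp_deg = diffpoly_num \<phi> z / \<phi> z ^ dp_ord * poly P0 z ^ dp_ord * (1 / poly PT z)"
            using n by simp
        qed
        then have "poly_bounded G a \<phi>0" using dp_deg_pos by (rule poly_bounded_root)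
        then obtain P1 where "\<phi>0 = poly P1" using poly_bounded_imp_poly[OF xs(1) _ G] by blast
        then have "\<phi> = poly (P0 * P1)" using \<phi>P by auto
        then show ?thesis by blast
      qed
    qed
  qed
qed

end

section \<open>The rescaling lemma of Zalcman and Pang\<close>

lemma strict_mono_choice:
  assumes "\<And>k. \<forall>\<^sub>F n in sequentially. P k n"
  obtains s :: "nat \<Rightarrow> nat" where "strict_mono s" "\<And>k. P k (s k)"
proof -
  obtain N where N: "\<And>k n. n \<ge> N k \<Longrightarrow> P k n" using assms unfolding eventually_sequentially by metis
  define s where "s = rec_nat (N 0) (\<lambda>k m. max (Suc m) (N (Suc k)))"
  have "s k \<ge> N k" for k by (cases k) (auto simp: s_def)
  moreover have "strict_mono s" unfolding strict_mono_Suc_iff by (auto simp: s_def less_max_iff_disj)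
  ultimately show thesis using that N by blast
qed

lemma Marty_conv_on_eventually:
  assumes ev: "\<forall>\<^sub>F n in sequentially. F n holomorphic_on ball z r \<and>
      (\<forall>x\<in>ball z r. cmod (deriv (F n) x) \<le> M * (1 + (cmod (F n x))\<^sup>2))"
    and "r > 0" "M > 0"
  shows "\<exists>t \<delta>. strict_mono (t :: nat \<Rightarrow> nat) \<and> \<delta> > 0 \<and> conv_on (\<lambda>n. F (t n)) (ball z \<delta>)"
proof -
  obtain N where N: "\<And>n. n \<ge> N \<Longrightarrow> F n holomorphic_on ball z r"
    "\<And>n x. n \<ge> N \<Longrightarrow> x \<in> ball z r \<Longrightarrow> cmod (deriv (F n) x) \<le> M * (1 + (cmod (F n x))\<^sup>2)"
    using ev unfolding eventually_sequentially by blast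
  have "\<exists>t \<delta>. strict_mono (t :: nat \<Rightarrow> nat) \<and> \<delta> > 0 \<and> conv_on (\<lambda>n. F (N + t n)) (ball z \<delta>)"
    by (rule Marty_conv_on[of "\<lambda>n. F (N + n)" z r M]) (use N assms in auto)
  then obtain t \<delta> where "strict_mono (t :: nat \<Rightarrow> nat)" "\<delta> > 0" "conv_on (\<lambda>n. F (N + t n)) (ball z \<delta>)" by blast
  then show ?thesis by (intro exI[of _ "\<lambda>n. N + t n"] exI[of _ \<delta>]) (auto simp: strict_mono_def)
qed

lemma scaled_in_open:
  fixes y :: "nat \<Rightarrow> complex" and \<rho> :: "nat \<Rightarrow> real"
  assumes "open S" "y \<longlonglongrightarrow> yl" "yl \<in> S" "\<rho> \<longlonglongrightarrow> 0"
  shows "\<forall>\<^sub>F n in sequentially. \<forall>\<zeta>\<in>ball \<zeta>0 1. y n + of_real (\<rho> n) * \<zeta> \<in> S"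
proof -
  obtain e where e: "e > 0" "ball yl e \<subseteq> S" using assms(1,3) open_contains_ball by blast
  have "\<forall>\<^sub>F n in sequentially. dist (y n) yl < e / 2" using tendstoD[OF assms(2), of "e / 2"] e(1) by simp
  moreover have "(\<lambda>n. \<bar>\<rho> n\<bar> * (cmod \<zeta>0 + 1)) \<longlonglongrightarrow> 0"
    using assms(4) by (intro tendsto_mult_left_zero tendsto_rabs_zero)
  then have "\<forall>\<^sub>F n in sequentially. \<bar>\<rho> n\<bar> * (cmod \<zeta>0 + 1) < e / 2" using e(1) by (intro order_tendstoD(2)) auto
  ultimately show ?thesis
  proof eventually_elim
    case (elim n)
    show ?case
    proof
      fix \<zeta> assume "\<zeta> \<in> ball \<zeta>0 1"
      then have "cmod \<zeta> \<le> cmod \<zeta>0 + 1" using norm_triangle_sub[of \<zeta> \<zeta>0] by (simp add: dist_norm norm_minus_commute)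
      then have "\<bar>\<rho> n\<bar> * cmod \<zeta> \<le> \<bar>\<rho> n\<bar> * (cmod \<zeta>0 + 1)" by (rule mult_left_mono) simp
      then have "cmod (of_real (\<rho> n) * \<zeta>) < e / 2" using elim by (simp add: norm_mult)
      then have "cmod ((y n - yl) + of_real (\<rho> n) * \<zeta>) < e"
        using elim norm_triangle_ineq[of "y n - yl" "of_real (\<rho> n) * \<zeta>"] by (simp add: dist_norm)
      then show "y n + of_real (\<rho> n) * \<zeta> \<in> S"
        using e(2) by (auto simp: subset_iff dist_norm norm_minus_commute algebra_simps)
    qed
  qed
qed

lemma holomorphic_affine:
  assumes "f holomorphic_on S" "\<And>\<zeta>. \<zeta> \<in> T \<Longrightarrow> b + \<rho> * \<zeta> \<in> S"
  shows "(\<lambda>\<zeta>. a * f (b + \<rho> * \<zeta>)) holomorphic_on T"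
proof -
  have "(f \<circ> (\<lambda>\<zeta>. b + \<rho> * \<zeta>)) holomorphic_on T"
    by (rule holomorphic_on_compose_gen[OF _ assms(1)]) (use assms(2) in \<open>auto intro!: holomorphic_intros\<close>)
  then show ?thesis by (intro holomorphic_intros) (simp add: o_def)
qed

lemma holo_near_scaled:
  assumes "open S" "\<And>n. F n holomorphic_on S" "y \<longlonglongrightarrow> yl" "yl \<in> S" "\<rho> \<longlonglongrightarrow> 0"
  shows "holo_near (\<lambda>n \<zeta>. a n * F n (y n + of_real (\<rho> n) * \<zeta>)) \<zeta>0"
proof -
  have "\<forall>\<^sub>F n in sequentially. (\<lambda>\<zeta>. a n * F n (y n + of_real (\<rho> n) * \<zeta>)) holomorphic_on ball \<zeta>0 1"
    using scaled_in_open[OF assms(1,3,4,5), of \<zeta>0]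
    by eventually_elim (rule holomorphic_affine[OF assms(2)], blast)
  then show ?thesis unfolding holo_near_def by (intro exI[of _ 1]) auto
qed

text \<open>Zooming in at \<open>yl\<close> freezes the sequence to the constant
  \<open>g yl\<close>. Applied to the right-hand side of the equation, this explains why the limit
  problem has a constant one.\<close>

lemma conv_at_scaled:
  assumes "conv_at h g yl" "y \<longlonglongrightarrow> yl" "\<rho> \<longlonglongrightarrow> 0"
  shows "conv_at (\<lambda>n \<zeta>. h n (y n + of_real (\<rho> n) * \<zeta>)) (\<lambda>_. g yl) \<zeta>0"
proof -
  have fst: "filterlim fst sequentially (sequentially \<times>\<^sub>F nhds \<zeta>0)" by (rule filterlim_fst)
  have snd: "filterlim snd (nhds \<zeta>0) (sequentially \<times>\<^sub>F nhds \<zeta>0)" by (rule filterlim_snd)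
  have y: "((\<lambda>x. y (fst x)) \<longlongrightarrow> yl) (sequentially \<times>\<^sub>F nhds \<zeta>0)" using filterlim_compose[OF assms(2) fst] .
  have r: "((\<lambda>x. \<rho> (fst x)) \<longlongrightarrow> 0) (sequentially \<times>\<^sub>F nhds \<zeta>0)" using filterlim_compose[OF assms(3) fst] .
  have "((\<lambda>x. y (fst x) + of_real (\<rho> (fst x)) * snd x) \<longlongrightarrow> yl + of_real 0 * \<zeta>0) (sequentially \<times>\<^sub>F nhds \<zeta>0)"
    by (intro tendsto_intros y r snd)
  then have "filterlim (\<lambda>x. (fst x, y (fst x) + of_real (\<rho> (fst x)) * snd x)) (sequentially \<times>\<^sub>F nhds yl) (sequentially \<times>\<^sub>F nhds \<zeta>0)"
    by (intro filterlim_Pair fst) simp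
  from filterlim_compose[OF assms(1)[unfolded conv_at_def] this] show ?thesis
    by (simp add: conv_at_def case_prod_unfold)
qed

text \<open>Choosing the smallest \<open>t\<close> for which the weighted spherical derivative reaches the value \<open>1\<close>
  makes it equal to \<open>1\<close> at \<open>y\<close> and at most \<open>1\<close> elsewhere.\<close>

lemma Zalcman_point:
  assumes f: "f holomorphic_on ball z0 R" and r: "0 < r" "r < R" and \<tau>: "0 < \<tau>" and \<alpha>: "\<alpha> > 0"
    and x: "x \<in> cball z0 r" "((r - cmod (x - z0)) * \<tau>) powr (1 + \<alpha>) * cmod (deriv f x)
      \<ge> 1 + ((r - cmod (x - z0)) * \<tau>) powr (2 * \<alpha>) * (cmod (f x))\<^sup>2"
  obtains y t where "y \<in> ball z0 r" "0 < t" "t \<le> \<tau>"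
    "((r - cmod (y - z0)) * t) powr (1 + \<alpha>) * cmod (deriv f y) = 1 + ((r - cmod (y - z0)) * t) powr (2 * \<alpha>) * (cmod (f y))\<^sup>2"
    "\<And>z. z \<in> cball z0 r \<Longrightarrow> ((r - cmod (z - z0)) * t) powr (1 + \<alpha>) * cmod (deriv f z)
      \<le> 1 + ((r - cmod (z - z0)) * t) powr (2 * \<alpha>) * (cmod (f z))\<^sup>2"
proof -
  define D where "D = (\<lambda>(z, t). ((r - cmod (z - z0)) * t) powr (1 + \<alpha>) * cmod (deriv f z)
      - (1 + ((r - cmod (z - z0)) * t) powr (2 * \<alpha>) * (cmod (f z))\<^sup>2))"
  define K where "K = cball z0 r \<times> {0..\<tau>}"
  have sub: "cball z0 r \<subseteq> ball z0 R" using r by auto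
  have cf: "continuous_on (cball z0 r) f" "continuous_on (cball z0 r) (deriv f)"
    using f sub by (meson holomorphic_on_imp_continuous_on holomorphic_on_subset holomorphic_deriv open_ball)+
  have nn: "(r - cmod (fst z - z0)) * snd z \<ge> 0" if "z \<in> K" for z
    using that by (auto simp: K_def dist_norm norm_minus_commute)
  have c1: "continuous_on K (\<lambda>z. f (fst z))" "continuous_on K (\<lambda>z. deriv f (fst z))"
    by (rule continuous_on_compose2[OF cf(1)] continuous_on_compose2[OF cf(2)];
        force simp: K_def intro: continuous_intros)+
  have c2: "continuous_on K (\<lambda>z. ((r - cmod (fst z - z0)) * snd z) powr b)" if "b > 0" for b
  proof (rule continuous_on_powr')
    show "continuous_on K (\<lambda>z. (r - cmod (fst z - z0)) * snd z)" by (intro continuous_intros)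
  qed (use nn that in auto)
  have cD: "continuous_on K D"
    unfolding D_def case_prod_unfold
    by (intro continuous_on_diff continuous_on_add continuous_on_mult continuous_on_const continuous_on_norm
        continuous_on_power c1 c2) (use \<alpha> in auto)
  have cK: "compact K" unfolding K_def by (intro compact_Times) auto
  define A where "A = {z \<in> K. 0 \<le> D z}"
  have "closed A" unfolding A_def
    using continuous_on_closed_Collect_le[OF continuous_on_const cD, of 0] compact_imp_closed[OF cK] by simp
  moreover have "A = K \<inter> A" by (auto simp: A_def)
  ultimately have cA: "compact A" using compact_Int_closed[OF cK] by metis
  have "(x, \<tau>) \<in> A" using x \<tau> by (auto simp: A_def K_def D_def)
  then have "A \<noteq> {}" by auto
  moreover have "continuous_on A snd" by (intro continuous_intros)
  ultimately obtain p where p: "p \<in> A" "\<And>p'. p' \<in> A \<Longrightarrow> snd p \<le> snd p'"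
    using continuous_attains_inf[OF cA] by blast
  define y t where "y = fst p" and "t = snd p"
  have yt: "(y, t) \<in> A" using p by (simp add: y_def t_def)
  have tle: "t \<le> t'" if "(z, t') \<in> A" for z t' using p(2)[OF that] by (simp add: t_def)
  have yK: "y \<in> cball z0 r" "0 \<le> t" "t \<le> \<tau>" "0 \<le> D (y, t)" using yt by (auto simp: A_def K_def)
  have t0: "t > 0" "cmod (y - z0) < r"
  proof -
    \<comment> \<open>Since \<open>0 powr b = 0\<close>, the difference \<open>D\<close> equals -1
      wherever the weight vanishes; the minimum is therefore attained at a positive \<open>t\<close>
      and inside the open disc.\<close>
    have "(r - cmod (y - z0)) * t \<noteq> 0"
    proof
      assume "(r - cmod (y - z0)) * t = 0"
      then have "D (y, t) = -1" unfolding D_def prod.case by (simp only: powr_zero_eq_one powr_0 mult_zero_left)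
      then show False using yK by simp
    qed
    then show "t > 0" "cmod (y - z0) < r" using yK by (auto simp: dist_norm norm_minus_commute)
  qed
  \<comment> \<open>For parameters below \<open>t\<close> no point of the disc satisfies
    \<open>0 \<le> D\<close>, by minimality; continuity in the parameter gives the bound at
    \<open>t\<close>.\<close>
  have le0: "D (z, t) \<le> 0" if z: "z \<in> cball z0 r" for z
  proof -
    have "continuous_on {0..\<tau>} (\<lambda>s. D (z, s))"
      by (rule continuous_on_compose2[OF cD]) (use z in \<open>auto simp: K_def intro!: continuous_intros\<close>)
    then have "continuous_on {0..t} (\<lambda>s. D (z, s))" by (rule continuous_on_subset) (use yK in auto)
    then have "((\<lambda>s. D (z, s)) \<longlongrightarrow> D (z, t)) (at_left t)"
      using t0(1) by (rule continuous_on_Icc_at_leftD)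
    then show ?thesis
    proof (rule tendsto_upperbound)
      show "\<forall>\<^sub>F s in at_left t. D (z, s) \<le> 0"
      proof (rule eventually_at_leftI[of 0])
        fix s assume s: "s \<in> {0<..<t}"
        then have "(z, s) \<notin> A" using tle[of z s] by auto
        then show "D (z, s) \<le> 0" using s z yK by (auto simp: A_def K_def)
      qed (use t0 in auto)
    qed simp
  qed
  show thesis
  proof (rule that[of y t])
    show "y \<in> ball z0 r" using t0 by (simp add: dist_norm norm_minus_commute)
    show "((r - cmod (y - z0)) * t) powr (1 + \<alpha>) * cmod (deriv f y) = 1 + ((r - cmod (y - z0)) * t) powr (2 * \<alpha>) * (cmod (f y))\<^sup>2"
      using le0[OF yK(1)] yK(4) by (simp add: D_def)
    show "((r - cmod (z - z0)) * t) powr (1 + \<alpha>) * cmod (deriv f z)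
      \<le> 1 + ((r - cmod (z - z0)) * t) powr (2 * \<alpha>) * (cmod (f z))\<^sup>2" if "z \<in> cball z0 r" for z
      using le0[OF that] by (simp add: D_def)
  qed (use t0 yK in auto)
qed

text \<open>The scale \<open>\<rho> = (r - cmod (y - z0)) * t\<close> is the weight at the extremal
  point. For \<open>cmod \<zeta> * \<tau> \<le> 1/2\<close> the weight at
  \<open>y + \<rho> * \<zeta>\<close> stays within a factor 2 of \<open>\<rho>\<close>; the powers
  \<open>1 + \<alpha>\<close> and \<open>2 * \<alpha>\<close> of this factor make up the
  constant.\<close>

lemma Zalcman_rescale:
  assumes f: "f holomorphic_on ball z0 R" and r: "0 < r" "r < R" and \<tau>: "0 < \<tau>" and \<alpha>: "\<alpha> > 0"
    and x: "x \<in> cball z0 r" "((r - cmod (x - z0)) * \<tau>) powr (1 + \<alpha>) * cmod (deriv f x)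
      \<ge> 1 + ((r - cmod (x - z0)) * \<tau>) powr (2 * \<alpha>) * (cmod (f x))\<^sup>2"
  obtains y \<rho> where "y \<in> cball z0 r" "0 < \<rho>" "\<rho> \<le> r * \<tau>"
    "cmod (deriv (\<lambda>\<zeta>. of_real (\<rho> powr \<alpha>) * f (y + of_real \<rho> * \<zeta>)) 0) = 1 + (cmod (of_real (\<rho> powr \<alpha>) * f y))\<^sup>2"
    "\<And>\<zeta>. cmod \<zeta> * \<tau> \<le> 1/2 \<Longrightarrow> y + of_real \<rho> * \<zeta> \<in> ball z0 R"
    "\<And>\<zeta>. cmod \<zeta> * \<tau> \<le> 1/2 \<Longrightarrow>
      cmod (deriv (\<lambda>\<zeta>. of_real (\<rho> powr \<alpha>) * f (y + of_real \<rho> * \<zeta>)) \<zeta>)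
      \<le> 2 powr (1 + 3 * \<alpha>) * (1 + (cmod (of_real (\<rho> powr \<alpha>) * f (y + of_real \<rho> * \<zeta>)))\<^sup>2)"
proof -
  obtain y t where y: "y \<in> ball z0 r" "0 < t" "t \<le> \<tau>"
    "((r - cmod (y - z0)) * t) powr (1 + \<alpha>) * cmod (deriv f y) = 1 + ((r - cmod (y - z0)) * t) powr (2 * \<alpha>) * (cmod (f y))\<^sup>2"
    and le: "\<And>z. z \<in> cball z0 r \<Longrightarrow> ((r - cmod (z - z0)) * t) powr (1 + \<alpha>) * cmod (deriv f z)
      \<le> 1 + ((r - cmod (z - z0)) * t) powr (2 * \<alpha>) * (cmod (f z))\<^sup>2"
    using Zalcman_point[OF assms] by blast
  define \<rho> where "\<rho> = (r - cmod (y - z0)) * t"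
  have yr: "cmod (y - z0) < r" using y(1) by (simp add: dist_norm norm_minus_commute)
  have \<rho>: "\<rho> > 0" using yr y(2) by (simp add: \<rho>_def)
  have sq: "(\<rho> powr \<alpha>)\<^sup>2 = \<rho> powr (2 * \<alpha>)" using \<rho> by (simp add: powr_powr power2_eq_square flip: powr_add)
  have normsq: "(cmod (of_real (\<rho> powr \<alpha>) * f u))\<^sup>2 = \<rho> powr (2 * \<alpha>) * (cmod (f u))\<^sup>2" for u
    using sq by (simp add: norm_mult power_mult_distrib)
  have mem: "y + of_real \<rho> * \<zeta> \<in> cball z0 r" "\<bar>(r - cmod (y + of_real \<rho> * \<zeta> - z0)) * t - \<rho>\<bar> \<le> \<rho> / 2"
    if \<zeta>: "cmod \<zeta> * \<tau> \<le> 1/2" for \<zeta>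
  proof -
    have t\<zeta>: "cmod \<zeta> * t \<le> 1/2" using mult_left_mono[OF y(3), of "cmod \<zeta>"] \<zeta> by simp
    have "cmod (of_real \<rho> * \<zeta>) = (r - cmod (y - z0)) * (cmod \<zeta> * t)"
      unfolding norm_mult norm_of_real using \<rho> by (simp add: \<rho>_def)
    also have "\<dots> \<le> (r - cmod (y - z0)) * (1/2)" using yr t\<zeta> by (intro mult_left_mono) auto
    finally have "cmod (of_real \<rho> * \<zeta>) \<le> r - cmod (y - z0)" using yr by simp
    then have "cmod ((y - z0) + of_real \<rho> * \<zeta>) \<le> r" using norm_triangle_ineq[of "y - z0" "of_real \<rho> * \<zeta>"] by linarith
    then show "y + of_real \<rho> * \<zeta> \<in> cball z0 r" by (simp add: dist_norm norm_minus_commute algebra_simps)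
    have "(r - cmod (y + of_real \<rho> * \<zeta> - z0)) * t - \<rho> = (cmod (y - z0) - cmod (y + of_real \<rho> * \<zeta> - z0)) * t"
      by (simp add: \<rho>_def algebra_simps)
    then have "\<bar>(r - cmod (y + of_real \<rho> * \<zeta> - z0)) * t - \<rho>\<bar> = \<bar>cmod (y - z0) - cmod (y + of_real \<rho> * \<zeta> - z0)\<bar> * t"
      using y(2) by (simp add: abs_mult)
    also have "\<dots> \<le> cmod (of_real \<rho> * \<zeta>) * t"
      using norm_triangle_ineq3[of "y - z0" "y + of_real \<rho> * \<zeta> - z0"] y(2)
      by (intro mult_right_mono) (auto simp: norm_minus_commute)
    also have "\<dots> = \<rho> * (cmod \<zeta> * t)" using \<rho> by (simp add: norm_mult)
    also have "\<dots> \<le> \<rho> * (1/2)" using \<rho> t\<zeta> by (intro mult_left_mono) auto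
    finally show "\<bar>(r - cmod (y + of_real \<rho> * \<zeta> - z0)) * t - \<rho>\<bar> \<le> \<rho> / 2" by simp
  qed
  have ball: "y + of_real \<rho> * \<zeta> \<in> ball z0 R" if "cmod \<zeta> * \<tau> \<le> 1/2" for \<zeta>
    using mem(1)[OF that] r by auto
  have der: "cmod (deriv (\<lambda>\<zeta>. of_real (\<rho> powr \<alpha>) * f (y + of_real \<rho> * \<zeta>)) \<zeta>) = \<rho> powr (1 + \<alpha>) * cmod (deriv f (y + of_real \<rho> * \<zeta>))"
    if "cmod \<zeta> * \<tau> \<le> 1/2" for \<zeta>
    using deriv_affine[OF open_ball f ball[OF that], of "of_real (\<rho> powr \<alpha>)"] \<rho>
    by (simp add: norm_mult powr_add mult_ac)
  show thesis
  proof (rule that[of y \<rho>])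
    show "y \<in> cball z0 r" using y(1) by auto
    show "\<rho> \<le> r * \<tau>" unfolding \<rho>_def using y r by (intro mult_mono) auto
    show "cmod (deriv (\<lambda>\<zeta>. of_real (\<rho> powr \<alpha>) * f (y + of_real \<rho> * \<zeta>)) 0) = 1 + (cmod (of_real (\<rho> powr \<alpha>) * f y))\<^sup>2"
      unfolding normsq using der[of 0] y(4) by (simp add: \<rho>_def)
    fix \<zeta> assume \<zeta>: "cmod \<zeta> * \<tau> \<le> 1/2"
    define z where "z = y + of_real \<rho> * \<zeta>"
    define s where "s = (r - cmod (z - z0)) * t"
    have "\<bar>s - \<rho>\<bar> \<le> \<rho> / 2" using mem(2)[OF \<zeta>] by (simp add: s_def z_def)
    then have s: "\<rho> \<le> 2 * s" "s \<le> 2 * \<rho>" "s > 0" using \<rho> by linarith+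
    have "\<rho> powr (1 + \<alpha>) * cmod (deriv f z) \<le> (2 * s) powr (1 + \<alpha>) * cmod (deriv f z)"
      using s \<rho> \<alpha> by (intro mult_right_mono powr_mono2) auto
    also have "\<dots> = 2 powr (1 + \<alpha>) * (s powr (1 + \<alpha>) * cmod (deriv f z))" using s by (simp add: powr_mult)
    also have "\<dots> \<le> 2 powr (1 + \<alpha>) * (1 + s powr (2 * \<alpha>) * (cmod (f z))\<^sup>2)"
      using le[OF mem(1)[OF \<zeta>]] by (intro mult_left_mono) (auto simp: s_def z_def)
    also have "\<dots> \<le> 2 powr (1 + \<alpha>) * (1 + (2 * \<rho>) powr (2 * \<alpha>) * (cmod (f z))\<^sup>2)"
      using s \<alpha> by (intro mult_left_mono add_left_mono mult_right_mono powr_mono2) auto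
    also have "\<dots> \<le> 2 powr (1 + \<alpha>) * (2 powr (2 * \<alpha>) * (1 + \<rho> powr (2 * \<alpha>) * (cmod (f z))\<^sup>2))"
    proof (intro mult_left_mono)
      have "1 \<le> 2 powr (2 * \<alpha>)" using \<alpha> by (intro ge_one_powr_ge_zero) auto
      then show "1 + (2 * \<rho>) powr (2 * \<alpha>) * (cmod (f z))\<^sup>2 \<le> 2 powr (2 * \<alpha>) * (1 + \<rho> powr (2 * \<alpha>) * (cmod (f z))\<^sup>2)"
        using \<rho> by (simp add: powr_mult algebra_simps)
    qed simp
    also have "\<dots> = 2 powr (1 + 3 * \<alpha>) * (1 + \<rho> powr (2 * \<alpha>) * (cmod (f z))\<^sup>2)"
      by (simp add: algebra_simps flip: powr_add)
    finally show "cmod (deriv (\<lambda>\<zeta>. of_real (\<rho> powr \<alpha>) * f (y + of_real \<rho> * \<zeta>)) \<zeta>)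
      \<le> 2 powr (1 + 3 * \<alpha>) * (1 + (cmod (of_real (\<rho> powr \<alpha>) * f (y + of_real \<rho> * \<zeta>)))\<^sup>2)"
      unfolding normsq der[OF \<zeta>] z_def .
  qed (use \<rho> ball in auto)
qed

lemma Zalcman_Pang:
  assumes F: "\<And>n. F n holomorphic_on ball z0 R" and R: "R > 0" and \<alpha>: "\<alpha> > 0"
    and unb: "\<And>M \<delta>. \<delta> > 0 \<Longrightarrow> \<forall>\<^sub>F n in sequentially. \<exists>x\<in>ball z0 \<delta>. M * (1 + (cmod (F n x))\<^sup>2) < cmod (deriv (F n) x)"
  obtains s :: "nat \<Rightarrow> nat" and \<rho> :: "nat \<Rightarrow> real" and y yl \<psi> M where
    "strict_mono s" "\<And>n. \<rho> n > 0" "\<rho> \<longlonglongrightarrow> 0" "y \<longlonglongrightarrow> yl" "yl \<in> ball z0 R"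
    "\<And>\<zeta>. conv_at (\<lambda>n \<zeta>. of_real (\<rho> n powr \<alpha>) * F (s n) (y n + of_real (\<rho> n) * \<zeta>)) \<psi> \<zeta>"
    "\<psi> holomorphic_on UNIV" "M > 0" "\<And>z. cmod (deriv \<psi> z) \<le> M * (1 + (cmod (\<psi> z))\<^sup>2)" "deriv \<psi> 0 \<noteq> 0"
proof -
  define r where "r = min (R / 2) 1"
  have r: "0 < r" "r < R" "r \<le> 1" using R by (auto simp: r_def)
  \<comment> \<open>The decay of \<open>\<tau>\<close> has two uses: it forces the scales to 0
    through \<open>\<rho> \<le> r * \<tau> k\<close>, and it lets the discs
    \<open>cmod \<zeta> \<le> 1 / (2 * \<tau> k)\<close> exhaust the plane.\<close>
  define \<tau> where "\<tau> = (\<lambda>k::nat. 1 / real (Suc k))"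
  have \<tau>: "\<tau> k > 0" "\<tau> k \<le> 1" for k by (auto simp: \<tau>_def)
  have \<tau>0: "\<tau> \<longlonglongrightarrow> 0" unfolding \<tau>_def by (rule lim_1_over_n[THEN LIMSEQ_Suc])
  \<comment> \<open>On \<open>ball z0 (r/2)\<close> the weight lies between
    \<open>r / 2 * \<tau> k\<close> and 1, so exceeding the spherical bound with constant
    \<open>L k\<close> there yields the hypothesis of \<open>Zalcman_rescale\<close>.\<close>
  define L where "L = (\<lambda>k. 1 / (r / 2 * \<tau> k) powr (1 + \<alpha>))"
  obtain s1 :: "nat \<Rightarrow> nat" where s1: "strict_mono s1"
    "\<And>k. \<exists>x\<in>ball z0 (r/2). L k * (1 + (cmod (F (s1 k) x))\<^sup>2) < cmod (deriv (F (s1 k)) x)"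
  proof (rule strict_mono_choice[of "\<lambda>k n. \<exists>x\<in>ball z0 (r/2). L k * (1 + (cmod (F n x))\<^sup>2) < cmod (deriv (F n) x)"])
    show "\<forall>\<^sub>F n in sequentially. \<exists>x\<in>ball z0 (r/2). L k * (1 + (cmod (F n x))\<^sup>2) < cmod (deriv (F n) x)" for k
      using unb[of "r/2" "L k"] r(1) by simp
  qed (rule that)
  define Z where "Z k y \<rho> \<longleftrightarrow> y \<in> cball z0 r \<and> 0 < \<rho> \<and> \<rho> \<le> r * \<tau> k \<and>
    cmod (deriv (\<lambda>\<zeta>. of_real (\<rho> powr \<alpha>) * F (s1 k) (y + of_real \<rho> * \<zeta>)) 0) = 1 + (cmod (of_real (\<rho> powr \<alpha>) * F (s1 k) y))\<^sup>2 \<and>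
    (\<forall>\<zeta>. cmod \<zeta> * \<tau> k \<le> 1/2 \<longrightarrow> y + of_real \<rho> * \<zeta> \<in> ball z0 R) \<and>
    (\<forall>\<zeta>. cmod \<zeta> * \<tau> k \<le> 1/2 \<longrightarrow>
      cmod (deriv (\<lambda>\<zeta>. of_real (\<rho> powr \<alpha>) * F (s1 k) (y + of_real \<rho> * \<zeta>)) \<zeta>)
      \<le> 2 powr (1 + 3 * \<alpha>) * (1 + (cmod (of_real (\<rho> powr \<alpha>) * F (s1 k) (y + of_real \<rho> * \<zeta>)))\<^sup>2))"
    for k y and \<rho> :: real
  have "\<exists>y \<rho>. Z k y \<rho>" for k
  proof -
    obtain x where x: "x \<in> ball z0 (r/2)" "L k * (1 + (cmod (F (s1 k) x))\<^sup>2) < cmod (deriv (F (s1 k)) x)"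
      using s1(2) by blast
    have xr: "cmod (x - z0) < r / 2" using x(1) by (simp add: dist_norm norm_minus_commute)
    define \<sigma> where "\<sigma> = (r - cmod (x - z0)) * \<tau> k"
    have \<sigma>1: "r / 2 * \<tau> k \<le> \<sigma>" unfolding \<sigma>_def using xr \<tau>(1)[of k] by (intro mult_right_mono) auto
    have \<sigma>2: "\<sigma> \<le> 1" unfolding \<sigma>_def
    proof (rule mult_le_one)
      show "r - cmod (x - z0) \<le> 1" using r(3) norm_ge_zero[of "x - z0"] by linarith
    qed (use \<tau>[of k] in auto)
    have pos: "r / 2 * \<tau> k > 0" using r \<tau>[of k] by simp
    have "\<sigma> powr (2 * \<alpha>) \<le> 1" using \<sigma>1 \<sigma>2 pos \<alpha> by (intro powr_le1) auto
    then have "1 + \<sigma> powr (2 * \<alpha>) * (cmod (F (s1 k) x))\<^sup>2 \<le> 1 + (cmod (F (s1 k) x))\<^sup>2"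
      by (simp add: mult_left_le_one_le)
    also have "\<dots> = (r / 2 * \<tau> k) powr (1 + \<alpha>) * (L k * (1 + (cmod (F (s1 k) x))\<^sup>2))"
    proof -
      have "(r / 2 * \<tau> k) powr (1 + \<alpha>) > 0" using r(1) \<tau>(1)[of k] by simp
      moreover have "A * (1 / A * X) = X" if "A > 0" for A X :: real using that by simp
      ultimately show ?thesis unfolding L_def by presburger
    qed
    also have "\<dots> \<le> (r / 2 * \<tau> k) powr (1 + \<alpha>) * cmod (deriv (F (s1 k)) x)"
      using x(2) by (intro mult_left_mono) auto
    also have "\<dots> \<le> \<sigma> powr (1 + \<alpha>) * cmod (deriv (F (s1 k)) x)"
      using \<sigma>1 pos \<alpha> by (intro mult_right_mono powr_mono2) auto
    finally have key: "1 + \<sigma> powr (2 * \<alpha>) * (cmod (F (s1 k) x))\<^sup>2 \<le> \<sigma> powr (1 + \<alpha>) * cmod (deriv (F (s1 k)) x)" .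
    have xc: "x \<in> cball z0 r" using xr r by (simp add: dist_norm norm_minus_commute)
    from Zalcman_rescale[OF F r(1,2) \<tau>(1) \<alpha> xc key[unfolded \<sigma>_def]] show ?thesis
      unfolding Z_def by metis
  qed
  then obtain y1 \<rho>1 where Z: "\<And>k. Z k (y1 k) (\<rho>1 k)" by metis
  have "\<forall>k. y1 k \<in> cball z0 r" using Z by (auto simp: Z_def)
  then obtain yl s2 where s2: "yl \<in> cball z0 r" "strict_mono (s2 :: nat \<Rightarrow> nat)" "(y1 \<circ> s2) \<longlonglongrightarrow> yl"
    using compact_cball[of z0 r] unfolding compact_def by metis
  define \<psi> where "\<psi> = (\<lambda>k \<zeta>. of_real (\<rho>1 k powr \<alpha>) * F (s1 k) (y1 k + of_real (\<rho>1 k) * \<zeta>))"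
  define M where "M = 2 powr (1 + 3 * \<alpha>)"
  have M: "M > 0" by (simp add: M_def)
  have \<rho>10: "\<rho>1 \<longlonglongrightarrow> 0"
  proof (rule tendsto_sandwich[of "\<lambda>_. 0" _ _ "\<lambda>k. r * \<tau> k"])
    show "(\<lambda>k. r * \<tau> k) \<longlonglongrightarrow> 0" using \<tau>0 by (rule tendsto_mult_right_zero)
  qed (use Z in \<open>auto simp: Z_def less_imp_le\<close>)
  have good: "\<forall>\<^sub>F k in sequentially. \<psi> k holomorphic_on ball 0 A \<and>
      (\<forall>x\<in>ball 0 A. cmod (deriv (\<psi> k) x) \<le> M * (1 + (cmod (\<psi> k x))\<^sup>2))" for A :: real
  proof -
    have "(\<lambda>k. \<bar>A\<bar> * \<tau> k) \<longlonglongrightarrow> 0" using \<tau>0 by (rule tendsto_mult_right_zero)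
    then have "\<forall>\<^sub>F k in sequentially. \<bar>A\<bar> * \<tau> k < 1/2" by (intro order_tendstoD(2)) auto
    then show ?thesis
    proof eventually_elim
      case (elim k)
      have small: "cmod \<zeta> * \<tau> k \<le> 1/2" if "\<zeta> \<in> ball 0 A" for \<zeta>
      proof -
        have "cmod \<zeta> * \<tau> k \<le> \<bar>A\<bar> * \<tau> k" using that \<tau>(1)[of k] by (intro mult_right_mono) auto
        then show ?thesis using elim by simp
      qed
      have "\<psi> k holomorphic_on ball 0 A"
        unfolding \<psi>_def by (rule holomorphic_affine[OF F]) (use Z[of k] small in \<open>auto simp: Z_def\<close>)
      moreover have "cmod (deriv (\<psi> k) x) \<le> M * (1 + (cmod (\<psi> k x))\<^sup>2)" if "x \<in> ball 0 A" for x
        unfolding \<psi>_def M_def using Z[of k] small[OF that] unfolding Z_def by blast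
      ultimately show ?case by blast
    qed
  qed
  have "\<exists>t. strict_mono t \<and> conv_on (\<lambda>n. \<psi> (s2 (t n))) UNIV"
  proof (rule conv_on_patch)
    fix z and s :: "nat \<Rightarrow> nat" assume s: "strict_mono s"
    have mono: "strict_mono (\<lambda>n. s2 (s n))" using s s2(2) by (simp add: strict_mono_def)
    have "\<forall>\<^sub>F n in sequentially. \<psi> (s2 (s n)) holomorphic_on ball z 1 \<and>
        (\<forall>x\<in>ball z 1. cmod (deriv (\<psi> (s2 (s n))) x) \<le> M * (1 + (cmod (\<psi> (s2 (s n)) x))\<^sup>2))"
      using eventually_subseq[OF mono good[of "cmod z + 1"]]
    proof eventually_elim
      case (elim n)
      have "ball z 1 \<subseteq> ball 0 (cmod z + 1)"
      proof
        fix x assume "x \<in> ball z 1"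
        then show "x \<in> ball 0 (cmod z + 1)" using norm_triangle_sub[of x z] by (simp add: dist_norm norm_minus_commute)
      qed
      then show ?case using elim holomorphic_on_subset by blast
    qed
    from Marty_conv_on_eventually[OF this _ M]
    show "\<exists>t r. strict_mono (t :: nat \<Rightarrow> nat) \<and> r > 0 \<and> conv_on (\<lambda>n. \<psi> (s2 (s (t n)))) (ball z r)" by simp
  qed auto
  then obtain t where t: "strict_mono t" "conv_on (\<lambda>n. \<psi> (s2 (t n))) UNIV" by blast
  define u where "u = (\<lambda>n. s2 (t n))"
  have u: "strict_mono u" using s2(2) t(1) by (simp add: strict_mono_def u_def)
  have d0: "cmod (deriv (\<psi> k) 0) = 1 + (cmod (\<psi> k 0))\<^sup>2" for k
    using Z[of k] unfolding Z_def \<psi>_def by simp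
  \<comment> \<open>Under an infinite limit Cauchy's estimate would make the derivative of the
    reciprocal at 0 at most \<open>1/2\<close>, while the normalisation \<open>d0\<close> makes it
    \<open>(1 + x\<^sup>2) / x\<^sup>2 > 1\<close> with
    \<open>x = cmod (\<psi> (u n) 0)\<close>.\<close>
  have "\<not> (\<forall>z. conv_inf_at (\<lambda>n. \<psi> (u n)) z)"
  proof
    assume "\<forall>z. conv_inf_at (\<lambda>n. \<psi> (u n)) z"
    then have "\<forall>\<^sub>F n in sequentially. \<forall>x\<in>cball 0 1. 2 < cmod (\<psi> (u n) x)"
      by (intro conv_inf_at_uniform) auto
    moreover have "\<forall>\<^sub>F n in sequentially. \<psi> (u n) holomorphic_on ball 0 2"
      using eventually_subseq[OF u good[of 2]] by (rule eventually_mono) auto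
    ultimately have "\<forall>\<^sub>F n in sequentially. False"
    proof eventually_elim
      case (elim n)
      have nz: "\<psi> (u n) x \<noteq> 0" if "x \<in> cball 0 1" for x using elim(1) that by force
      have h: "\<psi> (u n) holomorphic_on cball 0 1" using elim(2) by (rule holomorphic_on_subset) auto
      have hi: "(\<lambda>x. inverse (\<psi> (u n) x)) holomorphic_on cball 0 1" using h nz by (intro holomorphic_intros) auto
      have "cmod ((deriv ^^ 1) (\<lambda>x. inverse (\<psi> (u n) x)) 0) \<le> fact 1 * (1/2) / 1 ^ 1"
      proof (rule Cauchy_inequality)
        fix x :: complex assume "cmod (0 - x) = 1"
        then have "2 < cmod (\<psi> (u n) x)" using elim(1) by simp
        then have "inverse (cmod (\<psi> (u n) x)) \<le> inverse 2" by (intro le_imp_inverse_le) auto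
        then show "cmod (inverse (\<psi> (u n) x)) \<le> 1/2" by (simp add: norm_inverse)
      qed (use hi in \<open>auto intro: holomorphic_on_subset holomorphic_on_imp_continuous_on\<close>)
      moreover have "deriv (\<lambda>x. inverse (\<psi> (u n) x)) 0 = - deriv (\<psi> (u n)) 0 / (\<psi> (u n) 0)\<^sup>2"
      proof (rule DERIV_imp_deriv)
        have "(\<psi> (u n) has_field_derivative deriv (\<psi> (u n)) 0) (at 0)"
          using elim(2) by (intro holomorphic_derivI[of _ "ball 0 2"]) auto
        from DERIV_inverse'[OF this] nz[of 0]
        show "((\<lambda>x. inverse (\<psi> (u n) x)) has_field_derivative - deriv (\<psi> (u n)) 0 / (\<psi> (u n) 0)\<^sup>2) (at 0)"
          by (simp add: power2_eq_square field_simps)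
      qed
      ultimately have "(1 + (cmod (\<psi> (u n) 0))\<^sup>2) / (cmod (\<psi> (u n) 0))\<^sup>2 \<le> 1/2"
        by (simp add: norm_divide norm_power d0)
      moreover have "(cmod (\<psi> (u n) 0))\<^sup>2 > 0" using nz[of 0] by simp
      ultimately have "2 + (cmod (\<psi> (u n) 0))\<^sup>2 \<le> 0" by (simp add: pos_divide_le_eq)
      then show False using zero_le_power2[of "cmod (\<psi> (u n) 0)"] by linarith
    qed
    then show False by simp
  qed
  then obtain g where g: "\<And>z. conv_at (\<lambda>n. \<psi> (u n)) g z" using t(2) unfolding conv_on_def u_def by auto
  have eh: "holo_near (\<lambda>n. \<psi> (u n)) z" for z
  proof -
    have sub: "ball z 1 \<subseteq> ball 0 (cmod z + 1)"
    proof
      fix x assume "x \<in> ball z 1"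
      then show "x \<in> ball 0 (cmod z + 1)" using norm_triangle_sub[of x z] by (simp add: dist_norm norm_minus_commute)
    qed
    have "\<forall>\<^sub>F n in sequentially. \<psi> (u n) holomorphic_on ball z 1"
      using eventually_subseq[OF u good[of "cmod z + 1"]] by (rule eventually_mono) (use sub holomorphic_on_subset in blast)
    then show ?thesis unfolding holo_near_def by (intro exI[of _ 1]) auto
  qed
  have hg: "g holomorphic_on UNIV" by (rule conv_at_holomorphic) (use g eh in auto)
  have dg: "(\<lambda>n. deriv (\<psi> (u n)) z) \<longlonglongrightarrow> deriv g z" for z
    by (rule conv_at_pointwise[OF conv_at_deriv[of UNIV]]) (use g eh in auto)
  have "cmod (deriv g z) \<le> M * (1 + (cmod (g z))\<^sup>2)" for z
  proof (rule tendsto_le)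
    show "(\<lambda>n. M * (1 + (cmod (\<psi> (u n) z))\<^sup>2)) \<longlonglongrightarrow> M * (1 + (cmod (g z))\<^sup>2)"
      by (intro tendsto_intros conv_at_pointwise g)
    show "(\<lambda>n. cmod (deriv (\<psi> (u n)) z)) \<longlonglongrightarrow> cmod (deriv g z)" by (intro tendsto_norm dg)
    show "\<forall>\<^sub>F n in sequentially. cmod (deriv (\<psi> (u n)) z) \<le> M * (1 + (cmod (\<psi> (u n) z))\<^sup>2)"
      using eventually_subseq[OF u good[of "cmod z + 1"]] by (rule eventually_mono) auto
  qed simp
  moreover have "cmod (deriv g 0) \<ge> 1"
  proof (rule tendsto_lowerbound)
    show "(\<lambda>n. cmod (deriv (\<psi> (u n)) 0)) \<longlonglongrightarrow> cmod (deriv g 0)" by (intro tendsto_norm dg)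
    show "\<forall>\<^sub>F n in sequentially. 1 \<le> cmod (deriv (\<psi> (u n)) 0)" by (simp add: d0)
  qed simp
  moreover have "strict_mono (\<lambda>n. s1 (u n))" using s1(1) u by (simp add: strict_mono_def)
  moreover have "(\<lambda>n. \<rho>1 (u n)) \<longlonglongrightarrow> 0" using LIMSEQ_subseq_LIMSEQ[OF \<rho>10 u] by (simp add: o_def)
  moreover have "(\<lambda>n. y1 (u n)) \<longlonglongrightarrow> yl" using LIMSEQ_subseq_LIMSEQ[OF s2(3) t(1)] by (simp add: o_def u_def)
  moreover have "yl \<in> ball z0 R" using s2(1) r by auto
  moreover have "\<rho>1 (u n) > 0" for n using Z by (auto simp: Z_def)
  ultimately show thesis
    using g hg M by (intro that[of "\<lambda>n. s1 (u n)" "\<lambda>n. \<rho>1 (u n)" "\<lambda>n. y1 (u n)" yl g M]) (auto simp: \<psi>_def)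
qed

section \<open>Normality at regular points\<close>

definition multiple_zeros :: "(complex \<Rightarrow> complex) \<Rightarrow> complex set \<Rightarrow> bool" where
  "multiple_zeros f S \<longleftrightarrow> (\<forall>z\<in>S. f z = 0 \<longrightarrow> deriv f z = 0)"

lemma multiple_zeros_subset: "multiple_zeros f S \<Longrightarrow> T \<subseteq> S \<Longrightarrow> multiple_zeros f T"
  by (auto simp: multiple_zeros_def)

lemma multiple_zeros_affine:
  assumes "open S" "f holomorphic_on S" "multiple_zeros f S"
  shows "multiple_zeros (\<lambda>\<zeta>. a * f (b + \<rho> * \<zeta>)) {\<zeta>. b + \<rho> * \<zeta> \<in> S}"
  using assms(3) deriv_affine[OF assms(1,2), of b \<rho> _ a] by (auto simp: multiple_zeros_def)

text \<open>Near a simple zero of the limit, Hurwitz supplies zeros of \<open>F n\<close>, where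
  \<open>deriv (F n)\<close> vanishes, although it is close to \<open>deriv g z \<noteq> 0\<close>
  there. The sets \<open>T n\<close> are the domains of the rescaled functions; they need only
  contain some neighbourhood of each point from some index on.\<close>

lemma multiple_zeros_limit:
  assumes S: "open S" "connected S" and F: "\<And>z. z \<in> S \<Longrightarrow> conv_at F g z" "\<And>z. z \<in> S \<Longrightarrow> holo_near F z"
    and nz: "\<exists>z\<in>S. g z \<noteq> 0"
    and m: "\<And>n. multiple_zeros (F n) (T n)" and T: "\<And>x. x \<in> S \<Longrightarrow> \<exists>r>0. \<forall>\<^sub>F n in sequentially. ball x r \<subseteq> T n"
  shows "multiple_zeros g S"
  unfolding multiple_zeros_def
proof (intro ballI impI)
  fix z assume z: "z \<in> S" "g z = 0"
  have dF: "conv_at (\<lambda>n. deriv (F n)) (deriv g) z" using S(1) F z(1) by (rule conv_at_deriv)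
  obtain r where r: "r > 0" "\<forall>\<^sub>F n in sequentially. ball z r \<subseteq> T n" using T[OF z(1)] by blast
  show "deriv g z = 0"
  proof (rule ccontr)
    assume neq: "deriv g z \<noteq> 0"
    then have e: "cmod (deriv g z) > 0" by simp
    obtain N d where d: "d > 0" "\<And>n x. n \<ge> N \<Longrightarrow> x \<in> ball z d \<Longrightarrow> dist (deriv (F n) x) (deriv g z) < cmod (deriv g z)"
      using dF e unfolding conv_at_iff by meson
    have "\<forall>\<^sub>F n in sequentially. \<exists>x\<in>ball z (min r d). F n x = 0"
      by (rule Hurwitz_zero[OF S F z]) (use nz r d in auto)
    then have "\<forall>\<^sub>F n in sequentially. False"
      using r(2) eventually_ge_at_top[of N]
    proof eventually_elim
      case (elim n)
      then obtain x where x: "x \<in> ball z (min r d)" "F n x = 0" by blast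
      then have "deriv (F n) x = 0" using m[of n] elim(2) by (auto simp: multiple_zeros_def)
      then show False using d(2)[OF elim(3), of x] x by (simp add: dist_norm)
    qed
    then show False by simp
  qed
qed

lemma holo_near_mult: "holo_near F z \<Longrightarrow> holo_near G z \<Longrightarrow> holo_near (\<lambda>n x. F n x * G n x) z"
  and holo_near_diff: "holo_near F z \<Longrightarrow> holo_near G z \<Longrightarrow> holo_near (\<lambda>n x. F n x - G n x) z"
proof -
  assume "holo_near F z" "holo_near G z"
  then obtain r r' where r: "r > 0" "\<forall>\<^sub>F n in sequentially. F n holomorphic_on ball z r"
    "r' > 0" "\<forall>\<^sub>F n in sequentially. G n holomorphic_on ball z r'" by (auto simp: holo_near_def)
  have "\<forall>\<^sub>F n in sequentially. F n holomorphic_on ball z (min r r') \<and> G n holomorphic_on ball z (min r r')"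
    using r(2,4) by eventually_elim (auto intro: holomorphic_on_subset)
  then show "holo_near (\<lambda>n x. F n x * G n x) z" "holo_near (\<lambda>n x. F n x - G n x) z"
    unfolding holo_near_def using r(1,3)
    by (auto intro!: exI[of _ "min r r'"] holomorphic_intros elim!: eventually_mono)
qed

context diffpoly_exponents
begin

definition diffpoly_num_poly :: "complex poly \<Rightarrow> complex poly" where
  "diffpoly_num_poly P = (\<Prod>i\<in>{1..k}. recip_num_poly P (p i) (q i))"

lemma diffpoly_num_poly: "diffpoly_num (poly P) z = poly (diffpoly_num_poly P) z"
  by (simp add: diffpoly_num_def diffpoly_num_poly_def recip_num_poly poly_prod)

lemma diffpoly_num_poly_degree:
  assumes "degree P > 0"
  shows "diffpoly_num_poly P \<noteq> 0" "degree (diffpoly_num_poly P) = dp_ord * (degree P - 1)"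
proof -
  have *: "recip_num_poly P (p i) (q i) \<noteq> 0 \<and> degree (recip_num_poly P (p i) (q i)) = q i * (degree P - 1)" if "i \<in> {1..k}" for i
  proof (cases "q i = 0")
    case False
    then show ?thesis using q_le_p[OF that] assms by (intro recip_num_poly_degree) auto
  qed simp
  then show "diffpoly_num_poly P \<noteq> 0" by (simp add: diffpoly_num_poly_def)
  show "degree (diffpoly_num_poly P) = dp_ord * (degree P - 1)"
    unfolding diffpoly_num_poly_def using * by (subst degree_prod_eq_sum_degree) (auto simp: dp_ord_def sum_distrib_right)
qed

text \<open>The equation \<open>diffpoly_num f = h * f ^ dp_weight\<close> describes the zeros of \<open>Q[1 / f] - h\<close>.\<close>

definition few_solutions :: "(complex \<Rightarrow> complex) \<Rightarrow> (complex \<Rightarrow> complex) \<Rightarrow> complex set \<Rightarrow> bool" where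
  "few_solutions f h S \<longleftrightarrow> (\<forall>z\<in>S. f z \<noteq> 0 \<longrightarrow> diffpoly_num f z = h z * f z ^ dp_weight) \<or>
     (\<forall>T. finite T \<longrightarrow> T \<subseteq> {z\<in>S. f z \<noteq> 0 \<and> diffpoly_num f z = h z * f z ^ dp_weight} \<longrightarrow> card T < dp_weight)"

lemma few_solutions_subset: "few_solutions f h S \<Longrightarrow> T \<subseteq> S \<Longrightarrow> few_solutions f h T"
  unfolding few_solutions_def by (smt (verit) Collect_mono_iff order_trans subsetD)

text \<open>For \<open>degree P = M + 1\<close> the numerator has degree \<open>dp_ord * M\<close>
  and \<open>P\<close> has at most \<open>M + 1\<close> roots, so \<open>card_roots_off\<close>
  yields at least \<open>(dp_deg - 1) * M + dp_weight\<close> solutions. If the equation held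
  identically off the roots of \<open>P\<close>, then \<open>E * P\<close> would be zero.\<close>

lemma not_few_solutions_poly_const:
  assumes P: "degree P > 0" and c: "c \<noteq> 0"
  shows "\<not> few_solutions (poly P) (\<lambda>_. c) UNIV"
proof
  assume few_solutions: "few_solutions (poly P) (\<lambda>_. c) UNIV"
  define M where "M = degree P - 1"
  have M: "degree P = Suc M" using P by (simp add: M_def)
  obtain d' where d': "dp_deg = Suc d'" using dp_deg_pos by (cases dp_deg) auto
  have lt: "degree (diffpoly_num_poly P) < dp_weight * degree P" using diffpoly_num_poly_degree[OF P] M by (simp add: dp_weight_def d' algebra_simps)
  define E where "E = diffpoly_num_poly P - smult c (P ^ dp_weight)"
  note cr = card_roots_off[OF diffpoly_num_poly_degree(1)[OF P] P lt c, folded E_def]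
  have P0: "P \<noteq> 0" using P by auto
  define T where "T = {z. poly E z = 0 \<and> poly P z \<noteq> 0}"
  have finT: "finite T" unfolding T_def using poly_roots_finite[OF cr(1)] by (rule rev_finite_subset) auto
  have Ez: "poly E z = 0 \<longleftrightarrow> diffpoly_num (poly P) z = c * poly P z ^ dp_weight" for z by (simp add: E_def diffpoly_num_poly)
  have "dp_weight \<le> card T"
    using cr(2) card_roots_le_degree[OF P0] diffpoly_num_poly_degree(2)[OF P] M
    by (simp add: T_def dp_weight_def d' algebra_simps)
  moreover have "T = {z\<in>UNIV. poly P z \<noteq> 0 \<and> diffpoly_num (poly P) z = c * poly P z ^ dp_weight}"
    using Ez by (auto simp: T_def)
  ultimately have "\<forall>z. poly P z \<noteq> 0 \<longrightarrow> poly E z = 0"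
    using few_solutions finT unfolding few_solutions_def Ez by (metis UNIV_I not_less order_refl)
  then have "\<forall>z. poly (E * P) z = 0" by auto
  then have "E * P = 0" using poly_all_0_iff_0 by blast
  then show False using cr(1) P0 by simp
qed

text \<open>Clearing the denominator raises the degree of the numerator by one. In return
  \<open>P\<close> has at most \<open>M\<close> roots instead of \<open>M + 1\<close>, because they
  are multiple, and the count is the same as for a constant.\<close>

lemma not_few_solutions_poly_pole:
  assumes P: "degree P > 0" and b: "b \<noteq> 0" and m: "multiple_zeros (poly P) UNIV"
  shows "\<not> few_solutions (poly P) (\<lambda>z. b / z) (UNIV - {0})"
proof
  assume few_solutions: "few_solutions (poly P) (\<lambda>z. b / z) (UNIV - {0})"
  define M where "M = degree P - 1"
  have M: "degree P = Suc M" using P by (simp add: M_def)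
  obtain d' where d': "dp_deg = Suc d'" using dp_deg_pos by (cases dp_deg) auto
  obtain e where e: "dp_ord = Suc e" using dp_ord_pos by (cases dp_ord) auto
  define K where "K = [:0, 1:] * diffpoly_num_poly P"
  have K: "K \<noteq> 0" "degree K = Suc (dp_ord * M)" using diffpoly_num_poly_degree[OF P] by (simp_all add: K_def M_def degree_mult_eq)
  have lt: "degree K < dp_weight * degree P" using K M by (simp add: dp_weight_def d' e algebra_simps)
  define E where "E = K - smult b (P ^ dp_weight)"
  note cr = card_roots_off[OF K(1) P lt b, folded E_def]
  have P0: "P \<noteq> 0" using P by auto
  define T where "T = {z. poly E z = 0 \<and> poly P z \<noteq> 0}"
  have finT: "finite T" unfolding T_def using poly_roots_finite[OF cr(1)] by (rule rev_finite_subset) auto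
  \<comment> \<open>The point 0 is excluded from the equation and must not be counted:
    \<open>K\<close> vanishes there, so \<open>E\<close> takes the value of
    \<open>- b * P ^ dp_weight\<close>.\<close>
  have E0: "poly E 0 \<noteq> 0" if "poly P 0 \<noteq> 0" using that b by (simp add: E_def K_def)
  have Ez: "poly E z = 0 \<longleftrightarrow> diffpoly_num (poly P) z = b / z * poly P z ^ dp_weight" if "z \<noteq> 0" for z
    using that by (auto simp: E_def K_def diffpoly_num_poly field_simps)
  have "2 * card {z. poly P z = 0} \<le> degree P"
    by (rule card_multiple_roots[OF P0]) (use m in \<open>auto simp: multiple_zeros_def\<close>)
  then have "card {z. poly P z = 0} \<le> M" using M by simp
  then have "dp_weight \<le> card T"
    using cr(2) K(2) M by (simp add: T_def dp_weight_def d' e algebra_simps)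
  moreover have "T = {z\<in>UNIV - {0}. poly P z \<noteq> 0 \<and> diffpoly_num (poly P) z = b / z * poly P z ^ dp_weight}"
  proof (rule set_eqI)
    fix z
    show "z \<in> T \<longleftrightarrow> z \<in> {z\<in>UNIV - {0}. poly P z \<noteq> 0 \<and> diffpoly_num (poly P) z = b / z * poly P z ^ dp_weight}"
    proof (cases "z = 0")
      case True
      then show ?thesis using E0 by (auto simp: T_def)
    next
      case False
      then show ?thesis unfolding T_def mem_Collect_eq Ez[OF False] by blast
    qed
  qed
  ultimately have "\<forall>z\<in>UNIV - {0}. poly P z \<noteq> 0 \<longrightarrow> diffpoly_num (poly P) z = b / z * poly P z ^ dp_weight"
    using few_solutions finT unfolding few_solutions_def by (metis not_less order_refl)
  then have "poly (E * P * [:0, 1:]) z = 0" for z using Ez[of z] by (cases "z = 0") auto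
  then have "E * P * [:0, 1:] = 0" using poly_all_0_iff_0 by blast
  then show False using cr(1) P0 by simp
qed

text \<open>\<open>diffpoly_num\<close> is multiplied by \<open>(a * \<rho>) ^ dp_ord\<close> and
  \<open>f ^ dp_weight\<close> by \<open>a ^ dp_weight\<close>; the condition on \<open>h'\<close>
  is what makes these factors balance. The choice of \<open>a\<close> is left open because regular
  points and poles need different ones.\<close>

lemma few_solutions_affine:
  assumes S: "open S" "f holomorphic_on S" and "a \<noteq> 0" "\<rho> \<noteq> 0" and few_solutions: "few_solutions f h S"
    and h': "\<And>\<zeta>. b + \<rho> * \<zeta> \<in> S \<Longrightarrow> h' \<zeta> * a ^ dp_deg = \<rho> ^ dp_ord * h (b + \<rho> * \<zeta>)"
  shows "few_solutions (\<lambda>\<zeta>. a * f (b + \<rho> * \<zeta>)) h' {\<zeta>. b + \<rho> * \<zeta> \<in> S}"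
proof -
  let ?g = "\<lambda>\<zeta>. a * f (b + \<rho> * \<zeta>)"
  have iff: "diffpoly_num ?g \<zeta> = h' \<zeta> * ?g \<zeta> ^ dp_weight \<longleftrightarrow> diffpoly_num f (b + \<rho> * \<zeta>) = h (b + \<rho> * \<zeta>) * f (b + \<rho> * \<zeta>) ^ dp_weight"
    if \<zeta>: "b + \<rho> * \<zeta> \<in> S" for \<zeta>
  proof -
    have "diffpoly_num ?g \<zeta> = (a * \<rho>) ^ dp_ord * diffpoly_num f (b + \<rho> * \<zeta>)"
      unfolding diffpoly_num_def recip_num_affine[OF S \<zeta>] prod.distrib by (simp add: dp_ord_def power_sum)
    moreover have "h' \<zeta> * ?g \<zeta> ^ dp_weight = (h' \<zeta> * a ^ dp_deg) * a ^ dp_ord * f (b + \<rho> * \<zeta>) ^ dp_weight"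
      by (simp add: dp_weight_def power_add power_mult_distrib)
    then have "h' \<zeta> * ?g \<zeta> ^ dp_weight = (a * \<rho>) ^ dp_ord * (h (b + \<rho> * \<zeta>) * f (b + \<rho> * \<zeta>) ^ dp_weight)"
      unfolding h'[OF \<zeta>] power_mult_distrib by (simp only: mult_ac)
    ultimately show ?thesis using assms(3,4) by simp
  qed
  have inj: "inj (\<lambda>\<zeta>. b + \<rho> * \<zeta>)" using assms(4) by (auto intro: injI)
  from few_solutions show ?thesis unfolding few_solutions_def
  proof
    assume "\<forall>z\<in>S. f z \<noteq> 0 \<longrightarrow> diffpoly_num f z = h z * f z ^ dp_weight"
    then show "(\<forall>\<zeta>\<in>{\<zeta>. b + \<rho> * \<zeta> \<in> S}. ?g \<zeta> \<noteq> 0 \<longrightarrow> diffpoly_num ?g \<zeta> = h' \<zeta> * ?g \<zeta> ^ dp_weight) \<or> 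
      (\<forall>T. finite T \<longrightarrow> T \<subseteq> {\<zeta> \<in> {\<zeta>. b + \<rho> * \<zeta> \<in> S}. ?g \<zeta> \<noteq> 0 \<and> diffpoly_num ?g \<zeta> = h' \<zeta> * ?g \<zeta> ^ dp_weight} \<longrightarrow> card T < dp_weight)"
      using iff by (intro disjI1) auto
  next
    assume c: "\<forall>T. finite T \<longrightarrow> T \<subseteq> {z \<in> S. f z \<noteq> 0 \<and> diffpoly_num f z = h z * f z ^ dp_weight} \<longrightarrow> card T < dp_weight"
    have "card T < dp_weight" if T: "finite T" "T \<subseteq> {\<zeta> \<in> {\<zeta>. b + \<rho> * \<zeta> \<in> S}. ?g \<zeta> \<noteq> 0 \<and> diffpoly_num ?g \<zeta> = h' \<zeta> * ?g \<zeta> ^ dp_weight}" for T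
    proof -
      have "(\<lambda>\<zeta>. b + \<rho> * \<zeta>) ` T \<subseteq> {z \<in> S. f z \<noteq> 0 \<and> diffpoly_num f z = h z * f z ^ dp_weight}"
        using T(2) iff by auto
      then have "card ((\<lambda>\<zeta>. b + \<rho> * \<zeta>) ` T) < dp_weight" by (intro c[rule_format] finite_imageI T(1))
      then show ?thesis using card_image[OF inj_on_subset[OF inj, of T]] by simp
    qed
    then show "(\<forall>\<zeta>\<in>{\<zeta>. b + \<rho> * \<zeta> \<in> S}. ?g \<zeta> \<noteq> 0 \<longrightarrow> diffpoly_num ?g \<zeta> = h' \<zeta> * ?g \<zeta> ^ dp_weight) \<or> 
      (\<forall>T. finite T \<longrightarrow> T \<subseteq> {\<zeta> \<in> {\<zeta>. b + \<rho> * \<zeta> \<in> S}. ?g \<zeta> \<noteq> 0 \<and> diffpoly_num ?g \<zeta> = h' \<zeta> * ?g \<zeta> ^ dp_weight} \<longrightarrow> card T < dp_weight)"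
      by blast
  qed
qed

text \<open>By Hurwitz each solution for the limit is approached by solutions for
  \<open>F n\<close>, and disjoint balls keep different ones apart. Hurwitz gives nothing when the
  limit equation holds identically, which accounts for the first alternative in
  \<open>few_solutions\<close>.\<close>

lemma few_solutions_limit:
  assumes S: "open S" "connected S" and F: "\<And>z. z \<in> S \<Longrightarrow> conv_at F g z" "\<And>z. z \<in> S \<Longrightarrow> holo_near F z"
    and h: "\<And>z. z \<in> S \<Longrightarrow> conv_at h h0 z" "\<And>z. z \<in> S \<Longrightarrow> holo_near h z"
    and few_solutions: "\<And>n. few_solutions (F n) (h n) (T n)" and T: "\<And>x. x \<in> S \<Longrightarrow> \<exists>r>0. \<forall>\<^sub>F n in sequentially. ball x r \<subseteq> T n"
  shows "few_solutions g h0 S"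
proof -
  define E where "E = (\<lambda>n z. diffpoly_num (F n) z - h n z * F n z ^ dp_weight)"
  define e where "e = (\<lambda>z. diffpoly_num g z - h0 z * g z ^ dp_weight)"
  have Ec: "conv_at E e z" if z: "z \<in> S" for z
    unfolding E_def e_def diffpoly_num_def
    by (intro conv_at_diff conv_at_mult conv_at_power conv_at_prod conv_at_recip_num[OF S(1) F z] F h z) auto
  have eholp: "holo_near (\<lambda>n z. \<Prod>i\<in>I. f i n z) z" if "finite I" "\<And>i. i \<in> I \<Longrightarrow> holo_near (f i) z"
    for I :: "nat set" and f z
    using that
  proof (induction I rule: finite_induct)
    case empty
    then show ?case by (auto simp: holo_near_def intro!: exI[of _ 1])
  qed (auto intro: holo_near_mult)
  have eholpow: "holo_near (\<lambda>n z. f n z ^ m) z" if "holo_near f z" for f z m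
    using eholp[of "{..<m}" "\<lambda>_. f" z] that by simp
  have Eh: "holo_near E z" if z: "z \<in> S" for z
    unfolding E_def diffpoly_num_def
    by (intro holo_near_diff holo_near_mult eholp eholpow holo_near_recip_num F h z) auto
  show ?thesis
  proof (cases "\<forall>z\<in>S. g z \<noteq> 0 \<longrightarrow> e z = 0")
    case True
    then show ?thesis unfolding few_solutions_def e_def by auto
  next
    case False
    then obtain b where b: "b \<in> S" "g b \<noteq> 0" "e b \<noteq> 0" by blast
    have "card T' < dp_weight" if T': "finite T'" "T' \<subseteq> {z\<in>S. g z \<noteq> 0 \<and> diffpoly_num g z = h0 z * g z ^ dp_weight}" for T'
    proof -
      have T'z: "t \<in> S" "g t \<noteq> 0" "e t = 0" if "t \<in> T'" for t using T'(2) that by (auto simp: e_def)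
      \<comment> \<open>Half the least distance between points of \<open>T'\<close>, so that the
        balls of radius \<open>r0\<close> are disjoint.\<close>
      obtain r0 where r0: "r0 > 0" "\<And>s t. s \<in> T' \<Longrightarrow> t \<in> T' \<Longrightarrow> s \<noteq> t \<Longrightarrow> 2 * r0 \<le> dist s t"
      proof (cases "\<exists>s\<in>T'. \<exists>t\<in>T'. s \<noteq> t")
        case True
        define A where "A = (\<lambda>(s, t). dist s t) ` {(s, t) \<in> T' \<times> T'. s \<noteq> t}"
        have finA: "finite A" unfolding A_def
          by (intro finite_imageI finite_subset[OF _ finite_cartesian_product[OF T'(1) T'(1)]]) auto
        have neA: "A \<noteq> {}" using True by (auto simp: A_def)
        have "Min A \<in> A" by (rule Min_in[OF finA neA])
        then have "Min A > 0" by (auto simp: A_def)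
        moreover have "Min A \<le> dist s t" if "s \<in> T'" "t \<in> T'" "s \<noteq> t" for s t
          using that finA by (intro Min_le) (force simp: A_def)+
        ultimately show ?thesis by (intro that[of "Min A / 2"]) auto
      next
        case False
        then show ?thesis by (intro that[of 1]) auto
      qed
      have near: "\<forall>\<^sub>F n in sequentially. \<exists>x\<in>ball t r0. E n x = 0 \<and> F n x \<noteq> 0 \<and> x \<in> T n" if t: "t \<in> T'" for t
      proof -
        obtain r1 where r1: "r1 > 0" "\<forall>\<^sub>F n in sequentially. ball t r1 \<subseteq> T n" using T T'z(1)[OF t] by blast
        have gt: "cmod (g t) > 0" using T'z(2)[OF t] by simp
        obtain N r2 where r2: "r2 > 0" "\<And>n x. n \<ge> N \<Longrightarrow> x \<in> ball t r2 \<Longrightarrow> dist (F n x) (g t) < cmod (g t)"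
          using F(1)[OF T'z(1)[OF t]] gt unfolding conv_at_iff by meson
        have "\<forall>\<^sub>F n in sequentially. \<exists>x\<in>ball t (min r0 (min r1 r2)). E n x = 0"
          by (rule Hurwitz_zero[OF S Ec Eh]) (use T'z[OF t] b r0 r1 r2 in auto)
        then show ?thesis using r1(2) eventually_ge_at_top[of N]
        proof eventually_elim
          case (elim n)
          then obtain x where x: "x \<in> ball t (min r0 (min r1 r2))" "E n x = 0" by blast
          have "F n x \<noteq> 0" using r2(2)[OF elim(3), of x] x by (auto simp: dist_norm)
          moreover have "x \<in> T n" "x \<in> ball t r0" using elim(2) x(1) by auto
          ultimately show ?case using x(2) by blast
        qed
      qed
      have ev: "\<forall>\<^sub>F n in sequentially. \<forall>t\<in>T'. \<exists>x\<in>ball t r0. E n x = 0 \<and> F n x \<noteq> 0 \<and> x \<in> T n"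
        using T'(1) near by (intro eventually_ball_finite) auto
      \<comment> \<open>At \<open>b\<close> the limit is non-zero and the equation fails; for large
        \<open>n\<close> the same holds for \<open>F n\<close>, which excludes the first alternative
        there.\<close>
      have Eb: "(\<lambda>n. E n b) \<longlonglongrightarrow> e b" "(\<lambda>n. F n b) \<longlonglongrightarrow> g b"
        using Ec[OF b(1)] F(1)[OF b(1)] by (auto intro: conv_at_pointwise)
      have evb: "\<forall>\<^sub>F n in sequentially. E n b \<noteq> 0" "\<forall>\<^sub>F n in sequentially. F n b \<noteq> 0"
        using tendsto_imp_eventually_ne[OF Eb(1) b(3)] tendsto_imp_eventually_ne[OF Eb(2) b(2)] by auto
      obtain r3 where r3: "r3 > 0" "\<forall>\<^sub>F n in sequentially. ball b r3 \<subseteq> T n" using T b(1) by blast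
      obtain n where n: "\<forall>t\<in>T'. \<exists>x\<in>ball t r0. E n x = 0 \<and> F n x \<noteq> 0 \<and> x \<in> T n"
        "E n b \<noteq> 0" "F n b \<noteq> 0" "ball b r3 \<subseteq> T n"
        using eventually_happens[OF eventually_conj[OF ev eventually_conj[OF evb(1) eventually_conj[OF evb(2) r3(2)]]]]
        by auto
      have bT: "b \<in> T n" using n(4) r3(1) by auto
      from n(1) obtain x where x: "\<And>t. t \<in> T' \<Longrightarrow> x t \<in> ball t r0 \<and> E n (x t) = 0 \<and> F n (x t) \<noteq> 0 \<and> x t \<in> T n" by metis
      have inj: "inj_on x T'"
      proof (rule inj_onI, rule ccontr)
        fix s t assume st: "s \<in> T'" "t \<in> T'" "x s = x t" "s \<noteq> t"
        then have "dist s (x s) < r0" "dist t (x s) < r0" using x[of s] x[of t] by auto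
        then have "dist s t < 2 * r0" using dist_triangle2[of s t "x s"] by simp
        then show False using r0(2)[of s t] st by simp
      qed
      have "\<not> (\<forall>z\<in>T n. F n z \<noteq> 0 \<longrightarrow> diffpoly_num (F n) z = h n z * F n z ^ dp_weight)"
        using bT n(2,3) by (auto simp: E_def)
      moreover have "x ` T' \<subseteq> {z\<in>T n. F n z \<noteq> 0 \<and> diffpoly_num (F n) z = h n z * F n z ^ dp_weight}"
        using x by (auto simp: E_def)
      ultimately have "card (x ` T') < dp_weight" using few_solutions[of n] T'(1) unfolding few_solutions_def by blast
      then show ?thesis using card_image[OF inj] by simp
    qed
    then show ?thesis unfolding few_solutions_def by blast
  qed
qed

lemma few_solutions_finite:
  assumes "few_solutions f h S"
  shows "(\<forall>z\<in>S. f z \<noteq> 0 \<longrightarrow> diffpoly_num f z = h z * f z ^ dp_weight) \<or> finite {z\<in>S. f z \<noteq> 0 \<and> diffpoly_num f z = h z * f z ^ dp_weight}"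
  using assms infinite_arbitrarily_large[of "{z\<in>S. f z \<noteq> 0 \<and> diffpoly_num f z = h z * f z ^ dp_weight}" dp_weight]
  unfolding few_solutions_def by (metis (no_types, lifting) less_irrefl)

lemma normal_at_regular:
  assumes R: "R > 0" and F: "\<And>n. F n holomorphic_on ball z0 R" "\<And>n. multiple_zeros (F n) (ball z0 R)"
    and few_solutions: "\<And>n. few_solutions (F n) (hn n) (ball z0 R)"
    and hn: "\<And>n. hn n holomorphic_on ball z0 R" "\<And>z. z \<in> ball z0 R \<Longrightarrow> conv_at hn h z" "\<And>z. z \<in> ball z0 R \<Longrightarrow> h z \<noteq> 0"
  shows "\<exists>t r. strict_mono (t :: nat \<Rightarrow> nat) \<and> r > 0 \<and> conv_on (\<lambda>n. F (t n)) (ball z0 r)"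
\<comment> \<open>A spherical bound for infinitely many \<open>n\<close> suffices for Marty's
  criterion. Its failure is a statement about all large \<open>n\<close>, for every bound and
  radius, which is the input of \<open>Zalcman_Pang\<close>.\<close>
proof (cases "\<exists>M \<delta>. \<delta> > 0 \<and> (\<exists>\<^sub>F n in sequentially. \<forall>x\<in>ball z0 \<delta>. cmod (deriv (F n) x) \<le> M * (1 + (cmod (F n x))\<^sup>2))")
  case True
  then obtain M \<delta> where M: "\<delta> > 0" "\<exists>\<^sub>F n in sequentially. \<forall>x\<in>ball z0 \<delta>. cmod (deriv (F n) x) \<le> M * (1 + (cmod (F n x))\<^sup>2)" by blast
  then have "infinite {n. \<forall>x\<in>ball z0 \<delta>. cmod (deriv (F n) x) \<le> M * (1 + (cmod (F n x))\<^sup>2)}"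
    by (simp add: frequently_cofinite flip: cofinite_eq_sequentially)
  then obtain s :: "nat \<Rightarrow> nat" where s: "strict_mono s"
    "\<And>n x. x \<in> ball z0 \<delta> \<Longrightarrow> cmod (deriv (F (s n)) x) \<le> M * (1 + (cmod (F (s n) x))\<^sup>2)"
    by (auto dest!: infinite_enumerate)
  have "\<exists>t \<delta>'. strict_mono (t :: nat \<Rightarrow> nat) \<and> \<delta>' > 0 \<and> conv_on (\<lambda>n. F (s (t n))) (ball z0 \<delta>')"
  proof (rule Marty_conv_on[of "\<lambda>n. F (s n)" z0 "min \<delta> R" "max M 1"])
    fix n x assume x: "x \<in> ball z0 (min \<delta> R)"
    have "cmod (deriv (F (s n)) x) \<le> M * (1 + (cmod (F (s n) x))\<^sup>2)" using s(2) x by simp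
    also have "\<dots> \<le> max M 1 * (1 + (cmod (F (s n) x))\<^sup>2)" by (intro mult_right_mono) auto
    finally show "cmod (deriv (F (s n)) x) \<le> max M 1 * (1 + (cmod (F (s n) x))\<^sup>2)" .
  qed (use M R in \<open>auto intro: holomorphic_on_subset[OF F(1)]\<close>)
  then obtain t \<delta>' where "strict_mono (t :: nat \<Rightarrow> nat)" "\<delta>' > 0" "conv_on (\<lambda>n. F (s (t n))) (ball z0 \<delta>')" by blast
  then show ?thesis using s(1) by (intro exI[of _ "\<lambda>n. s (t n)"] exI[of _ \<delta>']) (auto simp: strict_mono_def)
next
  case False
  \<comment> \<open>With this exponent
    \<open>(\<rho> powr \<alpha>) ^ dp_deg = \<rho> ^ dp_ord\<close>, so the right-hand side of the
    rescaled equation is just \<open>hn\<close> at the rescaled point.\<close>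
  define \<alpha> where "\<alpha> = real dp_ord / real dp_deg"
  have \<alpha>: "\<alpha> > 0" using dp_ord_pos dp_deg_pos by (simp add: \<alpha>_def)
  have unb: "\<forall>\<^sub>F n in sequentially. \<exists>x\<in>ball z0 \<delta>. M * (1 + (cmod (F n x))\<^sup>2) < cmod (deriv (F n) x)" if "\<delta> > 0" for M \<delta>
  proof -
    have "\<not> (\<exists>\<^sub>F n in sequentially. \<forall>x\<in>ball z0 \<delta>. cmod (deriv (F n) x) \<le> M * (1 + (cmod (F n x))\<^sup>2))"
      using False that by blast
    then show ?thesis by (simp add: not_frequently not_le)
  qed
  obtain s \<rho> y yl \<psi> M where Z: "strict_mono (s :: nat \<Rightarrow> nat)" "\<And>n. \<rho> n > 0" "\<rho> \<longlonglongrightarrow> 0" "y \<longlonglongrightarrow> yl" "yl \<in> ball z0 R"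
    "\<And>\<zeta>. conv_at (\<lambda>n \<zeta>. of_real (\<rho> n powr \<alpha>) * F (s n) (y n + of_real (\<rho> n) * \<zeta>)) \<psi> \<zeta>"
    "\<psi> holomorphic_on UNIV" "M > 0" "\<And>z. cmod (deriv \<psi> z) \<le> M * (1 + (cmod (\<psi> z))\<^sup>2)" "deriv \<psi> 0 \<noteq> 0"
    using Zalcman_Pang[OF F(1) R \<alpha> unb] by blast
  define T where "T = (\<lambda>n. {\<zeta>. y n + of_real (\<rho> n) * \<zeta> \<in> ball z0 R})"
  have T: "\<exists>r>0. \<forall>\<^sub>F n in sequentially. ball x r \<subseteq> T n" for x
    using scaled_in_open[OF open_ball Z(4,5,3), of x] unfolding T_def
    by (intro exI[of _ 1]) (auto elim: eventually_mono)
  have eh: "holo_near (\<lambda>n \<zeta>. of_real (\<rho> n powr \<alpha>) * F (s n) (y n + of_real (\<rho> n) * \<zeta>)) \<zeta>" for \<zeta>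
    by (rule holo_near_scaled[OF open_ball F(1) Z(4,5,3)])
  have eh': "holo_near (\<lambda>n \<zeta>. hn (s n) (y n + of_real (\<rho> n) * \<zeta>)) \<zeta>" for \<zeta>
    using holo_near_scaled[of "ball z0 R" "\<lambda>n. hn (s n)" y yl \<rho> "\<lambda>_. 1" \<zeta>] hn(1) Z(3,4,5) by simp
  have ch: "conv_at (\<lambda>n \<zeta>. hn (s n) (y n + of_real (\<rho> n) * \<zeta>)) (\<lambda>_. h yl) \<zeta>" for \<zeta>
    by (rule conv_at_scaled[OF conv_at_subseq[OF hn(2)[OF Z(5)] Z(1)] Z(4,3)])
  have pw: "complex_of_real (\<rho> n powr \<alpha>) ^ dp_deg = of_real (\<rho> n) ^ dp_ord" for n
  proof -
    have "(\<rho> n powr \<alpha>) ^ dp_deg = \<rho> n powr (\<alpha> * real dp_deg)"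
      using Z(2)[of n] by (simp add: powr_powr flip: powr_realpow)
    also have "\<alpha> * real dp_deg = real dp_ord" using dp_deg_pos by (simp add: \<alpha>_def)
    also have "\<rho> n powr real dp_ord = \<rho> n ^ dp_ord" using Z(2)[of n] by (simp add: powr_realpow)
    finally show ?thesis by (simp flip: of_real_power)
  qed
  have fewn: "few_solutions (\<lambda>\<zeta>. of_real (\<rho> n powr \<alpha>) * F (s n) (y n + of_real (\<rho> n) * \<zeta>)) (\<lambda>\<zeta>. hn (s n) (y n + of_real (\<rho> n) * \<zeta>)) (T n)" for n
    unfolding T_def
    by (rule few_solutions_affine[OF open_ball F(1) _ _ few_solutions]) (use Z(2)[of n] pw in \<open>auto simp: mult.commute\<close>)
  have few_solutions\<psi>: "few_solutions \<psi> (\<lambda>_. h yl) UNIV"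
    by (rule few_solutions_limit[OF open_UNIV connected_UNIV Z(6) eh ch eh' fewn T])
  have "\<exists>z. \<psi> z \<noteq> 0"
  proof (rule ccontr)
    assume "\<not> (\<exists>z. \<psi> z \<noteq> 0)"
    then have "\<psi> = (\<lambda>_. 0)" by auto
    then show False using Z(10) by simp
  qed
  moreover have "multiple_zeros (\<lambda>\<zeta>. of_real (\<rho> n powr \<alpha>) * F (s n) (y n + of_real (\<rho> n) * \<zeta>)) (T n)" for n
    unfolding T_def by (rule multiple_zeros_affine[OF open_ball F(1) F(2)])
  ultimately have m\<psi>: "multiple_zeros \<psi> UNIV"
    by (intro multiple_zeros_limit[OF open_UNIV connected_UNIV Z(6) eh _ _ T]) auto
  have et: "exp_type 0 \<psi>" by (rule spherical_deriv_exp_type[OF Z(7,8,9)])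
  have c: "h yl \<noteq> 0" using hn(3) Z(5) by blast
  have "\<exists>P. \<psi> = poly P"
    by (rule transcendental_excluded[OF et _ c]) (use m\<psi> few_solutions_finite[OF few_solutions\<psi>] in \<open>auto simp: multiple_zeros_def\<close>)
  then obtain P where P: "\<psi> = poly P" by blast
  have "degree P > 0"
  proof (rule ccontr)
    assume "\<not> degree P > 0"
    then have "pderiv P = 0" by (simp add: pderiv_eq_0_iff)
    then show False using Z(10) by (simp add: P)
  qed
  then show ?thesis using not_few_solutions_poly_const[OF _ c] few_solutions\<psi> P by blast
qed

end

section \<open>The model problem at a simple pole\<close>

lemma conv_at_constant_sequence: "isCont h z \<Longrightarrow> conv_at (\<lambda>_. h) h z"
  unfolding conv_at_def case_prod_unfold isCont_def
  by (rule filterlim_compose[OF _ filterlim_snd]) (simp add: tendsto_at_iff_tendsto_nhds)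

text \<open>By the maximum principle, differences that are uniformly small on the circle are
  uniformly small on the disc. The limit inside is a new function, as nothing is assumed about
  \<open>g\<close> off the circle.\<close>

lemma conv_at_fill:
  assumes hol: "\<forall>\<^sub>F n in sequentially. F n holomorphic_on ball a R" and r: "0 < r" "r < R"
    and F: "\<And>z. z \<in> sphere a r \<Longrightarrow> conv_at F g z"
  shows "\<exists>g'. \<forall>z\<in>ball a r. conv_at F g' z"
proof -
  have sub: "cball a r \<subseteq> ball a R" using r by auto
  have ul: "uniform_limit (sphere a r) F g sequentially" by (rule conv_at_uniform) (use F in auto)
  have "uniformly_Cauchy_on (cball a r) (\<lambda>n. F (n))"
    unfolding uniformly_Cauchy_on_def
  proof (intro allI impI)
    fix e :: real assume e: "e > 0"
    have "\<forall>\<^sub>F n in sequentially. (\<forall>x\<in>sphere a r. dist (F n x) (g x) < e / 3) \<and> F n holomorphic_on ball a R"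
      using ul[unfolded uniform_limit_iff, rule_format, of "e / 3"] hol e by (intro eventually_conj) auto
    then obtain N where N: "\<And>n x. n \<ge> N \<Longrightarrow> x \<in> sphere a r \<Longrightarrow> dist (F n x) (g x) < e / 3"
      "\<And>n. n \<ge> N \<Longrightarrow> F n holomorphic_on ball a R"
      unfolding eventually_sequentially by blast
    have "dist (F m x) (F n x) < e" if x: "x \<in> cball a r" and mn: "m \<ge> N" "n \<ge> N" for x m n
    proof -
      have h: "(\<lambda>x. F m x - F n x) holomorphic_on cball a r"
        by (intro holomorphic_intros holomorphic_on_subset[OF N(2) sub] mn)
      have "cmod (F m x - F n x) \<le> e / 3 + e / 3"
      proof (rule maximum_modulus_frontier[of "\<lambda>x. F m x - F n x" "cball a r"])
        fix z assume "z \<in> frontier (cball a r)"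
        then have z: "z \<in> sphere a r" using r by auto
        then show "cmod (F m z - F n z) \<le> e / 3 + e / 3"
          using N(1)[OF mn(1) z] N(1)[OF mn(2) z] dist_triangle2[of "F m z" "F n z" "g z"] by (simp add: dist_norm)
      qed (use h x in \<open>auto intro: holomorphic_on_subset holomorphic_on_imp_continuous_on\<close>)
      then show ?thesis using e by (simp add: dist_norm)
    qed
    then show "\<exists>M. \<forall>x\<in>cball a r. \<forall>m\<ge>M. \<forall>n\<ge>M. dist (F m x) (F n x) < e" by blast
  qed
  then obtain g' where g': "uniform_limit (cball a r) F g' sequentially"
    using Cauchy_uniformly_convergent[of "cball a r" F] unfolding uniformly_convergent_on_def by auto
  have ev: "\<forall>\<^sub>F n in sequentially. continuous_on (cball a r) (F n) \<and> F n holomorphic_on ball a r"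
    using hol by eventually_elim
      (meson sub ball_subset_cball holomorphic_on_imp_continuous_on holomorphic_on_subset)
  then have "continuous_on (cball a r) g'"
    by (rule holomorphic_uniform_limit[OF _ g']) auto
  then have "continuous_on (ball a r) g'" by (rule continuous_on_subset) auto
  moreover have "uniform_limit (ball a r) F g' sequentially" by (rule uniform_limit_on_subset[OF g']) auto
  ultimately have "conv_at F g' z" if "z \<in> ball a r" for z
    using uniform_imp_conv_at[of "ball a r" F g' z] that by auto
  then show ?thesis by blast
qed

text \<open>The maximum principle for the reciprocals, which are holomorphic because the functions
  have no zeros in the closed disc.\<close>

lemma conv_inf_at_fill:
  assumes hol: "\<And>n. F n holomorphic_on ball a R" and r: "0 < r" "r < R"
    and nz: "\<And>n z. z \<in> cball a r \<Longrightarrow> F n z \<noteq> 0"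
    and F: "\<And>z. z \<in> sphere a r \<Longrightarrow> conv_inf_at F z" and z: "z \<in> ball a r"
  shows "conv_inf_at F z"
  unfolding conv_inf_at_iff
proof
  fix B :: real
  define B' where "B' = max B 1"
  have sub: "cball a r \<subseteq> ball a R" using r by auto
  obtain d where d: "d > 0" "ball z d \<subseteq> ball a r" using z open_ball open_contains_ball by blast
  have "\<forall>\<^sub>F n in sequentially. \<forall>x\<in>sphere a r. 2 * B' < norm (F n x)" by (rule conv_inf_at_uniform) (use F in auto)
  then obtain N where N: "\<And>n x. n \<ge> N \<Longrightarrow> x \<in> sphere a r \<Longrightarrow> 2 * B' < norm (F n x)"
    unfolding eventually_sequentially by blast
  have "B < norm (F n x)" if n: "n \<ge> N" and x: "x \<in> ball z d" for n x
  proof -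
    have xr: "x \<in> cball a r" using x d by auto
    have h: "(\<lambda>x. inverse (F n x)) holomorphic_on cball a r"
      using holomorphic_on_subset[OF hol sub] nz by (intro holomorphic_intros) auto
    have "cmod (inverse (F n x)) \<le> inverse (2 * B')"
    proof (rule maximum_modulus_frontier[of "\<lambda>x. inverse (F n x)" "cball a r"])
      fix w assume "w \<in> frontier (cball a r)"
      then have "w \<in> sphere a r" using r by auto
      then have "2 * B' < norm (F n w)" using N n by blast
      then show "cmod (inverse (F n w)) \<le> inverse (2 * B')"
        unfolding norm_inverse by (intro le_imp_inverse_le) (auto simp: B'_def)
    qed (use h xr in \<open>auto intro: holomorphic_on_subset holomorphic_on_imp_continuous_on\<close>)
    then have "inverse (norm (F n x)) \<le> inverse (2 * B')" by (simp only: norm_inverse)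
    then have "2 * B' \<le> norm (F n x)" using nz[OF xr, of n] by (subst (asm) inverse_le_iff_le) (auto simp: B'_def)
    then show ?thesis by (simp add: B'_def)
  qed
  then show "\<exists>N. \<exists>r>0. \<forall>n\<ge>N. \<forall>x\<in>ball z r. B < norm (F n x)" using d(1) by blast
qed

context diffpoly_exponents
begin

lemma normal_at_regular_eventually:
  assumes R: "R > 0" and ev: "\<forall>\<^sub>F n in sequentially. F n holomorphic_on ball z0 R \<and> multiple_zeros (F n) (ball z0 R)
      \<and> few_solutions (F n) (hn n) (ball z0 R) \<and> hn n holomorphic_on ball z0 R"
    and hn: "\<And>z. z \<in> ball z0 R \<Longrightarrow> conv_at hn h z" "\<And>z. z \<in> ball z0 R \<Longrightarrow> h z \<noteq> 0"
  shows "\<exists>t r. strict_mono (t :: nat \<Rightarrow> nat) \<and> r > 0 \<and> conv_on (\<lambda>n. F (t n)) (ball z0 r)"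
proof -
  obtain N where N: "\<And>n. n \<ge> N \<Longrightarrow> F n holomorphic_on ball z0 R \<and> multiple_zeros (F n) (ball z0 R)
      \<and> few_solutions (F n) (hn n) (ball z0 R) \<and> hn n holomorphic_on ball z0 R"
    using ev unfolding eventually_sequentially by blast
  have "\<exists>t r. strict_mono (t :: nat \<Rightarrow> nat) \<and> r > 0 \<and> conv_on (\<lambda>n. F (N + t n)) (ball z0 r)"
    by (rule normal_at_regular[of R "\<lambda>n. F (N + n)" z0 "\<lambda>n. hn (N + n)" h])
      (use N R hn conv_at_subseq[of hn h _ "\<lambda>n. N + n"] in \<open>auto simp: strict_mono_def\<close>)
  then obtain t r where "strict_mono (t :: nat \<Rightarrow> nat)" "r > 0" "conv_on (\<lambda>n. F (N + t n)) (ball z0 r)" by blast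
  then show ?thesis by (intro exI[of _ "\<lambda>n. N + t n"] exI[of _ r]) (auto simp: strict_mono_def)
qed

text \<open>The expression \<open>\<rho> * (b / (\<rho> * \<zeta>))\<close> does not depend on
  \<open>\<rho>\<close>, so the simple pole uses up one factor of \<open>\<rho> ^ dp_ord\<close> and
  leaves this condition on \<open>a\<close>.\<close>

lemma scale_factor:
  assumes "\<rho> > 0"
  obtains a :: real where "a > 0" "a ^ dp_deg = \<rho> ^ (dp_ord - 1)"
proof
  show "root dp_deg (\<rho> ^ (dp_ord - 1)) > 0" using assms dp_deg_pos by simp
  show "root dp_deg (\<rho> ^ (dp_ord - 1)) ^ dp_deg = \<rho> ^ (dp_ord - 1)" using assms dp_deg_pos by simp
qed

lemma few_solutions_affine_pole:
  assumes S: "open S" "f holomorphic_on S" and a: "a > 0" "a ^ dp_deg = \<rho> ^ (dp_ord - 1)" and \<rho>: "\<rho> > (0::real)"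
    and few_solutions: "few_solutions f h S" and h: "\<And>\<zeta>. b + of_real \<rho> * \<zeta> \<in> S \<Longrightarrow> h' \<zeta> = of_real \<rho> * h (b + of_real \<rho> * \<zeta>)"
  shows "few_solutions (\<lambda>\<zeta>. of_real a * f (b + of_real \<rho> * \<zeta>)) h' {\<zeta>. b + of_real \<rho> * \<zeta> \<in> S}"
proof (rule few_solutions_affine[OF S _ _ few_solutions])
  fix \<zeta> assume \<zeta>: "b + of_real \<rho> * \<zeta> \<in> S"
  have "complex_of_real \<rho> ^ dp_ord = of_real \<rho> * of_real \<rho> ^ (dp_ord - 1)" using dp_ord_pos by (cases dp_ord) auto
  moreover have "complex_of_real a ^ dp_deg = of_real \<rho> ^ (dp_ord - 1)" using a(2) by (metis of_real_power)
  ultimately show "h' \<zeta> * complex_of_real a ^ dp_deg = of_real \<rho> ^ dp_ord * h (b + of_real \<rho> * \<zeta>)"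
    unfolding h[OF \<zeta>] by (simp only: mult_ac)
qed (use a \<rho> in auto)

text \<open>Rescalings of \<open>f\<close> by radii tending to infinity are normal on the punctured plane. A finite limit would
  bound \<open>f\<close> on large circles, so the limit is infinite, which forces polynomial lower growth.\<close>

lemma pole_model_poly:
  assumes f: "f holomorphic_on UNIV" and nc: "\<not> f constant_on UNIV" and m: "multiple_zeros f UNIV"
    and few_solutions: "few_solutions f (\<lambda>z. b / z) (UNIV - {0})" and b: "b \<noteq> 0"
  shows "\<exists>P. f = poly P"
proof -
  \<comment> \<open>In the scaling adapted to the pole this says that, from some radius on, the
    rescaled functions have modulus at least 1 on the unit circle.\<close>
  have "\<exists>R0\<ge>1. \<forall>z. cmod z \<ge> R0 \<longrightarrow> 1 \<le> cmod z ^ (dp_ord - 1) * cmod (f z) ^ dp_deg"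
  proof (rule ccontr)
    assume neg: "\<not> ?thesis"
    have "\<exists>z. cmod z \<ge> real (Suc n) \<and> cmod z ^ (dp_ord - 1) * cmod (f z) ^ dp_deg < 1" for n
      using neg by (metis not_le of_nat_le_iff of_nat_1 One_nat_def Suc_le_mono le0)
    then obtain x where x: "\<And>n. cmod (x n) \<ge> real (Suc n)" "\<And>n. cmod (x n) ^ (dp_ord - 1) * cmod (f (x n)) ^ dp_deg < 1" by metis
    define \<rho> where "\<rho> = (\<lambda>n. cmod (x n))"
    have \<rho>1: "\<rho> n \<ge> 1" for n using x(1)[of n] by (simp add: \<rho>_def)
    have \<rho>: "\<rho> n > 0" for n using \<rho>1[of n] by linarith
    have "\<exists>a>0. a ^ dp_deg = \<rho> n ^ (dp_ord - 1)" for n using scale_factor[OF \<rho>] by metis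
    then obtain a where a: "\<And>n. a n > 0" "\<And>n. a n ^ dp_deg = \<rho> n ^ (dp_ord - 1)" by metis
    have a1: "a n \<ge> 1" for n
    proof (rule ccontr)
      assume "\<not> a n \<ge> 1"
      then have "a n ^ dp_deg < 1" using a(1)[of n] dp_deg_pos by (simp add: power_less_one_iff)
      moreover have "1 \<le> \<rho> n ^ (dp_ord - 1)" using \<rho>1 by (rule one_le_power)
      ultimately show False using a(2)[of n] by simp
    qed
    define G where "G = (\<lambda>n \<zeta>. of_real (a n) * f (0 + of_real (\<rho> n) * \<zeta>))"
    have hG: "G n holomorphic_on S" for n S unfolding G_def
      by (rule holomorphic_on_subset[OF holomorphic_affine[OF f, of UNIV]]) auto
    have fewG: "few_solutions (G n) (\<lambda>z. b / z) (UNIV - {0})" for n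
    proof -
      have "few_solutions (G n) (\<lambda>z. b / z) {\<zeta>. 0 + of_real (\<rho> n) * \<zeta> \<in> UNIV - {0}}" unfolding G_def
        by (rule few_solutions_affine_pole[OF _ holomorphic_on_subset[OF f] a(1,2) \<rho> few_solutions]) (use \<rho>[of n] in auto)
      moreover have "UNIV - {0} \<subseteq> {\<zeta>. 0 + complex_of_real (\<rho> n) * \<zeta> \<in> UNIV - {0}}" using \<rho>[of n] by auto
      ultimately show ?thesis by (rule few_solutions_subset)
    qed
    have mG: "multiple_zeros (G n) S" for n S
      using multiple_zeros_affine[OF open_UNIV f m, of "of_real (a n)" 0 "of_real (\<rho> n)"] unfolding G_def
      by (rule multiple_zeros_subset) auto
    have "\<exists>t. strict_mono t \<and> conv_on (\<lambda>n. G (t n)) (UNIV - {0})"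
    proof (rule conv_on_patch)
      show "connected (UNIV - {0::complex})" by (intro connected_open_delete) auto
      fix z and s :: "nat \<Rightarrow> nat" assume z: "z \<in> UNIV - {0 :: complex}"
      have sub: "ball z (cmod z) \<subseteq> UNIV - {0}" by (auto simp: dist_norm)
      have hh: "(\<lambda>z. b / z) holomorphic_on ball z (cmod z)" using sub by (intro holomorphic_intros) auto
      show "\<exists>t r. strict_mono (t :: nat \<Rightarrow> nat) \<and> r > 0 \<and> conv_on (\<lambda>n. G (s (t n))) (ball z r)"
      proof (rule normal_at_regular[where hn = "\<lambda>_ z. b / z"])
        show "conv_at (\<lambda>_ z. b / z) (\<lambda>z. b / z) w" if "w \<in> ball z (cmod z)" for w
        proof (rule conv_at_constant_sequence)
          have "w \<noteq> 0" using sub that by auto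
          then show "isCont (\<lambda>z. b / z) w" by (intro continuous_intros)
        qed
        show "few_solutions (G (s n)) (\<lambda>z. b / z) (ball z (cmod z))" for n using fewG sub by (rule few_solutions_subset)
        show "b / w \<noteq> 0" if "w \<in> ball z (cmod z)" for w using that sub b by auto
      qed (use z hG mG hh in auto)
    qed auto
    then obtain t where t: "strict_mono t" "conv_on (\<lambda>n. G (t n)) (UNIV - {0})" by blast
    have small: "cmod (G n (x n / of_real (\<rho> n))) < 1" for n
    proof -
      have "cmod (G n (x n / of_real (\<rho> n))) = a n * cmod (f (x n))" using \<rho>[of n] a(1)[of n] by (simp add: G_def norm_mult)
      moreover have "(a n * cmod (f (x n))) ^ dp_deg < 1" using x(2)[of n] by (simp add: power_mult_distrib a(2) \<rho>_def)
      then have "a n * cmod (f (x n)) < 1" using a(1)[of n] by (metis less_le_not_le mult_nonneg_nonneg norm_ge_zero not_less one_le_power)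
      ultimately show ?thesis by simp
    qed
    have one: "cmod (x n / of_real (\<rho> n)) = 1" for n using \<rho>[of n] by (simp add: \<rho>_def norm_divide)
    from t(2) show False unfolding conv_on_def
    proof
      assume "\<forall>z\<in>UNIV - {0}. conv_inf_at (\<lambda>n. G (t n)) z"
      then have "\<forall>\<^sub>F n in sequentially. \<forall>z\<in>sphere 0 1. 1 < cmod (G (t n) z)" by (intro conv_inf_at_uniform) auto
      then obtain n where "\<forall>z\<in>sphere 0 1. 1 < cmod (G (t n) z)" using eventually_happens by force
      then show False using small[of "t n"] one[of "t n"] by force
    next
      assume "\<exists>g. \<forall>z\<in>UNIV - {0}. conv_at (\<lambda>n. G (t n)) g z"
      then obtain g where g: "\<And>z. z \<noteq> 0 \<Longrightarrow> conv_at (\<lambda>n. G (t n)) g z" by blast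
      have "g holomorphic_on UNIV - {0}"
        by (rule conv_at_holomorphic[where F = "\<lambda>n. G (t n)"]) (use g hG in \<open>auto simp: holo_near_def intro!: exI[of _ 1]\<close>)
      then have "continuous_on (sphere 0 1) g"
        by (intro holomorphic_on_imp_continuous_on) (auto elim: holomorphic_on_subset)
      then have "compact (g ` sphere 0 1)" by (intro compact_continuous_image) auto
      then obtain C where C: "\<And>z. cmod z = 1 \<Longrightarrow> cmod (g z) \<le> C"
        using compact_imp_bounded bounded_iff by (metis imageI mem_sphere_0)
      have "uniform_limit (sphere 0 1) (\<lambda>n. G (t n)) g sequentially" by (rule conv_at_uniform) (auto intro!: g)
      then have ev: "\<forall>\<^sub>F n in sequentially. \<forall>z\<in>sphere 0 1. dist (G (t n) z) (g z) < 1"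
        unfolding uniform_limit_iff by auto
      \<comment> \<open>The factors \<open>a n\<close> are at least 1, so a bound for the rescaled
        functions on the unit circle bounds \<open>f\<close> on circles of radius
        \<open>\<rho> (t n)\<close>, and these radii tend to infinity.\<close>
      have bound: "cmod (f z) \<le> C + 1" for z
      proof -
        obtain N where N: "\<And>n. n \<ge> N \<Longrightarrow> \<forall>z\<in>sphere 0 1. dist (G (t n) z) (g z) < 1"
          using ev unfolding eventually_sequentially by blast
        obtain m where m: "cmod z \<le> real m" using real_arch_simple by blast
        define n where "n = max N m"
        have "real m \<le> real (Suc (t n))" using seq_suble[OF t(1), of n] by (simp add: n_def)
        then have zr: "cmod z \<le> \<rho> (t n)" using m x(1)[of "t n"] by (simp add: \<rho>_def)
        show ?thesis
        proof (rule cball_max_modulus[OF f, of 0 "\<rho> (t n)"])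
          fix w assume w: "cmod (w - 0) = \<rho> (t n)"
          define \<zeta> where "\<zeta> = w / of_real (\<rho> (t n))"
          have \<zeta>: "cmod \<zeta> = 1" using w \<rho>[of "t n"] by (simp add: \<zeta>_def norm_divide)
          have "cmod (G (t n) \<zeta>) \<le> C + 1"
          proof -
            have "dist (G (t n) \<zeta>) (g \<zeta>) < 1" using N[of n] \<zeta> by (simp add: n_def)
            then show ?thesis using C[OF \<zeta>] norm_triangle_sub[of "G (t n) \<zeta>" "g \<zeta>"] by (simp add: dist_norm)
          qed
          moreover have "cmod (G (t n) \<zeta>) = a (t n) * cmod (f w)"
            using \<rho>[of "t n"] a(1)[of "t n"] by (simp add: G_def \<zeta>_def norm_mult)
          moreover have "1 * cmod (f w) \<le> a (t n) * cmod (f w)" using a1 by (intro mult_right_mono) auto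
          ultimately show "cmod (f w) \<le> C + 1" by simp
        qed (use \<rho> zr in auto)
      qed
      have "bounded (range f)" unfolding bounded_iff using bound by blast
      then show False using Liouville_theorem[OF f] nc by blast
    qed
  qed
  then obtain R0 where R0: "R0 \<ge> 1" "\<And>z. cmod z \<ge> R0 \<Longrightarrow> 1 \<le> cmod z ^ (dp_ord - 1) * cmod (f z) ^ dp_deg" by blast
  \<comment> \<open>One factor \<open>z\<close> more than in the lower bound, so that
    \<open>\<Psi>\<close> tends to infinity and is a polynomial. It dominates
    \<open>f ^ dp_deg\<close> outside the unit disc.\<close>
  define \<Psi> where "\<Psi> = (\<lambda>z. z ^ dp_ord * f z ^ dp_deg)"
  have big: "cmod z \<le> cmod (\<Psi> z)" if "cmod z \<ge> R0" for z
  proof -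
    have "cmod (\<Psi> z) = cmod z * (cmod z ^ (dp_ord - 1) * cmod (f z) ^ dp_deg)"
      using dp_ord_pos by (cases dp_ord) (auto simp: \<Psi>_def norm_mult norm_power)
    moreover have "cmod z * 1 \<le> cmod z * (cmod z ^ (dp_ord - 1) * cmod (f z) ^ dp_deg)"
      using R0(2)[OF that] by (intro mult_left_mono) auto
    ultimately show ?thesis by simp
  qed
  have "\<Psi> holomorphic_on UNIV" unfolding \<Psi>_def by (intro holomorphic_intros f)
  moreover have "((inverse \<circ> \<Psi>) \<longlongrightarrow> 0) at_infinity"
  proof (rule Lim_null_comparison)
    show "((\<lambda>z::complex. inverse (cmod z)) \<longlongrightarrow> 0) at_infinity"
      by (intro tendsto_inverse_0_at_top filterlim_norm_at_top)
    show "\<forall>\<^sub>F z in at_infinity. cmod ((inverse \<circ> \<Psi>) z) \<le> inverse (cmod z)"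
      unfolding eventually_at_infinity
    proof (intro exI[of _ R0] allI impI)
      fix z assume z: "R0 \<le> cmod z"
      then have "0 < cmod z" using R0(1) by linarith
      then show "cmod ((inverse \<circ> \<Psi>) z) \<le> inverse (cmod z)"
        unfolding o_def norm_inverse using big[OF z] by (intro le_imp_inverse_le)
    qed
  qed
  ultimately obtain c n where cn: "\<And>z. \<Psi> z = (\<Sum>i\<le>n. c i * z ^ i)" using pole_at_infinity by metis
  have "\<Psi> = poly (\<Sum>i\<le>n. monom (c i) i)" by (rule ext) (simp add: cn poly_sum poly_monom)
  then have "poly_bounded UNIV 0 \<Psi>" using poly_bounded_poly by metis
  then have "poly_bounded UNIV 0 (\<lambda>z. f z ^ dp_deg)"
  proof (rule poly_bounded_mono)
    fix r z assume "1 \<le> r" "cmod (z - 0) = r"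
    then have "1 \<le> cmod z ^ dp_ord" by (intro one_le_power) simp
    then have "1 * cmod (f z ^ dp_deg) \<le> cmod z ^ dp_ord * cmod (f z ^ dp_deg)" by (rule mult_right_mono) simp
    then show "cmod (f z ^ dp_deg) \<le> cmod (\<Psi> z)" by (simp add: \<Psi>_def norm_mult norm_power)
  qed
  then have "poly_bounded UNIV 0 f" using dp_deg_pos by (rule poly_bounded_root)
  then show ?thesis by (rule poly_bounded_imp_poly[OF f]) (rule bexI[of _ "_ :: real"], auto)
qed

text \<open>The scale \<open>\<sigma>\<close> at which the rescaled function first reaches size \<open>1\<close>, but not below the
  scale of the zero \<open>x0\<close>.\<close>

lemma critical_scale:
  fixes G :: "complex \<Rightarrow> complex" and e :: real
  assumes G: "G holomorphic_on ball z0 R" and e: "0 < e" "e < R" and x0: "x0 \<in> ball z0 e" "G x0 = 0"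
    and big: "\<And>x. x \<in> sphere z0 e \<Longrightarrow> 1 \<le> e ^ m * cmod (G x) ^ l" and l: "l > 0"
  obtains \<sigma> x where "0 < \<sigma>" "cmod (x0 - z0) \<le> \<sigma>" "\<sigma> \<le> e" "x \<in> cball z0 \<sigma>" "1 \<le> \<sigma> ^ m * cmod (G x) ^ l"
    "\<sigma> = cmod (x0 - z0) \<or> (\<forall>x\<in>ball z0 \<sigma>. \<sigma> ^ m * cmod (G x) ^ l \<le> 1)"
proof -
  define D where "D = (\<lambda>(x, s). s ^ m * cmod (G x) ^ l)"
  \<comment> \<open>A pair consists of a point and a scale; the point lies in the closed disc of
    that radius, and scales start at the distance of the zero \<open>x0\<close>.\<close>
  define K where "K = cball z0 e \<times> {cmod (x0 - z0)..e} \<inter> {p. cmod (fst p - z0) \<le> snd p}"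
  have sub: "cball z0 e \<subseteq> ball z0 R" using e by auto
  have cG: "continuous_on (cball z0 e) G"
    using G sub by (meson holomorphic_on_imp_continuous_on holomorphic_on_subset)
  have cK: "compact K" unfolding K_def
    by (intro compact_Int_closed compact_Times closed_Collect_le continuous_intros) auto
  have c1: "continuous_on K (\<lambda>p. G (fst p))"
    by (rule continuous_on_compose2[OF cG]) (auto simp: K_def intro: continuous_intros)
  have cD: "continuous_on K D" unfolding D_def case_prod_unfold
    by (intro continuous_on_mult continuous_on_power continuous_on_norm c1 continuous_on_snd continuous_on_id)
  define A where "A = {p \<in> K. 1 \<le> D p}"
  have "closed A" unfolding A_def
    using continuous_on_closed_Collect_le[OF continuous_on_const cD, of 1] compact_imp_closed[OF cK] by simp
  moreover have "A = K \<inter> A" by (auto simp: A_def)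
  ultimately have cA: "compact A" using compact_Int_closed[OF cK] by metis
  have x0e: "cmod (x0 - z0) < e" using x0(1) by (simp add: dist_norm norm_minus_commute)
  have "(z0 + of_real e, e) \<in> A"
    using big[of "z0 + of_real e"] e x0e by (auto simp: A_def K_def D_def dist_norm)
  then have "A \<noteq> {}" by auto
  moreover have "continuous_on A snd" by (intro continuous_intros)
  ultimately obtain p where p: "p \<in> A" "\<And>p'. p' \<in> A \<Longrightarrow> snd p \<le> snd p'"
    using continuous_attains_inf[OF cA] by blast
  define x \<sigma> where "x = fst p" and "\<sigma> = snd p"
  have xs: "x \<in> cball z0 \<sigma>" "cmod (x0 - z0) \<le> \<sigma>" "\<sigma> \<le> e" "1 \<le> \<sigma> ^ m * cmod (G x) ^ l"
    using p(1) by (auto simp: A_def K_def D_def x_def \<sigma>_def case_prod_unfold dist_norm norm_minus_commute)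
  have min: "\<sigma> \<le> s" if "(y, s) \<in> A" for y s using p(2)[OF that] by (simp add: \<sigma>_def)
  \<comment> \<open>Scale 0 would force \<open>x = x0 = z0\<close>, where \<open>G\<close> vanishes;
    \<open>l > 0\<close> makes this a contradiction even for \<open>m = 0\<close>, where
    \<open>0 ^ m = 1\<close>.\<close>
  have \<sigma>0: "\<sigma> > 0"
  proof (rule ccontr)
    assume "\<not> \<sigma> > 0"
    then have s: "\<sigma> = 0" using xs(2) norm_ge_zero[of "x0 - z0"] by linarith
    then have "x0 = z0" "x = z0" using xs(1,2) by auto
    then show False using xs(4) x0(2) l s by (simp add: zero_power)
  qed
  have "\<sigma> ^ m * cmod (G y) ^ l \<le> 1" if ne: "\<sigma> \<noteq> cmod (x0 - z0)" and y: "y \<in> ball z0 \<sigma>" for y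
  proof -
    define s0 where "s0 = max (cmod (x0 - z0)) (cmod (y - z0))"
    have s0: "s0 < \<sigma>" using ne xs(2) y by (auto simp: s0_def dist_norm norm_minus_commute)
    have "((\<lambda>s. s ^ m * cmod (G y) ^ l) \<longlongrightarrow> \<sigma> ^ m * cmod (G y) ^ l) (at_left \<sigma>)"
      by (intro tendsto_intros)
    then show ?thesis
    proof (rule tendsto_upperbound)
      show "\<forall>\<^sub>F s in at_left \<sigma>. s ^ m * cmod (G y) ^ l \<le> 1"
      proof (rule eventually_at_leftI[OF _ s0])
        fix s assume s: "s \<in> {s0<..<\<sigma>}"
        then have "(y, s) \<notin> A" using min[of y s] by auto
        then show "s ^ m * cmod (G y) ^ l \<le> 1"
          using s xs(3) by (auto simp: A_def K_def D_def s0_def dist_norm norm_minus_commute)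
      qed
    qed simp
  qed
  then show thesis using that[of \<sigma> x] xs \<sigma>0 by blast
qed

end

section \<open>Normality at simple poles\<close>

context diffpoly_exponents
begin

text \<open>The remaining bad case: the functions are large on circles shrinking to the pole, yet
  have zeros inside. Rescaling about the pole at the critical scale keeps a zero and a point of
  modulus at least 1 in the closed unit disc, so the limit is non-constant, and the polynomial count
  contradicts it.\<close>

lemma zeros_collapsing_to_pole:
  assumes R: "R > 0" and F: "\<And>n. F n holomorphic_on ball z0 R" "\<And>n. multiple_zeros (F n) (ball z0 R)"
    and few_solutions: "\<And>n. few_solutions (F n) h (ball z0 R - {z0})"
    and b: "b holomorphic_on ball z0 R" "\<And>z. z \<in> ball z0 R \<Longrightarrow> b z \<noteq> 0"
    and h: "\<And>z. z \<in> ball z0 R - {z0} \<Longrightarrow> h z = b z / (z - z0)"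
    and x0: "\<And>n. x0 n \<in> ball z0 (\<epsilon> n)" "\<And>n. F n (x0 n) = 0" and \<epsilon>: "\<And>n. 0 < \<epsilon> n" "\<And>n. \<epsilon> n < R" "\<epsilon> \<longlonglongrightarrow> 0"
    and big: "\<And>n x. x \<in> sphere z0 (\<epsilon> n) \<Longrightarrow> 1 \<le> \<epsilon> n ^ (dp_ord - 1) * cmod (F n x) ^ dp_deg"
  shows False
proof -
  have "\<exists>\<sigma> x. 0 < \<sigma> \<and> cmod (x0 n - z0) \<le> \<sigma> \<and> \<sigma> \<le> \<epsilon> n \<and> x \<in> cball z0 \<sigma> \<and> 1 \<le> \<sigma> ^ (dp_ord - 1) * cmod (F n x) ^ dp_deg \<and>
    (\<sigma> = cmod (x0 n - z0) \<or> (\<forall>x\<in>ball z0 \<sigma>. \<sigma> ^ (dp_ord - 1) * cmod (F n x) ^ dp_deg \<le> 1))" for n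
    using critical_scale[OF F(1) \<epsilon>(1,2) x0(1,2) big dp_deg_pos, of n] by metis
  then obtain \<sigma> \<xi> where \<sigma>: "\<And>n. 0 < \<sigma> n" "\<And>n. cmod (x0 n - z0) \<le> \<sigma> n" "\<And>n. \<sigma> n \<le> \<epsilon> n"
    "\<And>n. \<xi> n \<in> cball z0 (\<sigma> n)" "\<And>n. 1 \<le> \<sigma> n ^ (dp_ord - 1) * cmod (F n (\<xi> n)) ^ dp_deg"
    "\<And>n. \<sigma> n = cmod (x0 n - z0) \<or> (\<forall>x\<in>ball z0 (\<sigma> n). \<sigma> n ^ (dp_ord - 1) * cmod (F n x) ^ dp_deg \<le> 1)"
    by metis
  have "\<exists>a>0. a ^ dp_deg = \<sigma> n ^ (dp_ord - 1)" for n using scale_factor[OF \<sigma>(1)] by metis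
  then obtain a where a: "\<And>n. a n > 0" "\<And>n. a n ^ dp_deg = \<sigma> n ^ (dp_ord - 1)" by metis
  have \<sigma>0: "\<sigma> \<longlonglongrightarrow> 0"
    by (rule tendsto_sandwich[OF _ _ tendsto_const \<epsilon>(3)]) (use \<sigma>(1,3) in \<open>auto simp: less_imp_le\<close>)
  define P where "P = ball z0 R - {z0}"
  have P: "open P" by (auto simp: P_def)
  define V where "V = (\<lambda>n \<zeta>. of_real (a n) * F n (z0 + of_real (\<sigma> n) * \<zeta>))"
  \<comment> \<open>The rescaled right-hand side; the factor \<open>\<sigma> n\<close> is absorbed
    by the pole, and the limit is \<open>b z0 / \<zeta>\<close>.\<close>
  define c where "c = (\<lambda>n \<zeta>. b (z0 + of_real (\<sigma> n) * \<zeta>) * (1 / \<zeta>))"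
  define T where "T = (\<lambda>n. {\<zeta>. z0 + of_real (\<sigma> n) * \<zeta> \<in> ball z0 R})"
  define T' where "T' = (\<lambda>n. {\<zeta>. z0 + of_real (\<sigma> n) * \<zeta> \<in> P})"
  have T': "T' n = T n - {0}" for n using \<sigma>(1)[of n] by (auto simp: T_def T'_def P_def)
  have hV: "V n holomorphic_on T n" for n
    unfolding V_def T_def by (rule holomorphic_affine[OF F(1)]) auto
  have hb: "(\<lambda>\<zeta>. b (z0 + of_real (\<sigma> n) * \<zeta>)) holomorphic_on T n" for n
    using holomorphic_affine[OF b(1), of "T n" z0 "of_real (\<sigma> n)" 1] by (auto simp: T_def)
  have mV: "multiple_zeros (V n) (T n)" for n
    unfolding V_def T_def by (rule multiple_zeros_affine[OF open_ball F(1) F(2)])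
  have fV: "few_solutions (V n) (c n) (T' n)" for n
    unfolding V_def T'_def
  proof (rule few_solutions_affine_pole[OF P _ a(1,2) \<sigma>(1)])
    show "F n holomorphic_on P" using F(1) by (rule holomorphic_on_subset) (auto simp: P_def)
    show "few_solutions (F n) h P" using few_solutions by (simp add: P_def)
    fix \<zeta> assume "z0 + complex_of_real (\<sigma> n) * \<zeta> \<in> P"
    then show "c n \<zeta> = of_real (\<sigma> n) * h (z0 + of_real (\<sigma> n) * \<zeta>)"
      using h[of "z0 + of_real (\<sigma> n) * \<zeta>"] \<sigma>(1)[of n] by (simp add: c_def P_def)
  qed
  have evT: "\<forall>\<^sub>F n in sequentially. ball z 1 \<subseteq> T n" for z
    using scaled_in_open[OF open_ball tendsto_const _ \<sigma>0, of z0 z0 R z] R unfolding T_def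
    by (auto elim: eventually_mono)
  have cc: "conv_at c (\<lambda>\<zeta>. b z0 * (1 / \<zeta>)) z" if "z \<noteq> 0" for z
    unfolding c_def
  proof (rule conv_at_mult)
    have "isCont b z0"
      using b(1) R by (auto simp: continuous_on_eq_continuous_at dest: holomorphic_on_imp_continuous_on)
    then have "conv_at (\<lambda>_. b) b z0" by (rule conv_at_constant_sequence)
    then show "conv_at (\<lambda>n \<zeta>. b (z0 + of_real (\<sigma> n) * \<zeta>)) (\<lambda>_. b z0) z"
      using conv_at_scaled[of "\<lambda>_. b" b z0 "\<lambda>_. z0" \<sigma> z] \<sigma>0 by simp
    show "conv_at (\<lambda>_ \<zeta>. 1 / \<zeta>) (\<lambda>\<zeta>. 1 / \<zeta>) z"
      using that by (intro conv_at_constant_sequence continuous_intros)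
  qed
  have b0: "b z0 \<noteq> 0" using b(2) R by simp
  have evz: "\<forall>\<^sub>F n in sequentially. ball z (min 1 (cmod z)) \<subseteq> T' n" for z
    using evT[of z]
  proof eventually_elim
    case (elim n)
    have "0 \<notin> ball z (min 1 (cmod z))" by (simp add: dist_norm)
    then show ?case unfolding T' using elim by (auto simp: subset_iff)
  qed
  have conn: "connected (UNIV - {0::complex})" by (intro connected_open_delete) auto
  have "\<exists>t. strict_mono t \<and> conv_on (\<lambda>n. V (t n)) (UNIV - {0})"
  proof (rule conv_on_patch[OF _ conn])
    fix z and s :: "nat \<Rightarrow> nat" assume z: "z \<in> UNIV - {0 :: complex}" and s: "strict_mono s"
    show "\<exists>t r. strict_mono (t :: nat \<Rightarrow> nat) \<and> r > 0 \<and> conv_on (\<lambda>n. V (s (t n))) (ball z r)"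
    proof (rule normal_at_regular_eventually[where hn = "\<lambda>n. c (s n)" and h = "\<lambda>\<zeta>. b z0 * (1 / \<zeta>)"])
      let ?B = "ball z (min 1 (cmod z))"
      show "\<forall>\<^sub>F n in sequentially. V (s n) holomorphic_on ?B \<and> multiple_zeros (V (s n)) ?B \<and> few_solutions (V (s n)) (c (s n)) ?B \<and> c (s n) holomorphic_on ?B"
        using eventually_subseq[OF s evz[of z]]
      proof eventually_elim
        case (elim n)
        then have sub: "?B \<subseteq> T (s n)" "0 \<notin> ?B" unfolding T' by (auto simp: subset_iff)
        show ?case
        proof (intro conjI)
          show "V (s n) holomorphic_on ?B" using hV sub(1) by (rule holomorphic_on_subset)
          show "multiple_zeros (V (s n)) ?B" using mV sub(1) by (rule multiple_zeros_subset)
          show "few_solutions (V (s n)) (c (s n)) ?B" using fV elim by (rule few_solutions_subset)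
          show "c (s n) holomorphic_on ?B" unfolding c_def
            using sub(2) by (intro holomorphic_on_mult holomorphic_on_subset[OF hb sub(1)] holomorphic_on_divide
                holomorphic_on_const holomorphic_on_ident) auto
        qed
      qed
      show "conv_at (\<lambda>n. c (s n)) (\<lambda>\<zeta>. b z0 * (1 / \<zeta>)) w" if "w \<in> ?B" for w
        by (rule conv_at_subseq[OF cc s]) (use that in \<open>auto simp: dist_norm\<close>)
      show "b z0 * (1 / w) \<noteq> 0" if "w \<in> ?B" for w using that b0 by (auto simp: dist_norm)
    qed (use z in auto)
  qed auto
  then obtain u where u: "strict_mono u" "conv_on (\<lambda>n. V (u n)) (UNIV - {0})" by blast
  define \<zeta>0 where "\<zeta>0 = (\<lambda>n. (x0 n - z0) / of_real (\<sigma> n))"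
  define \<eta> where "\<eta> = (\<lambda>n. (\<xi> n - z0) / of_real (\<sigma> n))"
  have \<zeta>0: "V n (\<zeta>0 n) = 0" "cmod (\<zeta>0 n) \<le> 1" for n
    using \<sigma>(1,2)[of n] x0(2)[of n] by (simp_all add: V_def \<zeta>0_def norm_divide)
  have sc: "(a n * cmod w) ^ dp_deg = \<sigma> n ^ (dp_ord - 1) * cmod w ^ dp_deg" for n w by (simp add: power_mult_distrib a(2))
  have \<eta>: "1 \<le> cmod (V n (\<eta> n))" "cmod (\<eta> n) \<le> 1" for n
  proof -
    have "1 \<le> (a n * cmod (F n (\<xi> n))) ^ dp_deg" unfolding sc by (rule \<sigma>(5))
    then have "1 \<le> a n * cmod (F n (\<xi> n))"
      using a(1)[of n] dp_deg_pos by (metis less_imp_le mult_nonneg_nonneg norm_ge_zero not_le power_less_one_iff)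
    then show "1 \<le> cmod (V n (\<eta> n))" using \<sigma>(1)[of n] a(1)[of n] by (simp add: V_def \<eta>_def norm_mult)
    show "cmod (\<eta> n) \<le> 1" using \<sigma>(1,4)[of n] by (simp add: \<eta>_def norm_divide dist_norm norm_minus_commute)
  qed
  \<comment> \<open>Either the zero sits on the unit circle or, by minimality of the scale, the
    modulus at \<open>1/2\<close> is at most 1. Both prevent an infinite limit on the punctured
    plane; \<open>1/2\<close> is merely some non-zero point of the open disc.\<close>
  have alt: "cmod (\<zeta>0 n) = 1 \<or> cmod (V n (1/2)) \<le> 1" for n
    using \<sigma>(6)[of n]
  proof
    assume "\<sigma> n = cmod (x0 n - z0)"
    then show ?thesis using \<sigma>(1)[of n] by (simp add: \<zeta>0_def norm_divide)
  next
    assume le: "\<forall>x\<in>ball z0 (\<sigma> n). \<sigma> n ^ (dp_ord - 1) * cmod (F n x) ^ dp_deg \<le> 1"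
    have "z0 + of_real (\<sigma> n) * (1/2) \<in> ball z0 (\<sigma> n)" using \<sigma>(1)[of n] by (simp add: dist_norm norm_mult)
    then have "(a n * cmod (F n (z0 + of_real (\<sigma> n) * (1/2)))) ^ dp_deg \<le> 1" unfolding sc using le by blast
    then have "a n * cmod (F n (z0 + of_real (\<sigma> n) * (1/2))) \<le> 1"
      using a(1)[of n] dp_deg_pos by (metis not_le one_less_power)
    then show ?thesis using a(1)[of n] by (simp add: V_def norm_mult)
  qed
  have "\<not> (\<forall>z\<in>UNIV - {0}. conv_inf_at (\<lambda>n. V (u n)) z)"
  proof
    assume "\<forall>z\<in>UNIV - {0}. conv_inf_at (\<lambda>n. V (u n)) z"
    then have "\<forall>\<^sub>F n in sequentially. \<forall>z\<in>insert (1/2) (sphere 0 1). 1 < cmod (V (u n) z)"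
      by (intro conv_inf_at_uniform) auto
    then obtain n where n: "\<forall>z\<in>insert (1/2) (sphere 0 1). 1 < cmod (V (u n) z)"
      using eventually_happens by force
    then show False using alt[of "u n"] \<zeta>0(1)[of "u n"] by force
  qed
  then obtain g where g: "\<And>z. z \<noteq> 0 \<Longrightarrow> conv_at (\<lambda>n. V (u n)) g z" using u(2) unfolding conv_on_def by blast
  have "\<forall>\<^sub>F n in sequentially. \<sigma> (u n) < R / 2"
    using eventually_subseq[OF u(1) order_tendstoD(2)[OF \<sigma>0, of "R / 2"]] R by simp
  then have hol2: "\<forall>\<^sub>F n in sequentially. V (u n) holomorphic_on ball 0 2"
  proof eventually_elim
    case (elim n)
    have "ball 0 2 \<subseteq> T (u n)"
    proof
      fix \<zeta> :: complex assume "\<zeta> \<in> ball 0 2"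
      then have "\<sigma> (u n) * cmod \<zeta> \<le> \<sigma> (u n) * 2" using \<sigma>(1)[of "u n"] by (intro mult_left_mono) auto
      then have "\<sigma> (u n) * cmod \<zeta> < R" using elim by linarith
      then show "\<zeta> \<in> T (u n)" using \<sigma>(1)[of "u n"] by (simp add: T_def dist_norm norm_mult)
    qed
    then show ?case using hV holomorphic_on_subset by blast
  qed
  \<comment> \<open>Convergence is known only off 0; the maximum principle fills in the
    disc.\<close>
  have "\<exists>g'. \<forall>z\<in>ball 0 1. conv_at (\<lambda>n. V (u n)) g' z"
    by (rule conv_at_fill[OF hol2, where g = g]) (auto intro!: g)
  then obtain g' where g': "\<And>z. z \<in> ball 0 1 \<Longrightarrow> conv_at (\<lambda>n. V (u n)) g' z" by blast
  define G where "G = (\<lambda>z. if z \<in> ball 0 1 then g' z else g z)"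
  have VG: "conv_at (\<lambda>n. V (u n)) G z" for z
  proof (cases "z \<in> ball 0 1")
    case True
    then show ?thesis using g'[OF True] by (simp add: conv_at_def G_def)
  next
    case False
    then have "z \<noteq> 0" by auto
    then show ?thesis using g False by (simp add: conv_at_def G_def)
  qed
  have eT: "\<forall>\<^sub>F n in sequentially. ball z 1 \<subseteq> T (u n)" for z
    using eventually_subseq[OF u(1) evT[of z]] .
  have VE: "holo_near (\<lambda>n. V (u n)) z" for z
    unfolding holo_near_def
    by (intro exI[of _ 1] conjI eventually_mono[OF eT[of z]]) (auto intro: holomorphic_on_subset[OF hV])
  have hG: "G holomorphic_on UNIV" by (rule conv_at_holomorphic[OF _ VG VE]) auto
  \<comment> \<open>The zeros \<open>\<zeta>0 n\<close> stay in the closed unit disc, so a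
    subsequence converges to a zero of \<open>G\<close>. The points \<open>\<eta> n\<close> give
    \<open>z2\<close> in the same way.\<close>
  obtain z1 where z1: "G z1 = 0"
  proof -
    have "\<forall>n. \<zeta>0 (u n) \<in> cball 0 1" using \<zeta>0(2) by simp
    then obtain l v where v: "strict_mono (v :: nat \<Rightarrow> nat)" "((\<lambda>n. \<zeta>0 (u n)) \<circ> v) \<longlonglongrightarrow> l"
      using compact_cball[of "0::complex" 1] unfolding compact_def by metis
    have "(\<lambda>n. V (u (v n)) (\<zeta>0 (u (v n)))) \<longlonglongrightarrow> G l"
      by (rule conv_at_seq[OF conv_at_subseq[OF VG v(1)]]) (use v(2) in \<open>simp add: o_def\<close>)
    then have "G l = 0" using \<zeta>0(1) by (simp add: LIMSEQ_const_iff)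
    then show ?thesis using that by blast
  qed
  obtain z2 where z2: "cmod (G z2) \<ge> 1"
  proof -
    have "\<forall>n. \<eta> (u n) \<in> cball 0 1" using \<eta>(2) by simp
    then obtain l v where v: "strict_mono (v :: nat \<Rightarrow> nat)" "((\<lambda>n. \<eta> (u n)) \<circ> v) \<longlonglongrightarrow> l"
      using compact_cball[of "0::complex" 1] unfolding compact_def by metis
    have "(\<lambda>n. V (u (v n)) (\<eta> (u (v n)))) \<longlonglongrightarrow> G l"
      by (rule conv_at_seq[OF conv_at_subseq[OF VG v(1)]]) (use v(2) in \<open>simp add: o_def\<close>)
    then have "1 \<le> cmod (G l)"
      using tendsto_lowerbound[OF tendsto_norm, of _ "G l" sequentially 1] \<eta>(1) by auto
    then show ?thesis using that by blast
  qed
  have nc: "\<not> G constant_on UNIV" using z1 z2 unfolding constant_on_def by force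
  have "few_solutions G (\<lambda>\<zeta>. b z0 * (1 / \<zeta>)) (UNIV - {0})"
  proof (rule few_solutions_limit[OF _ conn VG VE, where T = "\<lambda>n. T' (u n)" and h = "\<lambda>n. c (u n)"])
    show "few_solutions (V (u n)) (c (u n)) (T' (u n))" for n by (rule fV)
    fix z :: complex assume z: "z \<in> UNIV - {0}"
    have z': "\<forall>\<^sub>F n in sequentially. ball z (min 1 (cmod z)) \<subseteq> T' (u n)"
      using eventually_subseq[OF u(1) evz[of z]] .
    then show "\<exists>r>0. \<forall>\<^sub>F n in sequentially. ball z r \<subseteq> T' (u n)" using z by (intro exI[of _ "min 1 (cmod z)"]) auto
    show "conv_at (\<lambda>n. c (u n)) (\<lambda>\<zeta>. b z0 * (1 / \<zeta>)) z" by (rule conv_at_subseq[OF cc u(1)]) (use z in auto)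
    show "holo_near (\<lambda>n. c (u n)) z"
      unfolding holo_near_def
    proof (intro exI[of _ "min 1 (cmod z)"] conjI)
      show "\<forall>\<^sub>F n in sequentially. c (u n) holomorphic_on ball z (min 1 (cmod z))"
        using z'
      proof eventually_elim
        case (elim n)
        then have sub: "ball z (min 1 (cmod z)) \<subseteq> T (u n)" "0 \<notin> ball z (min 1 (cmod z))" unfolding T' by auto
        show ?case unfolding c_def
          using sub(2) by (intro holomorphic_on_mult holomorphic_on_subset[OF hb sub(1)] holomorphic_on_divide
              holomorphic_on_const holomorphic_on_ident) auto
      qed
    qed (use z in auto)
  qed auto
  then have fewG: "few_solutions G (\<lambda>z. b z0 / z) (UNIV - {0})" by simp
  have "\<exists>z\<in>UNIV. G z \<noteq> 0" using z2 by (intro bexI[of _ z2]) auto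
  then have mG: "multiple_zeros G UNIV"
    by (intro multiple_zeros_limit[OF open_UNIV connected_UNIV VG VE, where T = "\<lambda>n. T (u n)"])
      (use mV eT in \<open>auto intro: exI[of _ 1]\<close>)
  obtain PG where PG: "G = poly PG" using pole_model_poly[OF hG nc mG fewG b0] by blast
  have "degree PG > 0"
  proof (rule ccontr)
    assume "\<not> degree PG > 0"
    then obtain d where "PG = [:d:]" using degree_eq_zeroE by blast
    then show False using nc by (auto simp: PG constant_on_def)
  qed
  then show False using not_few_solutions_poly_pole[OF _ b0] mG fewG PG by blast
qed

text \<open>Off the pole a subsequence converges. A finite limit extends across \<open>z0\<close> by
  the maximum principle, and so does an infinite one if infinitely many members are zero-free near
  \<open>z0\<close>. Otherwise almost all members have zeros, which must run into
  \<open>z0\<close>.\<close>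

lemma normal_at_pole:
  assumes R: "R > 0" and F: "\<And>n. F n holomorphic_on ball z0 R" "\<And>n. multiple_zeros (F n) (ball z0 R)"
    and few_solutions: "\<And>n. few_solutions (F n) h (ball z0 R - {z0})"
    and b: "b holomorphic_on ball z0 R" "\<And>z. z \<in> ball z0 R \<Longrightarrow> b z \<noteq> 0"
    and h: "\<And>z. z \<in> ball z0 R - {z0} \<Longrightarrow> h z = b z / (z - z0)"
  shows "\<exists>t r. strict_mono (t :: nat \<Rightarrow> nat) \<and> r > 0 \<and> conv_on (\<lambda>n. F (t n)) (ball z0 r)"
proof -
  define P where "P = ball z0 R - {z0}"
  have P: "open P" "connected P" unfolding P_def by (auto intro!: connected_open_delete)
  have hh: "h holomorphic_on P"
  proof -
    have "(\<lambda>z. b z / (z - z0)) holomorphic_on P"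
      by (intro holomorphic_intros holomorphic_on_subset[OF b(1)]) (auto simp: P_def)
    then show ?thesis by (rule holomorphic_transform) (use h in \<open>auto simp: P_def\<close>)
  qed
  have "\<exists>t. strict_mono t \<and> conv_on (\<lambda>n. F (t n)) P"
  proof (rule conv_on_patch[OF P])
    fix z and s :: "nat \<Rightarrow> nat" assume z: "z \<in> P"
    obtain e where e: "e > 0" "ball z e \<subseteq> P" using P(1) z open_contains_ball by blast
    show "\<exists>t r. strict_mono (t :: nat \<Rightarrow> nat) \<and> r > 0 \<and> conv_on (\<lambda>n. F (s (t n))) (ball z r)"
    proof (rule normal_at_regular[OF e(1), where hn = "\<lambda>_. h" and h = h])
      have sub: "ball z e \<subseteq> ball z0 R" using e(2) by (auto simp: P_def)
      show "F (s n) holomorphic_on ball z e" for n using F(1) sub by (rule holomorphic_on_subset)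
      show "multiple_zeros (F (s n)) (ball z e)" for n using F(2) sub by (rule multiple_zeros_subset)
      show "few_solutions (F (s n)) h (ball z e)" for n using few_solutions e(2) unfolding P_def by (rule few_solutions_subset)
      show "h holomorphic_on ball z e" using hh e(2) by (rule holomorphic_on_subset)
      fix w assume w: "w \<in> ball z e"
      then have wP: "w \<in> P" using e(2) by blast
      have "isCont h w" using hh P(1) wP by (auto simp: continuous_on_eq_continuous_at dest: holomorphic_on_imp_continuous_on)
      then show "conv_at (\<lambda>_. h) h w" by (rule conv_at_constant_sequence)
      show "h w \<noteq> 0" using wP h[of w] b(2)[of w] by (auto simp: P_def)
    qed
  qed
  then obtain t where t: "strict_mono t" "conv_on (\<lambda>n. F (t n)) P" by blast
  define r where "r = R / 2"
  have r: "0 < r" "r < R" using R by (auto simp: r_def)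
  have sP: "sphere z0 r \<subseteq> P" using r by (auto simp: P_def)
  from t(2) show ?thesis unfolding conv_on_def[of _ P]
  proof
    assume "\<exists>g. \<forall>z\<in>P. conv_at (\<lambda>n. F (t n)) g z"
    then obtain g where g: "\<And>z. z \<in> P \<Longrightarrow> conv_at (\<lambda>n. F (t n)) g z" by blast
    have "\<exists>g'. \<forall>z\<in>ball z0 r. conv_at (\<lambda>n. F (t n)) g' z"
      by (rule conv_at_fill[OF _ r, where g = g]) (use F(1) g sP in auto)
    then show ?thesis using t(1) r(1) unfolding conv_on_def by blast
  next
    assume inf: "\<forall>z\<in>P. conv_inf_at (\<lambda>n. F (t n)) z"
    show ?thesis
    proof (cases "\<exists>\<^sub>F n in sequentially. \<forall>z\<in>cball z0 r. F (t n) z \<noteq> 0")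
      case True
      then have "infinite {n. \<forall>z\<in>cball z0 r. F (t n) z \<noteq> 0}"
        by (simp add: frequently_cofinite flip: cofinite_eq_sequentially)
      then obtain s :: "nat \<Rightarrow> nat" where s: "strict_mono s" "\<And>n z. z \<in> cball z0 r \<Longrightarrow> F (t (s n)) z \<noteq> 0"
        by (auto dest!: infinite_enumerate)
      have "conv_inf_at (\<lambda>n. F (t (s n))) z" if "z \<in> ball z0 r" for z
        by (rule conv_inf_at_fill[OF _ r _ _ that]) (use F(1) s sP inf conv_inf_at_subseq[OF _ s(1), of "\<lambda>n. F (t n)"] in auto)
      moreover have "strict_mono (\<lambda>n. t (s n))" using t(1) s(1) by (simp add: strict_mono_def)
      ultimately show ?thesis using r(1) unfolding conv_on_def by (intro exI[of _ "\<lambda>n. t (s n)"] exI[of _ r]) auto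
    next
      case False
      then have ev: "\<forall>\<^sub>F n in sequentially. \<exists>z\<in>cball z0 r. F (t n) z = 0" by (simp add: not_frequently)
      define \<epsilon> where "\<epsilon> = (\<lambda>k::nat. r * (1 / real (Suc k)))"
      have \<epsilon>: "0 < \<epsilon> k" "\<epsilon> k \<le> r" for k using r by (auto simp: \<epsilon>_def field_simps)
      have \<epsilon>0: "\<epsilon> \<longlonglongrightarrow> 0" unfolding \<epsilon>_def
        by (rule tendsto_mult_right_zero) (rule lim_1_over_n[THEN LIMSEQ_Suc])
      define C where "C k n \<longleftrightarrow> (\<exists>x0\<in>ball z0 (\<epsilon> k). F (t n) x0 = 0) \<and>
        (\<forall>x\<in>sphere z0 (\<epsilon> k). 1 \<le> \<epsilon> k ^ (dp_ord - 1) * cmod (F (t n) x) ^ dp_deg)" for k n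
      have "\<forall>\<^sub>F n in sequentially. C k n" for k
      proof -
        \<comment> \<open>\<open>B \<ge> 1\<close> excludes zeros outside
          \<open>ball z0 (\<epsilon> k)\<close> and allows passing to the power
          \<open>dp_deg\<close>; the other term supplies the size demanded on the sphere.\<close>
        define B where "B = max 1 (1 / \<epsilon> k ^ (dp_ord - 1))"
        have K: "compact (cball z0 r - ball z0 (\<epsilon> k))" by (intro compact_diff) auto
        have "\<forall>\<^sub>F n in sequentially. \<forall>x\<in>cball z0 r - ball z0 (\<epsilon> k). B < cmod (F (t n) x)"
          by (rule conv_inf_at_uniform[OF K]) (use inf r \<epsilon>(1)[of k] in \<open>auto simp: P_def\<close>)
        with ev show ?thesis
        proof eventually_elim
          case (elim n)
          obtain x0 where x0: "x0 \<in> cball z0 r" "F (t n) x0 = 0" using elim(1) by blast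
          have "x0 \<in> ball z0 (\<epsilon> k)"
          proof (rule ccontr)
            assume "x0 \<notin> ball z0 (\<epsilon> k)"
            then have "B < cmod (F (t n) x0)" using elim(2) x0(1) by blast
            then show False using x0(2) by (simp add: B_def)
          qed
          moreover have "1 \<le> \<epsilon> k ^ (dp_ord - 1) * cmod (F (t n) x) ^ dp_deg" if "x \<in> sphere z0 (\<epsilon> k)" for x
          proof -
            have lt: "B < cmod (F (t n) x)" using elim(2) that \<epsilon>(2)[of k] by auto
            then have "cmod (F (t n) x) ^ 1 \<le> cmod (F (t n) x) ^ dp_deg"
              using dp_deg_pos by (intro power_increasing) (auto simp: B_def)
            then have "B \<le> cmod (F (t n) x) ^ dp_deg" using lt by simp
            then have "1 / \<epsilon> k ^ (dp_ord - 1) \<le> cmod (F (t n) x) ^ dp_deg" by (simp add: B_def)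
            then show ?thesis using \<epsilon>(1)[of k] by (simp add: pos_divide_le_eq mult.commute)
          qed
          ultimately show ?case using x0(2) unfolding C_def by blast
        qed
      qed
      then obtain s :: "nat \<Rightarrow> nat" where s: "\<And>k. C k (s k)" using strict_mono_choice by blast
      then have "\<forall>k. \<exists>x0. x0 \<in> ball z0 (\<epsilon> k) \<and> F (t (s k)) x0 = 0" unfolding C_def by blast
      then obtain x0 where x0: "\<And>k. x0 k \<in> ball z0 (\<epsilon> k)" "\<And>k. F (t (s k)) (x0 k) = 0" by metis
      have lt: "\<epsilon> k < R" for k using \<epsilon>(2)[of k] r(2) by linarith
      have big: "1 \<le> \<epsilon> k ^ (dp_ord - 1) * cmod (F (t (s k)) x) ^ dp_deg" if "x \<in> sphere z0 (\<epsilon> k)" for k x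
        using s[of k] that unfolding C_def by blast
      show ?thesis
        using zeros_collapsing_to_pole[OF R F(1) F(2) few_solutions b h x0 \<epsilon>(1) lt \<epsilon>0 big] by blast
    qed
  qed
qed

end

section \<open>The spherical metric and the main theorem\<close>

definition inv_ext :: "complex \<Rightarrow> complex option" where
  "inv_ext a = (if a = 0 then None else Some (inverse a))"

lemma norm_le_sqrt: "cmod a \<le> sqrt (1 + (cmod a)\<^sup>2)"
  by (rule real_le_rsqrt) simp

lemma one_le_sqrt: "1 \<le> sqrt (1 + (cmod a)\<^sup>2)"
  by simp

text \<open>Inversion preserves the chordal metric, which is at most twice the Euclidean one. Here
  this is checked directly: each \<open>sqrt (1 + x\<^sup>2)\<close> is bounded below by
  \<open>x\<close>, the modulus of the inverse, and these factors cancel.\<close>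

lemma chordal_inv_ext: "chordal (inv_ext a) (inv_ext b) \<le> 2 * cmod (a - b)"
proof -
  have bd: "2 / sqrt (1 + (cmod (inverse a))\<^sup>2) \<le> 2 * cmod a" if "a \<noteq> 0" for a
  proof -
    have "2 / sqrt (1 + (cmod (inverse a))\<^sup>2) \<le> 2 / cmod (inverse a)"
      using that
      by (intro divide_left_mono mult_pos_pos norm_le_sqrt less_le_trans[OF zero_less_one one_le_sqrt]) auto
    then show ?thesis by (simp add: norm_inverse divide_inverse)
  qed
  show ?thesis
  proof (cases "a = 0 \<or> b = 0")
    case True
    then show ?thesis using bd[of a] bd[of b] by (auto simp: inv_ext_def)
  next
    case False
    define s where "s = (\<lambda>a. sqrt (1 + (cmod (inverse a))\<^sup>2))"
    define v where "v = inverse a - inverse b"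
    have le: "cmod (inverse a) * cmod (inverse b) \<le> s a * s b"
      unfolding s_def by (intro mult_mono norm_le_sqrt) auto
    have pos: "0 < cmod (inverse a) * cmod (inverse b)" using False by simp
    have "v = inverse a * (b - a) * inverse b" using False by (simp add: v_def field_simps)
    then have "cmod v = cmod (inverse a) * cmod (b - a) * cmod (inverse b)" by (simp only: norm_mult)
    then have "2 * cmod v / (cmod (inverse a) * cmod (inverse b)) = 2 * cmod (a - b)"
      using False by (simp add: norm_minus_commute)
    moreover have "2 * cmod v / (s a * s b) \<le> 2 * cmod v / (cmod (inverse a) * cmod (inverse b))"
    proof (rule divide_left_mono[OF le])
      show "0 < s a * s b * (cmod (inverse a) * cmod (inverse b))" by (rule mult_pos_pos[OF less_le_trans[OF pos le] pos])
    qed simp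
    ultimately show ?thesis using False by (simp add: inv_ext_def s_def v_def)
  qed
qed

lemma chordal_inv_ext_zero: "a \<noteq> 0 \<Longrightarrow> chordal (inv_ext a) (Some 0) \<le> 2 / cmod a"
proof -
  assume "a \<noteq> 0"
  moreover have "2 * cmod (inverse a) / sqrt (1 + (cmod (inverse a))\<^sup>2) \<le> 2 * cmod (inverse a) / 1"
    using one_le_sqrt[of "inverse a"] by (intro divide_left_mono) (auto intro: add_pos_nonneg)
  ultimately show ?thesis by (simp add: inv_ext_def norm_inverse divide_inverse)
qed

section \<open>Meromorphic functions and their reciprocals\<close>

lemma pole_factor:
  assumes "f nicely_meromorphic_on D" "open D" "z \<in> D" "is_pole f z"
  obtains g r where "r > 0" "ball z r \<subseteq> D" "g holomorphic_on ball z r" "\<And>w. w \<in> ball z r \<Longrightarrow> g w \<noteq> 0"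
    "\<And>w. w \<in> ball z r - {z} \<Longrightarrow> f w = g w / (w - z) ^ nat (- zorder f z)"
proof -
  have "f meromorphic_on {z}"
    using assms(1,3) unfolding nicely_meromorphic_on_def by (auto intro: meromorphic_on_subset)
  then have "isolated_singularity_at f z" by (simp add: meromorphic_at_iff)
  then obtain e where e: "e > 0" "f analytic_on ball z e - {z}" by (auto simp: isolated_singularity_at_def)
  have "f holomorphic_on (ball z e \<inter> D) - {z}"
    using e(2) by (intro analytic_imp_holomorphic) (auto elim: analytic_on_subset)
  moreover have "open (ball z e \<inter> D)" "z \<in> ball z e \<inter> D" using assms e by auto
  ultimately obtain r where r: "zor_poly f z z \<noteq> 0" "r > 0" "cball z r \<subseteq> ball z e \<inter> D"
    "zor_poly f z holomorphic_on cball z r"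
    "\<forall>w\<in>cball z r - {z}. f w = zor_poly f z w / (w - z) ^ nat (- zorder f z) \<and> zor_poly f z w \<noteq> 0"
    using zorder_exist_pole[of f "ball z e \<inter> D" z] assms(4) by blast
  show thesis
  proof (rule that[of r "zor_poly f z"])
    show "ball z r \<subseteq> D" using r(3) by (auto simp: subset_iff)
    show "zor_poly f z holomorphic_on ball z r" using r(4) by (rule holomorphic_on_subset) auto
    show "zor_poly f z w \<noteq> 0" if "w \<in> ball z r" for w
      using r(1,5) that by (cases "w = z") auto
    show "f w = zor_poly f z w / (w - z) ^ nat (- zorder f z)" if "w \<in> ball z r - {z}" for w
      using r(5) that by auto
  qed (rule r(2))
qed

text \<open>At a pole the function cannot tend to its own value, so the other clause of being nicely
  meromorphic applies. Since \<open>inverse 0 = 0\<close>, the pointwise reciprocal is already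
  correct at poles.\<close>

lemma nicely_meromorphic_pole_value:
  assumes "f nicely_meromorphic_on D" "z \<in> D" "is_pole f z"
  shows "f z = 0"
  using assms not_tendsto_and_filterlim_at_infinity[of "at z" f "f z"]
  unfolding nicely_meromorphic_on_def is_pole_def by auto

text \<open>Near a pole of order \<open>n\<close> the reciprocal is
  \<open>(w - z) ^ n / g w\<close>, also at \<open>w = z\<close> because both sides are 0 there;
  \<open>n \<ge> 2\<close> makes its derivative vanish.\<close>

lemma reciprocal_of_zero_free:
  assumes f: "f nicely_meromorphic_on D" and D: "open D"
    and nz: "\<And>z. z \<in> D \<Longrightarrow> \<not> is_pole f z \<Longrightarrow> f z \<noteq> 0"
    and ord: "\<And>z. z \<in> D \<Longrightarrow> is_pole f z \<Longrightarrow> zorder f z \<le> -2"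
  shows "(\<lambda>z. inverse (f z)) holomorphic_on D" "multiple_zeros (\<lambda>z. inverse (f z)) D"
    "\<And>z. z \<in> D \<Longrightarrow> ext_val f z = inv_ext (inverse (f z))"
    "\<And>z. z \<in> D \<Longrightarrow> inverse (f z) = 0 \<longleftrightarrow> is_pole f z"
proof -
  have f0: "f z = 0" if "z \<in> D" "is_pole f z" for z
    using nicely_meromorphic_pole_value[OF f that] .
  show iff: "inverse (f z) = 0 \<longleftrightarrow> is_pole f z" if "z \<in> D" for z
    using f0[OF that] nz[OF that] by auto
  then show "ext_val f z = inv_ext (inverse (f z))" if "z \<in> D" for z
    using that by (auto simp: ext_val_def inv_ext_def)
  have pole: "(\<lambda>z. inverse (f z)) analytic_on {z} \<and> deriv (\<lambda>z. inverse (f z)) z = 0"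
    if z: "z \<in> D" "is_pole f z" for z
  proof -
    obtain g r where g: "r > 0" "ball z r \<subseteq> D" "g holomorphic_on ball z r" "\<And>w. w \<in> ball z r \<Longrightarrow> g w \<noteq> 0"
      "\<And>w. w \<in> ball z r - {z} \<Longrightarrow> f w = g w / (w - z) ^ nat (- zorder f z)"
      by (rule pole_factor[OF f D z]) (rule that)
    define n where "n = nat (- zorder f z)"
    have n: "n \<ge> 2" using ord[OF z] by (simp add: n_def)
    have eq: "inverse (f w) = (w - z) ^ n / g w" if "w \<in> ball z r" for w
      using g(5)[of w] f0[OF z] that n by (cases "w = z") (auto simp: n_def)
    have "(\<lambda>w. (w - z) ^ n / g w) holomorphic_on ball z r"
      using g(4) by (intro holomorphic_intros g(3)) auto
    then have "(\<lambda>w. inverse (f w)) holomorphic_on ball z r"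
      by (rule holomorphic_transform) (simp add: eq)
    then have 1: "(\<lambda>w. inverse (f w)) analytic_on {z}"
      using g(1) analytic_at[of _ z] by (meson centre_in_ball open_ball)
    have "(g has_field_derivative deriv g z) (at z)" using g(1) by (intro holomorphic_derivI[OF g(3)]) auto
    moreover have "((\<lambda>w. (w - z) ^ n) has_field_derivative of_nat n * (z - z) ^ (n - 1)) (at z)"
      by (auto intro!: derivative_eq_intros)
    ultimately have "((\<lambda>w. (w - z) ^ n / g w) has_field_derivative
        (of_nat n * (z - z) ^ (n - 1) * g z - (z - z) ^ n * deriv g z) / (g z * g z)) (at z)"
      using g(1,4) by (intro DERIV_divide) auto
    moreover have "of_nat n * (z - z) ^ (n - 1) * g z - (z - z) ^ n * deriv g z = 0"
      using n by (simp add: power_0_left)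
    ultimately have "((\<lambda>w. (w - z) ^ n / g w) has_field_derivative 0) (at z)" by simp
    then have "deriv (\<lambda>w. (w - z) ^ n / g w) z = 0" by (rule DERIV_imp_deriv)
    moreover have "deriv (\<lambda>w. inverse (f w)) z = deriv (\<lambda>w. (w - z) ^ n / g w) z"
      by (rule deriv_cong_open[of "ball z r"]) (use g(1) eq in auto)
    ultimately show ?thesis using 1 by simp
  qed
  have "(\<lambda>z. inverse (f z)) analytic_on {z}" if "z \<in> D" for z
  proof (cases "is_pole f z")
    case False
    then show ?thesis
      using nicely_meromorphic_on_imp_analytic_at[OF f that] nz[OF that] by (intro analytic_on_inverse) auto
  qed (use pole that in blast)
  then have "(\<lambda>z. inverse (f z)) analytic_on D" using analytic_on_analytic_at by blast
  then show "(\<lambda>z. inverse (f z)) holomorphic_on D" by (rule analytic_imp_holomorphic)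
  show "multiple_zeros (\<lambda>z. inverse (f z)) D" unfolding multiple_zeros_def using pole iff by blast
qed

text \<open>The point \<open>w\<close> makes the zeros of \<open>g\<close> isolated, so they become
  poles of the reciprocal, and the value \<open>inverse 0 = 0\<close> is the one required at a
  pole.\<close>

lemma nicely_meromorphic_inverse:
  assumes D: "open D" "connected D" and g: "g holomorphic_on D" and w: "w \<in> D" "g w \<noteq> 0"
  shows "(\<lambda>z. inverse (g z)) nicely_meromorphic_on D"
    and "\<And>z. z \<in> D \<Longrightarrow> ext_val (\<lambda>z. inverse (g z)) z = inv_ext (g z)"
proof -
  have ga: "g analytic_on D" using g D by (simp add: analytic_on_open)
  have cont: "(g \<longlongrightarrow> g z) (at z)" if "z \<in> D" for z
    using g D(1) that by (metis continuous_on_eq_continuous_at continuous_at holomorphic_on_imp_continuous_on)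
  have zero: "is_pole (\<lambda>z. inverse (g z)) z" if z: "z \<in> D" "g z = 0" for z
  proof -
    have "\<forall>\<^sub>F x in at z. g x \<noteq> 0"
      using non_zero_neighbour_alt[OF g D z(1) w] by (rule eventually_mono) auto
    then have "filterlim g (at 0) (at z)" using cont[OF z(1)] z(2) by (auto intro: filterlim_atI)
    then show ?thesis unfolding is_pole_def by (rule filterlim_compose[OF filterlim_inverse_at_infinity])
  qed
  have nonzero: "(\<lambda>z. inverse (g z)) \<midarrow>z\<rightarrow> inverse (g z)" if "z \<in> D" "g z \<noteq> 0" for z
    using cont that by (intro tendsto_inverse) auto
  have "(\<lambda>z. inverse (g z)) meromorphic_on D"
    by (intro meromorphic_intros analytic_on_imp_meromorphic_on ga)
  then show "(\<lambda>z. inverse (g z)) nicely_meromorphic_on D"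
    unfolding nicely_meromorphic_on_def using zero nonzero by force
  show "ext_val (\<lambda>z. inverse (g z)) z = inv_ext (g z)" if z: "z \<in> D" for z
  proof (cases "g z = 0")
    case True
    then show ?thesis using zero[OF z] by (simp add: ext_val_def inv_ext_def)
  next
    case False
    then have "\<not> is_pole (\<lambda>z. inverse (g z)) z"
      using nonzero[OF z] not_tendsto_and_filterlim_at_infinity[of "at z"] unfolding is_pole_def by force
    then show ?thesis using False by (simp add: ext_val_def inv_ext_def)
  qed
qed

theorem theorem1:
  fixes D :: "complex set" and Fam :: "(complex \<Rightarrow> complex) set"
    and h :: "complex \<Rightarrow> complex"
    and k :: nat and p q :: "nat \<Rightarrow> nat"
  assumes D: "open D" "connected D" "D \<noteq> {}"
    and k: "k \<ge> 1"
    and pq: "\<forall>i\<in>{1..k}. p i \<ge> q i"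
    and qpos: "(\<Sum>i\<in>{1..k}. q i) > 0"
    and F_mero: "\<forall>f\<in>Fam. f nicely_meromorphic_on D"
    and F_nonzero: "\<forall>f\<in>Fam. \<forall>z\<in>D. \<not> is_pole f z \<longrightarrow> f z \<noteq> 0"
    and F_poles: "\<forall>f\<in>Fam. \<forall>z\<in>D. is_pole f z \<longrightarrow> zorder f z \<le> -2"
    and h_mero: "h nicely_meromorphic_on D"
    and h_nonzero: "\<forall>z\<in>D. \<not> is_pole h z \<longrightarrow> h z \<noteq> 0"
    and h_notinf: "\<not> (\<forall>z\<in>D. is_pole h z)"
    and h_poles: "\<forall>z\<in>D. is_pole h z \<longrightarrow> zorder h z = -1"
    and zeros: "\<forall>f\<in>Fam. finite (mero_zeros (\<lambda>z. diffpoly k p q f z - h z) D) \<and>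
                  card (mero_zeros (\<lambda>z. diffpoly k p q f z - h z) D) \<le> diffpoly_weight k p q - 1"
  shows "normal_family_sph Fam D"
  unfolding normal_family_sph_def
proof (intro allI impI)
  interpret diffpoly_exponents k p q by unfold_locales (use pq qpos in auto)
  fix f :: "nat \<Rightarrow> complex \<Rightarrow> complex" assume f: "\<forall>n. f n \<in> Fam"
  define \<phi> where "\<phi> = (\<lambda>n z. inverse (f n z))"
  have \<phi>: "\<phi> n holomorphic_on D" "multiple_zeros (\<phi> n) D" "\<And>z. z \<in> D \<Longrightarrow> ext_val (f n) z = inv_ext (\<phi> n z)"
    "\<And>z. z \<in> D \<Longrightarrow> \<phi> n z = 0 \<longleftrightarrow> is_pole (f n) z" for n
    unfolding \<phi>_def
    using reciprocal_of_zero_free[of "f n" D] F_mero F_nonzero F_poles f D(1) by auto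
  have dp_weight: "dp_weight = diffpoly_weight k p q" by (simp add: dp_weight_def dp_deg_def dp_ord_def diffpoly_weight_def)
  have wpos: "dp_weight > 0" using dp_deg_pos by (simp add: dp_weight_def)
  \<comment> \<open>Where \<open>h\<close> is finite, a solution of the numerator equation with
    \<open>\<phi> n \<noteq> 0\<close> is a zero of \<open>Q[f n] - h\<close>; solutions are counted
    there only.\<close>
  define D' where "D' = {z\<in>D. \<not> is_pole h z}"
  have h_an: "h analytic_on {z}" if "z \<in> D'" for z
    using nicely_meromorphic_on_imp_analytic_at[OF h_mero] that by (auto simp: D'_def)
  have h_cont: "isCont h z" if "z \<in> D'" for z using h_an[OF that] by (rule analytic_at_imp_isCont)
  have few_solutions\<phi>: "few_solutions (\<phi> n) h D'" for n
  proof -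
    have sub: "{z\<in>D'. \<phi> n z \<noteq> 0 \<and> diffpoly_num (\<phi> n) z = h z * \<phi> n z ^ dp_weight} \<subseteq> mero_zeros (\<lambda>z. diffpoly k p q (f n) z - h z) D"
    proof
      fix z assume "z \<in> {z\<in>D'. \<phi> n z \<noteq> 0 \<and> diffpoly_num (\<phi> n) z = h z * \<phi> n z ^ dp_weight}"
      then have z: "z \<in> D'" "\<phi> n z \<noteq> 0" "diffpoly_num (\<phi> n) z = h z * \<phi> n z ^ dp_weight" by auto
      \<comment> \<open>Membership in \<open>mero_zeros\<close> is defined by a limit, so the
        formula for \<open>diffpoly\<close> is needed on a neighbourhood of
        \<open>z\<close>.\<close>
      define S where "S = D \<inter> \<phi> n -` (- {0})"
      have S: "open S" unfolding S_def
        using \<phi>(1)[of n] D(1) by (intro continuous_open_preimage holomorphic_on_imp_continuous_on) auto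
      have zS: "z \<in> S" using z by (auto simp: S_def D'_def)
      have hS: "\<phi> n holomorphic_on S" using \<phi>(1) by (rule holomorphic_on_subset) (auto simp: S_def)
      have eq: "diffpoly k p q (f n) x = diffpoly_num (\<phi> n) x / \<phi> n x ^ dp_weight" if x: "x \<in> S" for x
      proof -
        have fx: "f n = (\<lambda>x. inverse (\<phi> n x))" by (simp add: \<phi>_def)
        have "(deriv ^^ q i) (\<lambda>x. f n x ^ p i) x = recip_num (\<phi> n) (p i) (q i) x / \<phi> n x ^ (p i + q i)" for i
          unfolding fx by (rule higher_deriv_inverse_power[OF S hS _ x]) (auto simp: S_def)
        then have "diffpoly k p q (f n) x = inverse (\<phi> n x) ^ p 0 * (diffpoly_num (\<phi> n) x / \<phi> n x ^ (\<Sum>i\<in>{1..k}. p i + q i))"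
          unfolding diffpoly_def diffpoly_num_def by (simp add: fx prod_dividef power_sum)
        also have "\<dots> = diffpoly_num (\<phi> n) x / \<phi> n x ^ dp_weight"
          by (simp add: dp_weight_def dp_deg_def dp_ord_def sum.distrib power_add power_inverse divide_inverse)
        finally show ?thesis .
      qed
      have cS: "isCont F z" if "F holomorphic_on S" for F
        using that S zS by (metis continuous_on_eq_continuous_at holomorphic_on_imp_continuous_on)
      have "isCont (\<lambda>x. diffpoly_num (\<phi> n) x / \<phi> n x ^ dp_weight - h x) z"
        using z(2) by (intro continuous_intros cS diffpoly_num_holomorphic S hS h_cont z(1)) auto
      then have "((\<lambda>x. diffpoly_num (\<phi> n) x / \<phi> n x ^ dp_weight - h x) \<longlongrightarrow> 0) (at z)"
        using z(2,3) by (simp add: isCont_def)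
      moreover have "\<forall>\<^sub>F x in at z. diffpoly_num (\<phi> n) x / \<phi> n x ^ dp_weight - h x = diffpoly k p q (f n) x - h x"
        using eventually_at_in_open[OF S zS] by eventually_elim (simp add: eq)
      ultimately have "((\<lambda>x. diffpoly k p q (f n) x - h x) \<longlongrightarrow> 0) (at z)" by (rule Lim_transform_eventually)
      then show "z \<in> mero_zeros (\<lambda>z. diffpoly k p q (f n) z - h z) D"
        using z(1) by (simp add: mero_zeros_def D'_def)
    qed
    \<comment> \<open>Finiteness of the zero set allows comparing cardinalities, and
      \<open>wpos\<close> turns the truncated \<open>dp_weight - 1\<close> into a strict
      bound.\<close>
    have "card T < dp_weight" if "T \<subseteq> {z\<in>D'. \<phi> n z \<noteq> 0 \<and> diffpoly_num (\<phi> n) z = h z * \<phi> n z ^ dp_weight}" for T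
    proof -
      have "card T \<le> card (mero_zeros (\<lambda>z. diffpoly k p q (f n) z - h z) D)"
        using zeros f that sub by (intro card_mono) auto
      also have "\<dots> \<le> dp_weight - 1" using zeros f dp_weight by auto
      finally show ?thesis using wpos by linarith
    qed
    then show ?thesis unfolding few_solutions_def by blast
  qed
  have "\<exists>t. strict_mono t \<and> conv_on (\<lambda>n. \<phi> (t n)) D"
  proof (rule conv_on_patch[OF D(1,2)])
    fix z and s :: "nat \<Rightarrow> nat" assume z: "z \<in> D"
    show "\<exists>t r. strict_mono (t :: nat \<Rightarrow> nat) \<and> r > 0 \<and> conv_on (\<lambda>n. \<phi> (s (t n))) (ball z r)"
    proof (cases "is_pole h z")
      case False
      then obtain A where A: "open A" "z \<in> A" "h holomorphic_on A"
        using h_an[of z] z unfolding D'_def analytic_at by blast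
      obtain e where e: "e > 0" "ball z e \<subseteq> A \<inter> D"
        using open_contains_ball[of "A \<inter> D"] A(1,2) D(1) z by blast
      have he: "h holomorphic_on ball z e" using A(3) by (rule holomorphic_on_subset) (use e in auto)
      have sub: "ball z e \<subseteq> D'"
      proof
        fix w assume w: "w \<in> ball z e"
        have "\<not> is_pole h w" by (rule not_is_pole_holomorphic[OF open_ball w he])
        then show "w \<in> D'" using w e by (auto simp: D'_def)
      qed
      have sD: "ball z e \<subseteq> D" using e by auto
      show ?thesis
      proof (rule normal_at_regular[OF e(1), where hn = "\<lambda>_. h" and h = h])
        show "\<phi> (s n) holomorphic_on ball z e" for n using \<phi>(1) sD by (rule holomorphic_on_subset)
        show "multiple_zeros (\<phi> (s n)) (ball z e)" for n using \<phi>(2) sD by (rule multiple_zeros_subset)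
        show "few_solutions (\<phi> (s n)) h (ball z e)" for n using few_solutions\<phi> sub by (rule few_solutions_subset)
        show "conv_at (\<lambda>_. h) h w" if "w \<in> ball z e" for w
          using sub that by (intro conv_at_constant_sequence h_cont) auto
        show "h w \<noteq> 0" if "w \<in> ball z e" for w using h_nonzero sub that by (auto simp: D'_def)
      qed (rule he)
    next
      case True
      obtain b r where b: "r > 0" "ball z r \<subseteq> D" "b holomorphic_on ball z r" "\<And>w. w \<in> ball z r \<Longrightarrow> b w \<noteq> 0"
        "\<And>w. w \<in> ball z r - {z} \<Longrightarrow> h w = b w / (w - z) ^ nat (- zorder h z)"
        by (rule pole_factor[OF h_mero D(1) z True]) (rule that)
      have hb: "h w = b w / (w - z)" if "w \<in> ball z r - {z}" for w
        using b(5)[OF that] h_poles z True by simp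
      have "h holomorphic_on ball z r - {z}"
      proof -
        have "(\<lambda>w. b w / (w - z)) holomorphic_on ball z r - {z}"
          by (intro holomorphic_intros holomorphic_on_subset[OF b(3)]) auto
        then show ?thesis by (rule holomorphic_transform) (simp add: hb)
      qed
      then have "\<not> is_pole h w" if "w \<in> ball z r - {z}" for w
        using not_is_pole_holomorphic[of "ball z r - {z}" w h] that by auto
      then have sub: "ball z r - {z} \<subseteq> D'" using b(2) by (auto simp: D'_def)
      show ?thesis
      proof (rule normal_at_pole[OF b(1) _ _ _ b(3,4) hb])
        show "\<phi> (s n) holomorphic_on ball z r" for n using \<phi>(1) b(2) by (rule holomorphic_on_subset)
        show "multiple_zeros (\<phi> (s n)) (ball z r)" for n using \<phi>(2) b(2) by (rule multiple_zeros_subset)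
        show "few_solutions (\<phi> (s n)) h (ball z r - {z})" for n using few_solutions\<phi> sub by (rule few_solutions_subset)
      qed
    qed
  qed
  then obtain t where t: "strict_mono t" "conv_on (\<lambda>n. \<phi> (t n)) D" by blast
  \<comment> \<open>\<open>G\<close> will be the reciprocal of a limit that is not identically zero,
    or constantly \<open>None\<close> when the limit vanishes identically.\<close>
  have conv: "sph_loc_unif (\<lambda>n. ext_val (f (t n))) G D"
    if g: "\<And>z. z \<in> D \<Longrightarrow> conv_at (\<lambda>n. \<phi> (t n)) g z" and G: "\<And>z. z \<in> D \<Longrightarrow> G z = inv_ext (g z)" for g G
    unfolding sph_loc_unif_def
  proof (intro allI impI)
    fix K and e :: real assume K: "K \<subseteq> D" "compact K" and e: "e > 0"
    have "uniform_limit K (\<lambda>n. \<phi> (t n)) g sequentially" by (rule conv_at_uniform) (use K g in auto)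
    then have "\<forall>\<^sub>F n in sequentially. \<forall>z\<in>K. dist (\<phi> (t n) z) (g z) < e / 2"
      by (rule uniform_limitD) (use e in simp)
    then show "\<forall>\<^sub>F n in sequentially. \<forall>z\<in>K. chordal (ext_val (f (t n)) z) (G z) < e"
    proof eventually_elim
      case (elim n)
      show ?case
      proof
        fix z assume z: "z \<in> K"
        then have "chordal (ext_val (f (t n)) z) (G z) \<le> 2 * cmod (\<phi> (t n) z - g z)"
          using \<phi>(3)[of z "t n"] G[of z] K(1) chordal_inv_ext by auto
        then show "chordal (ext_val (f (t n)) z) (G z) < e" using elim z by (auto simp: dist_norm)
      qed
    qed
  qed
  have "(\<exists>g. g nicely_meromorphic_on D \<and> sph_loc_unif (\<lambda>n. ext_val (f (t n))) (ext_val g) D)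
      \<or> sph_loc_unif (\<lambda>n. ext_val (f (t n))) (\<lambda>_. None) D"
    using t(2) unfolding conv_on_def
  proof
    assume "\<exists>g. \<forall>z\<in>D. conv_at (\<lambda>n. \<phi> (t n)) g z"
    then obtain g where g: "\<And>z. z \<in> D \<Longrightarrow> conv_at (\<lambda>n. \<phi> (t n)) g z" by blast
    have hg: "g holomorphic_on D"
    proof (rule conv_at_holomorphic[OF D(1) g])
      fix z assume "z \<in> D"
      then obtain r where "r > 0" "ball z r \<subseteq> D" using D(1) open_contains_ball by blast
      then show "holo_near (\<lambda>n. \<phi> (t n)) z" unfolding holo_near_def
        by (intro exI[of _ r] conjI always_eventually allI holomorphic_on_subset[OF \<phi>(1)])
    qed
    show ?thesis
    proof (cases "\<exists>w\<in>D. g w \<noteq> 0")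
      case True
      then obtain w where w: "w \<in> D" "g w \<noteq> 0" by blast
      note G = nicely_meromorphic_inverse[OF D(1,2) hg w]
      have "sph_loc_unif (\<lambda>n. ext_val (f (t n))) (ext_val (\<lambda>z. inverse (g z))) D"
        by (rule conv[OF g G(2)])
      then show ?thesis using G(1) by blast
    next
      case False
      then have "sph_loc_unif (\<lambda>n. ext_val (f (t n))) (\<lambda>_. None) D"
        by (intro conv[OF g]) (auto simp: inv_ext_def)
      then show ?thesis by blast
    qed
  next
    assume inf: "\<forall>z\<in>D. conv_inf_at (\<lambda>n. \<phi> (t n)) z"
    \<comment> \<open>An infinite limit of the reciprocals means that the functions themselves tend
      to 0.\<close>
    have "(\<lambda>_. 0) nicely_meromorphic_on D" by (intro analytic_on_imp_nicely_meromorphic_on analytic_on_const)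
    moreover have "sph_loc_unif (\<lambda>n. ext_val (f (t n))) (ext_val (\<lambda>_. 0)) D"
      unfolding sph_loc_unif_def
    proof (intro allI impI)
      fix K and e :: real assume K: "K \<subseteq> D" "compact K" and e: "e > 0"
      have "\<forall>\<^sub>F n in sequentially. \<forall>z\<in>K. 2 / e < cmod (\<phi> (t n) z)"
        by (rule conv_inf_at_uniform) (use K inf in auto)
      then show "\<forall>\<^sub>F n in sequentially. \<forall>z\<in>K. chordal (ext_val (f (t n)) z) (ext_val (\<lambda>_. 0) z) < e"
      proof eventually_elim
        case (elim n)
        show ?case
        proof
          fix z assume z: "z \<in> K"
          then have lt: "2 / e < cmod (\<phi> (t n) z)" using elim by blast
          have pos: "0 < 2 / e" using e by simp
          then have c: "cmod (\<phi> (t n) z) > 0" using lt by linarith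
          have "ext_val (\<lambda>_. 0 :: complex) z = Some 0" by (simp add: ext_val_def)
          then have "chordal (ext_val (f (t n)) z) (ext_val (\<lambda>_. 0) z) \<le> 2 / cmod (\<phi> (t n) z)"
            using \<phi>(3)[of z "t n"] z K(1) c chordal_inv_ext_zero[of "\<phi> (t n) z"] by auto
          also have "\<dots> < e" using lt c e by (simp add: field_simps)
          finally show "chordal (ext_val (f (t n)) z) (ext_val (\<lambda>_. 0) z) < e" .
        qed
      qed
    qed
    ultimately show ?thesis by blast
  qed
  then show "\<exists>r. strict_mono r \<and>
      ((\<exists>g. g nicely_meromorphic_on D \<and> sph_loc_unif (\<lambda>n. ext_val (f (r n))) (ext_val g) D)
       \<or> sph_loc_unif (\<lambda>n. ext_val (f (r n))) (\<lambda>_. None) D)"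
    using t(1) by blast
qed

end
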